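(* Let the regularity assumption (R) and the displacement monotonicity assumption (M) stated in the context hold. Then the following hold. (1) For every $\nu\in\mathcal P_2(\mathbb R^d\times\mathbb R^d)$ there is a unique $\mu=:\Phi(\nu)\in\mathcal P_2(\mathbb R^d\times\mathbb R^d)$ such that $$\mu=\Big((x,p)\mapsto\big(x,-D_pH(x,p,\mu)\big)\Big)_{\#}\nu ,$$ and the resulting map $\Phi:\mathcal P_2(\mathbb R^d\times\mathbb R^d)\to\mathcal P_2(\mathbb R^d\times\mathbb R^d)$ is Lipschitz continuous with respect to $\mathbf d_2$. (2) For all $N$ large enough, the system of equations $$a^{N,i}(\mathbf x,\mathbf p)=-D_pH\big(x^i,p^i,m^{N,-i}_{\mathbf x,\mathbf a^N(\mathbf x,\mathbf p)}\big),\qquad i=1,\dots,N,$$ uniquely defines a map $\mathbf a^N=(a^{N,1},\dots,a^{N,N}):(\mathbb R^d)^N\times(\mathbb R^d)^N\to(\mathbb R^d)^N$, and there is a constant $C$ independent of $N$ such that for all $N$ large enough $$\sum_{i=1}^N|a^{N,i}(\mathbf x,\mathbf p)-a^{N,i}(\overline{\mathbf x},\overline{\mathbf p})|^2\le C\sum_{i=1}^N\big(|x^i-\overline x^i|^2+|p^i-\overline p^i|^2\big)$$ for all $\mathbf x,\mathbf p,\overline{\mathbf x},\overline{\mathbf p}\in(\mathbb R^d)^N$. (3) There is a constant $C$ independent of $N$ such that $$\mathbf d_2^2\Big(\Phi(m^N_{\mathbf x,\mathbf p}),\,m^N_{\mathbf x,\mathbf a^N(\mathbf x,\mathbf p)}\Big)\le\frac{C}{N^2}\sum_{i=1}^N\big(|x^i|^2+|p^i|^2\big)$$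 for all $\mathbf x,\mathbf p\in(\mathbb R^d)^N$ and all $N$ large enough.
   Context: Fix $d\in\mathbb N$ and $T>0$. For $p\ge1$, $\mathcal P_p(\mathbb R^k)$ is the set of Borel probability measures on $\mathbb R^k$ with finite $p$-th moment, and $\mathbf d_p$ is the $p$-Wasserstein distance. $\mathcal L(\cdot)$ denotes the law of a random variable; random variables live on an atomless probability space. $D_\mu$ is the Wasserstein (Lions) derivative; $\frac{\delta F}{\delta m}(\mu):\mathbb R^k\to\mathbb R$ is the flat derivative, i.e. the continuous function with $\lim_{t\downarrow0}\frac{F(\mu+t(\nu-\mu))-F(\mu)}{t}=\int\frac{\delta F}{\delta m}(\mu)(x)\,d(\nu-\mu)(x)$ for all $\nu\in\mathcal P_2(\mathbb R^k)$. Data: $L:\mathbb R^d\times\mathbb R^d\times\mathcal P_2(\mathbb R^d\times\mathbb R^d)\to\mathbb R$, with variables $(x,a,\mu)$, and $G:\mathbb R^d\times\mathcal P_2(\mathbb R^d)\to\mathbb R$. The Hamiltonian is $H(x,p,\mu)=\sup_{a\in\mathbb R^d}\{-a\cdot p-L(x,a,\mu)\}$. Empirical measures ($N\ge2$, $\mathbf x=(x^1,\dots,x^N)$, $\mathbf a=(a^1,\dots,a^N)\in(\mathbb R^d)^N$): $m^N_{\mathbf x,\mathbf a}=\frac1N\sum_{j=1}^N\delta_{(x^j,a^j)}$, $m^{N,-i}_{\mathbf x,\mathbf a}=\frac1{N-1}\sum_{j\ne i}\delta_{(x^j,a^j)}$. Assumption (R): $L$ and $G$ are fully $C^2$ (with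 $z$ the Euclidean variables, the derivatives $D_z$, $D_\mu(\cdot,y)$, $D_{zz}$, $D_zD_\mu$, $D_yD_\mu$, $D^2_{\mu\mu}$ exist and are jointly continuous in all their arguments) and all their second derivatives are uniformly bounded; $D_\mu L$ and $D_\mu G$ are uniformly bounded. There is $C>0$ with $D_{aa}L(x,a,\mu)\ge C I_{d\times d}$ and $\frac1C|a|^2-C(1+|x|^2+\mathbf d_2(\mu,\delta_0))\le L(x,a,\mu)\le C|a|^2+C(1+|x|^2+\mathbf d_2(\mu,\delta_0))$ for all $(x,a,\mu)$. The map $(x,a,\mu,x',a')\mapsto\frac{\delta}{\delta m}D_xL(x,a,\mu,x',a')$ is uniformly Lipschitz, and likewise $\frac{\delta}{\delta m}D_aL$ and $\frac{\delta}{\delta m}D_xG$, where Lipschitz continuity in the measure variable is with respect to $\mathbf d_1$. Assumption (M): there are constants $C_{L,a}>0$, $C_{L,x},C_G\ge0$ such that for all square-integrable $\mathbb R^d$-valued random vectors $X,\overline X,\alpha,\overline\alpha$, $$\mathbf E\big[(D_aL(X,\alpha,\mathcal L(X,\alpha))-D_aL(\overline X,\overline\alpha,\mathcal L(\overline X,\overline\alpha)))\cdot(\alpha-\overline\alpha)+(D_xL(X,\alpha,\mathcal L(X,\alpha))-D_xL(\overline X,\overline\alpha,\mathcal L(\overline X,\overline\alpha)))\cdot(X-\overline X)\big]\ge C_{L,a}\mathbf E|\alpha-\overline\alpha|^2-C_{L,x}\mathbf E|X-\overline X|^2,$$ $$\mathbf E\big[(D_xG(X,\mathcal L(X))-D_xG(\overline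 X,\mathcal L(\overline X)))\cdot(X-\overline X)\big]\ge-C_G\mathbf E|X-\overline X|^2,$$ and $C_{\mathrm{disp}}:=C_{L,a}-TC_G-\frac{T^2}2C_{L,x}>0$. *)

theory Defs
  imports "HOL-Probability.Probability"
begin

section \<open>Wasserstein spaces\<close>

definition wspace :: "real \<Rightarrow> 'a::euclidean_space measure set" where
  "wspace p = {\<mu>. prob_space \<mu> \<and> sets \<mu> = sets borel \<and> integrable \<mu> (\<lambda>x. norm x powr p)}"

abbreviation P2 :: "'a::euclidean_space measure set" where
  "P2 \<equiv> wspace 2"

definition couplings :: "'a::euclidean_space measure \<Rightarrow> 'a measure \<Rightarrow> ('a \<times> 'a) measure set" where
  "couplings \<mu> \<nu> = {\<pi>. prob_space \<pi> \<and> sets \<pi> = sets borel \<and>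
     distr \<pi> borel fst = \<mu> \<and> distr \<pi> borel snd = \<nu>}"

definition wdist :: "real \<Rightarrow> 'a::euclidean_space measure \<Rightarrow> 'a measure \<Rightarrow> real" where
  "wdist p \<mu> \<nu> =
     enn2real (INF \<pi>\<in>couplings \<mu> \<nu>. \<integral>\<^sup>+ z. ennreal (dist (fst z) (snd z) powr p) \<partial>\<pi>) powr (1 / p)"

text \<open>Empirical measure of the points \<open>y j\<close>, \<open>j \<in> I\<close>: the law of \<open>y j\<close> for a uniformly
  chosen index \<open>j\<close>.\<close>

definition empirical :: "nat set \<Rightarrow> (nat \<Rightarrow> 'a::euclidean_space) \<Rightarrow> 'a measure" where
  "empirical I y = distr (uniform_count_measure I) borel y"

lemma emeasure_empirical:
  assumes "finite I" "I \<noteq> {}" "A \<in> sets borel"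
  shows "emeasure (empirical I y) A = ennreal ((1 / real (card I)) * (\<Sum>j\<in>I. indicator A (y j)))"
proof -
  have "emeasure (empirical I y) A = emeasure (uniform_count_measure I) (y -` A \<inter> I)"
    unfolding empirical_def using assms
    by (subst emeasure_distr) (auto simp: space_uniform_count_measure sets_uniform_count_measure)
  also have "\<dots> = ennreal (real (card (y -` A \<inter> I)) / real (card I))"
    using assms by (subst emeasure_uniform_count_measure) auto
  also have "real (card (y -` A \<inter> I)) = (\<Sum>j\<in>I. indicator A (y j))"
    using assms(1) by (simp add: indicator_def sum.If_cases Int_def vimage_def conj_commute)
  finally show ?thesis by simp
qed

text \<open>The measure \<open>\<mu> + t (\<nu> - \<mu>)\<close>, for \<open>0 \<le> t \<le> 1\<close>.\<close>

definition mixture :: "real \<Rightarrow> 'a::euclidean_space measure \<Rightarrow> 'a measure \<Rightarrow> 'a measure" where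
  "mixture t \<mu> \<nu> = measure_of UNIV (sets borel)
     (\<lambda>A. ennreal (1 - t) * emeasure \<mu> A + ennreal t * emeasure \<nu> A)"

lemma emeasure_mixture:
  assumes "sets \<mu> = sets borel" "sets \<nu> = sets borel" "A \<in> sets borel"
  shows "emeasure (mixture t \<mu> \<nu>) A = ennreal (1 - t) * emeasure \<mu> A + ennreal t * emeasure \<nu> A"
proof (rule emeasure_measure_of[OF mixture_def])
  show "countably_additive (sets (mixture t \<mu> \<nu>))
      (\<lambda>A. ennreal (1 - t) * emeasure \<mu> A + ennreal t * emeasure \<nu> A)"
  proof (rule countably_additiveI)
    fix B :: "nat \<Rightarrow> 'a set"
    assume B: "range B \<subseteq> sets (mixture t \<mu> \<nu>)" "disjoint_family B"
    have "sets (mixture t \<mu> \<nu>) = sets borel"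
      unfolding mixture_def
      by (metis sets.sets_measure_of_eq space_borel)
    with B have "range B \<subseteq> sets \<mu>" "range B \<subseteq> sets \<nu>" using assms by auto
    then have "(\<Sum>i. emeasure \<mu> (B i)) = emeasure \<mu> (\<Union>i. B i)"
      "(\<Sum>i. emeasure \<nu> (B i)) = emeasure \<nu> (\<Union>i. B i)"
      using B(2) by (auto intro!: suminf_emeasure)
    then show "(\<Sum>i. ennreal (1 - t) * emeasure \<mu> (B i) + ennreal t * emeasure \<nu> (B i)) =
        ennreal (1 - t) * emeasure \<mu> (\<Union>i. B i) + ennreal t * emeasure \<nu> (\<Union>i. B i)"
      by (simp flip: suminf_add add: ennreal_suminf_cmult)
  qed
qed (use assms in \<open>auto simp: positive_def mixture_def sets.sets_measure_of_eq[of borel, simplified]\<close>)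


section \<open>Random variables\<close>

definition atomless_prob_space :: "'w measure \<Rightarrow> bool" where
  "atomless_prob_space \<Omega> \<longleftrightarrow> prob_space \<Omega> \<and>
     (\<forall>A\<in>sets \<Omega>. measure \<Omega> A > 0 \<longrightarrow>
        (\<exists>B\<in>sets \<Omega>. B \<subseteq> A \<and> 0 < measure \<Omega> B \<and> measure \<Omega> B < measure \<Omega> A))"

definition L2 :: "'w measure \<Rightarrow> ('w \<Rightarrow> 'a::euclidean_space) set" where
  "L2 \<Omega> = {X. X \<in> borel_measurable \<Omega> \<and> integrable \<Omega> (\<lambda>\<omega>. (norm (X \<omega>))\<^sup>2)}"

definition L2_norm :: "'w measure \<Rightarrow> ('w \<Rightarrow> 'a::euclidean_space) \<Rightarrow> real" where
  "L2_norm \<Omega> X = sqrt (\<integral>\<omega>. (norm (X \<omega>))\<^sup>2 \<partial>\<Omega>)"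

abbreviation law :: "'w measure \<Rightarrow> ('w \<Rightarrow> 'a::euclidean_space) \<Rightarrow> 'a measure" where
  "law \<Omega> X \<equiv> distr \<Omega> borel X"


section \<open>Derivatives\<close>

definition gradient :: "('a::euclidean_space \<Rightarrow> real) \<Rightarrow> 'a \<Rightarrow> 'a" where
  "gradient f x = (THE D. GDERIV f x :> D)"

text \<open>Lions derivative: the lift \<open>X \<mapsto> F (law X)\<close> to the square-integrable random variables is
  Frechet differentiable at some \<open>X\<close> with law \<open>\<mu>\<close>, and its differential is
  \<open>Y \<mapsto> E[\<xi>(X) Y]\<close>. For vector-valued \<open>F\<close> (needed for the second derivative) \<open>\<xi>(y)\<close> is a linear map.\<close>

definition has_lions_derivative ::
  "'w measure \<Rightarrow> ('a::euclidean_space measure \<Rightarrow> 'v::euclidean_space)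
    \<Rightarrow> ('a \<Rightarrow> 'a \<Rightarrow>\<^sub>L 'v) \<Rightarrow> 'a measure \<Rightarrow> bool" where
  "has_lions_derivative \<Omega> F \<xi> \<mu> \<longleftrightarrow>
     \<xi> \<in> borel_measurable borel \<and> integrable \<mu> (\<lambda>y. (norm (\<xi> y))\<^sup>2) \<and>
     (\<exists>X\<in>L2 \<Omega>. law \<Omega> X = \<mu> \<and>
        (\<forall>e>0. \<exists>r>0. \<forall>Y\<in>L2 \<Omega>. L2_norm \<Omega> Y < r \<longrightarrow>
           norm (F (law \<Omega> (\<lambda>\<omega>. X \<omega> + Y \<omega>)) - F (law \<Omega> X)
             - (\<integral>\<omega>. blinfun_apply (\<xi> (X \<omega>)) (Y \<omega>) \<partial>\<Omega>)) \<le> e * L2_norm \<Omega> Y))"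

text \<open>The flat derivative is determined only up to an additive constant depending on \<open>\<mu>\<close>, hence
  a relation.\<close>

definition has_flat_derivative ::
  "('a::euclidean_space measure \<Rightarrow> 'v::euclidean_space) \<Rightarrow> ('a \<Rightarrow> 'v) \<Rightarrow> 'a measure \<Rightarrow> bool" where
  "has_flat_derivative F f \<mu> \<longleftrightarrow>
     continuous_on UNIV f \<and>
     (\<forall>\<nu>\<in>P2. integrable \<nu> f) \<and>
     (\<forall>\<nu>\<in>P2. ((\<lambda>t. (F (mixture t \<mu> \<nu>) - F \<mu>) /\<^sub>R t)
        \<longlongrightarrow> (\<integral>y. f y \<partial>\<nu>) - (\<integral>y. f y \<partial>\<mu>)) (at_right 0))"

definition jointly_continuous ::
  "('e::metric_space \<Rightarrow> 'a::euclidean_space measure \<Rightarrow> 'v::metric_space) \<Rightarrow> bool" where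
  "jointly_continuous f \<longleftrightarrow>
     (\<forall>u. \<forall>\<mu>\<in>P2. \<forall>e>0. \<exists>r>0. \<forall>u'. \<forall>\<mu>'\<in>P2.
        dist u' u < r \<and> wdist 2 \<mu>' \<mu> < r \<longrightarrow> dist (f u' \<mu>') (f u \<mu>) < e)"

text \<open>\<open>Dz\<close> and \<open>Dm\<close> are the gradients in the Euclidean and in the measure variable; the remaining
  functions are the second derivatives \<open>D\<^sub>z\<^sub>z\<close>, \<open>D\<^sub>zD\<^sub>\<mu>\<close>, \<open>D\<^sub>yD\<^sub>\<mu>\<close>, \<open>D\<^sub>\<mu>\<^sub>\<mu>\<close>.
  Joint continuity singles out one version of the Lions derivatives, which at a given \<open>\<mu>\<close>
  are determined only \<open>\<mu>\<close>-almost everywhere.\<close>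

definition fully_C2_bounded ::
  "'w measure \<Rightarrow> ('z::euclidean_space \<Rightarrow> 'y::euclidean_space measure \<Rightarrow> real) \<Rightarrow> bool" where
  "fully_C2_bounded \<Omega> F \<longleftrightarrow>
     (\<exists>(Dz :: 'z \<Rightarrow> 'y measure \<Rightarrow> 'z)
       (Dm :: 'z \<Rightarrow> 'y measure \<Rightarrow> 'y \<Rightarrow> 'y)
       (Dzz :: 'z \<Rightarrow> 'y measure \<Rightarrow> 'z \<Rightarrow>\<^sub>L 'z)
       (Dzm :: 'z \<Rightarrow> 'y measure \<Rightarrow> 'y \<Rightarrow> 'z \<Rightarrow>\<^sub>L 'y)
       (Dym :: 'z \<Rightarrow> 'y measure \<Rightarrow> 'y \<Rightarrow> 'y \<Rightarrow>\<^sub>L 'y)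
       (Dmm :: 'z \<Rightarrow> 'y measure \<Rightarrow> 'y \<Rightarrow> 'y \<Rightarrow> 'y \<Rightarrow>\<^sub>L 'y).
       (\<forall>z. \<forall>\<mu>\<in>P2.
          (GDERIV (\<lambda>z. F z \<mu>) z :> Dz z \<mu>) \<and>
          has_lions_derivative \<Omega> (F z) (\<lambda>y. blinfun_inner_left (Dm z \<mu> y)) \<mu> \<and>
          ((\<lambda>z. Dz z \<mu>) has_derivative blinfun_apply (Dzz z \<mu>)) (at z) \<and>
          (\<forall>y. ((\<lambda>z. Dm z \<mu> y) has_derivative blinfun_apply (Dzm z \<mu> y)) (at z) \<and>
               (Dm z \<mu> has_derivative blinfun_apply (Dym z \<mu> y)) (at y) \<and>
               has_lions_derivative \<Omega> (\<lambda>\<mu>. Dm z \<mu> y) (Dmm z \<mu> y) \<mu>)) \<and>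
       jointly_continuous Dz \<and>
       jointly_continuous (\<lambda>(z, y) \<mu>. Dm z \<mu> y) \<and>
       jointly_continuous Dzz \<and>
       jointly_continuous (\<lambda>(z, y) \<mu>. Dzm z \<mu> y) \<and>
       jointly_continuous (\<lambda>(z, y) \<mu>. Dym z \<mu> y) \<and>
       jointly_continuous (\<lambda>(z, y, y') \<mu>. Dmm z \<mu> y y') \<and>
       (\<exists>K. \<forall>z y y'. \<forall>\<mu>\<in>P2.
          norm (Dm z \<mu> y) \<le> K \<and> norm (Dzz z \<mu>) \<le> K \<and> norm (Dzm z \<mu> y) \<le> K \<and>
          norm (Dym z \<mu> y) \<le> K \<and> norm (Dmm z \<mu> y y') \<le> K))"

definition lipschitz_flat_derivative ::
  "('z::euclidean_space \<Rightarrow> 'y::euclidean_space measure \<Rightarrow> 'v::euclidean_space) \<Rightarrow> bool" where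
  "lipschitz_flat_derivative F \<longleftrightarrow>
     (\<exists>f :: 'z \<Rightarrow> 'y measure \<Rightarrow> 'y \<Rightarrow> 'v.
       (\<forall>z. \<forall>\<mu>\<in>P2. has_flat_derivative (F z) (f z \<mu>) \<mu>) \<and>
       (\<exists>K. \<forall>z z' y y'. \<forall>\<mu>\<in>P2. \<forall>\<mu>'\<in>P2.
          norm (f z \<mu> y - f z' \<mu>' y') \<le> K * (dist z z' + wdist 1 \<mu> \<mu>' + dist y y')))"


section \<open>The data\<close>

type_synonym 'd vec = "real ^ 'd"
type_synonym 'd lagrangian = "'d vec \<Rightarrow> 'd vec \<Rightarrow> ('d vec \<times> 'd vec) measure \<Rightarrow> real"
type_synonym 'd terminal_cost = "'d vec \<Rightarrow> 'd vec measure \<Rightarrow> real"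

definition D_xL :: "'d::finite lagrangian \<Rightarrow> 'd vec \<Rightarrow> 'd vec \<Rightarrow> ('d vec \<times> 'd vec) measure \<Rightarrow> 'd vec" where
  "D_xL L x a \<mu> = gradient (\<lambda>x. L x a \<mu>) x"

definition D_aL :: "'d::finite lagrangian \<Rightarrow> 'd vec \<Rightarrow> 'd vec \<Rightarrow> ('d vec \<times> 'd vec) measure \<Rightarrow> 'd vec" where
  "D_aL L x a \<mu> = gradient (\<lambda>a. L x a \<mu>) a"

definition D_xG :: "'d::finite terminal_cost \<Rightarrow> 'd vec \<Rightarrow> 'd vec measure \<Rightarrow> 'd vec" where
  "D_xG G x m = gradient (\<lambda>x. G x m) x"

definition hamiltonian ::
  "'d::finite lagrangian \<Rightarrow> 'd vec \<Rightarrow> 'd vec \<Rightarrow> ('d vec \<times> 'd vec) measure \<Rightarrow> real" where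
  "hamiltonian L x p \<mu> = (SUP a. - (a \<bullet> p) - L x a \<mu>)"

definition D_pH :: "'d::finite lagrangian \<Rightarrow> 'd vec \<Rightarrow> 'd vec \<Rightarrow> ('d vec \<times> 'd vec) measure \<Rightarrow> 'd vec" where
  "D_pH L x p \<mu> = gradient (\<lambda>p. hamiltonian L x p \<mu>) p"

text \<open>The convexity constant \<open>c\<close> and the growth constant \<open>C\<close> are not required to coincide:
  with \<open>c = C\<close> the Lagrangian \<open>|a|\<^sup>2 / 2\<close> would be excluded. This hypothesis is implied by
  the one with a single constant.\<close>

definition assumption_R :: "'w measure \<Rightarrow> 'd::finite lagrangian \<Rightarrow> 'd terminal_cost \<Rightarrow> bool" where
  "assumption_R \<Omega> L G \<longleftrightarrow>
     fully_C2_bounded \<Omega> (\<lambda>(x, a). L x a) \<and>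
     fully_C2_bounded \<Omega> G \<and>
     (\<exists>c>0. \<forall>x a. \<forall>\<mu>\<in>P2. \<forall>v.
        v \<bullet> frechet_derivative (\<lambda>a. D_aL L x a \<mu>) (at a) v \<ge> c * (norm v)\<^sup>2) \<and>
     (\<exists>C>0. \<forall>x a. \<forall>\<mu>\<in>P2.
        (1 / C) * (norm a)\<^sup>2 - C * (1 + (norm x)\<^sup>2 + wdist 2 \<mu> (return borel 0)) \<le> L x a \<mu> \<and>
        L x a \<mu> \<le> C * (norm a)\<^sup>2 + C * (1 + (norm x)\<^sup>2 + wdist 2 \<mu> (return borel 0))) \<and>
     lipschitz_flat_derivative (\<lambda>(x, a). D_xL L x a) \<and>
     lipschitz_flat_derivative (\<lambda>(x, a). D_aL L x a) \<and>
     lipschitz_flat_derivative (D_xG G)"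

definition assumption_M ::
  "'w measure \<Rightarrow> real \<Rightarrow> 'd::finite lagrangian \<Rightarrow> 'd terminal_cost \<Rightarrow> bool" where
  "assumption_M \<Omega> T L G \<longleftrightarrow>
     (\<exists>C_La C_Lx C_G. C_La > 0 \<and> C_Lx \<ge> 0 \<and> C_G \<ge> 0 \<and>
        (\<forall>X\<in>L2 \<Omega>. \<forall>X'\<in>L2 \<Omega>. \<forall>\<alpha>\<in>L2 \<Omega>. \<forall>\<alpha>'\<in>L2 \<Omega>.
           let \<mu> = law \<Omega> (\<lambda>\<omega>. (X \<omega>, \<alpha> \<omega>)); \<mu>' = law \<Omega> (\<lambda>\<omega>. (X' \<omega>, \<alpha>' \<omega>)) in
           (\<integral>\<omega>. (D_aL L (X \<omega>) (\<alpha> \<omega>) \<mu> - D_aL L (X' \<omega>) (\<alpha>' \<omega>) \<mu>') \<bullet> (\<alpha> \<omega> - \<alpha>' \<omega>)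
               + (D_xL L (X \<omega>) (\<alpha> \<omega>) \<mu> - D_xL L (X' \<omega>) (\<alpha>' \<omega>) \<mu>') \<bullet> (X \<omega> - X' \<omega>) \<partial>\<Omega>)
           \<ge> C_La * (\<integral>\<omega>. (norm (\<alpha> \<omega> - \<alpha>' \<omega>))\<^sup>2 \<partial>\<Omega>)
             - C_Lx * (\<integral>\<omega>. (norm (X \<omega> - X' \<omega>))\<^sup>2 \<partial>\<Omega>)) \<and>
        (\<forall>X\<in>L2 \<Omega>. \<forall>X'\<in>L2 \<Omega>.
           (\<integral>\<omega>. (D_xG G (X \<omega>) (law \<Omega> X) - D_xG G (X' \<omega>) (law \<Omega> X')) \<bullet> (X \<omega> - X' \<omega>) \<partial>\<Omega>)
           \<ge> - C_G * (\<integral>\<omega>. (norm (X \<omega> - X' \<omega>))\<^sup>2 \<partial>\<Omega>)) \<and>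
        C_La - T * C_G - T\<^sup>2 / 2 * C_Lx > 0)"


section \<open>The fixed-point map and the finite-player system\<close>

definition is_Phi ::
  "'d::finite lagrangian \<Rightarrow> ('d vec \<times> 'd vec) measure \<Rightarrow> ('d vec \<times> 'd vec) measure \<Rightarrow> bool" where
  "is_Phi L \<nu> \<mu> \<longleftrightarrow> \<mu> \<in> P2 \<and> \<mu> = distr \<nu> borel (\<lambda>(x, p). (x, - D_pH L x p \<mu>))"

definition Phi :: "'d::finite lagrangian \<Rightarrow> ('d vec \<times> 'd vec) measure \<Rightarrow> ('d vec \<times> 'd vec) measure" where
  "Phi L \<nu> = (THE \<mu>. is_Phi L \<nu> \<mu>)"

definition emp :: "nat \<Rightarrow> (nat \<Rightarrow> 'd::finite vec) \<Rightarrow> (nat \<Rightarrow> 'd vec) \<Rightarrow> ('d vec \<times> 'd vec) measure" where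
  "emp N x a = empirical {..<N} (\<lambda>j. (x j, a j))"

definition emp_minus ::
  "nat \<Rightarrow> nat \<Rightarrow> (nat \<Rightarrow> 'd::finite vec) \<Rightarrow> (nat \<Rightarrow> 'd vec) \<Rightarrow> ('d vec \<times> 'd vec) measure" where
  "emp_minus N i x a = empirical ({..<N} - {i}) (\<lambda>j. (x j, a j))"

text \<open>Elements of \<open>(\<real>\<^sup>d)\<^sup>N\<close> are functions on \<open>nat\<close> of which only the values at \<open>i < N\<close> matter.
  The solution of the system is taken \<open>undefined\<close> elsewhere, so that uniqueness
  is uniqueness in \<open>(\<real>\<^sup>d)\<^sup>N\<close>.\<close>

definition solves_system ::
  "'d::finite lagrangian \<Rightarrow> nat \<Rightarrow> (nat \<Rightarrow> 'd vec) \<Rightarrow> (nat \<Rightarrow> 'd vec) \<Rightarrow> (nat \<Rightarrow> 'd vec) \<Rightarrow> bool" where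
  "solves_system L N x p a \<longleftrightarrow>
     a \<in> {..<N} \<rightarrow>\<^sub>E UNIV \<and> (\<forall>i<N. a i = - D_pH L (x i) (p i) (emp_minus N i x a))"

definition aN :: "'d::finite lagrangian \<Rightarrow> nat \<Rightarrow> (nat \<Rightarrow> 'd vec) \<Rightarrow> (nat \<Rightarrow> 'd vec) \<Rightarrow> nat \<Rightarrow> 'd vec" where
  "aN L N x p = (THE a. solves_system L N x p a)"

end

theory Submission
  imports Defs
begin

text \<open>The Lagrangian is strongly convex in the control, hence the value \<open>- D\<^sub>pH(x, p, \<mu>)\<close> is the unique
  solution \<open>a\<close> of the first order condition \<open>D\<^sub>aL(x, a, \<mu>) = - p\<close> (lemma
  \<open>strongly_convex_legendre\<close>). If \<open>(X, P)\<close> has the law \<open>\<nu>\<close>, the fixed points \<open>\<mu>\<close> are therefore the laws of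
  \<open>(X, \<alpha>)\<close> for the square-integrable controls \<open>\<alpha>\<close> with \<open>D\<^sub>aL(X, \<alpha>, law (X, \<alpha>)) = - P\<close>.
  Displacement monotonicity for two controls of the same state \<open>X\<close> says that the operator on the left
  is strongly monotone on \<open>L\<^sup>2\<close>, and the Lipschitz continuity of the flat derivative makes it Lipschitz.
  Such an operator has a Lipschitz inverse (lemmas \<open>L2_strongly_monotone_zero\<close> and
  \<open>control_estimate\<close>).

  The monotonicity assumption is about one probability space \<open>\<Omega>\<close>, but it concerns only the joint law
  of the state and the two controls. Every law with finite second moment is realized on \<open>\<Omega>\<close>: for laws
  of pairs of vectors this is part of the Lions differentiability of the Lagrangian, and lemma \<open>realize_law\<close>
  passes to other dimensions. So the operator is strongly monotone over every probability space. For the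
  existence of a fixed point this space is \<open>\<nu>\<close>; for the Lipschitz estimate of \<open>\<Phi>\<close> it is a coupling
  of the two measures.

  For the finite-player system the space is the set of players with the uniform distribution. Replacing
  the empirical measure of the other players by that of all players changes the equation by a
  self-interaction term. The flat derivative is Lipschitz in all its arguments, and therefore the
  self-interaction is a Lipschitz function of the configuration with a constant of the order \<open>1 / N\<close>
  (lemma \<open>self_interaction_lipschitz\<close>). For large \<open>N\<close> this perturbation uses up at most half of
  the monotonicity, which gives existence, uniqueness and the Lipschitz bound. The finite-player
  control also solves the mean field equation with a momentum perturbed by the self-interaction.
  When all states and momenta vanish, all players act alike and the self-interaction is zero. In
  general its norm is thus at most \<open>C / N\<close> times that of the data, and \<open>control_estimate\<close>
  yields the last claim.\<close>

section \<open>Square-integrable random variables\<close>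

lemma L2D:
  assumes "X \<in> L2 M"
  shows "X \<in> borel_measurable M" "integrable M (\<lambda>\<omega>. (norm (X \<omega>))\<^sup>2)"
  using assms by (auto simp: L2_def)

lemma L2_norm_nonneg: "0 \<le> L2_norm M X"
  by (simp add: L2_norm_def)

lemma L2_norm_sq: "(L2_norm M X)\<^sup>2 = (\<integral>\<omega>. (norm (X \<omega>))\<^sup>2 \<partial>M)"
  by (simp add: L2_norm_def)

lemma L2_norm_minus_commute: "L2_norm M (\<lambda>\<omega>. X \<omega> - Y \<omega>) = L2_norm M (\<lambda>\<omega>. Y \<omega> - X \<omega>)"
  by (simp add: L2_norm_def norm_minus_commute)

lemma L2_norm_scaleR: "L2_norm M (\<lambda>\<omega>. c *\<^sub>R X \<omega>) = \<bar>c\<bar> * L2_norm M X"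
  by (simp add: L2_norm_def power_mult_distrib real_sqrt_mult)

lemma L2_norm_normed: "L2_norm M (\<lambda>\<omega>. norm (X \<omega>)) = L2_norm M X"
  by (simp add: L2_norm_def)

lemma L2_scaleR:
  assumes "X \<in> L2 M"
  shows "(\<lambda>\<omega>. c *\<^sub>R X \<omega>) \<in> L2 M"
  using assms by (auto simp: L2_def power_mult_distrib)

lemma L2_normed:
  assumes "X \<in> L2 M"
  shows "(\<lambda>\<omega>. norm (X \<omega>)) \<in> L2 M"
  using assms by (auto simp: L2_def)

lemma norm_add_sq_le: "(norm (x + y))\<^sup>2 \<le> 2 * (norm x)\<^sup>2 + 2 * (norm (y :: 'a::real_normed_vector))\<^sup>2"
proof -
  have "(norm (x + y))\<^sup>2 \<le> (norm x + norm y)\<^sup>2"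
    by (intro power_mono norm_triangle_ineq) auto
  also have "\<dots> \<le> 2 * (norm x)\<^sup>2 + 2 * (norm y)\<^sup>2"
    using sum_squares_bound[of "norm x" "norm y"] by (simp add: power2_sum)
  finally show ?thesis .
qed

lemma L2_add:
  assumes "X \<in> L2 M" "Y \<in> L2 M"
  shows "(\<lambda>\<omega>. X \<omega> + Y \<omega>) \<in> L2 M"
proof -
  note [measurable] = assms[THEN L2D(1)]
  have "integrable M (\<lambda>\<omega>. (norm (X \<omega> + Y \<omega>))\<^sup>2)"
    by (rule Bochner_Integration.integrable_bound
          [where f = "\<lambda>\<omega>. 2 * (norm (X \<omega>))\<^sup>2 + 2 * (norm (Y \<omega>))\<^sup>2"])
       (use assms[THEN L2D(2)] in \<open>auto intro: norm_add_sq_le\<close>)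
  then show ?thesis by (simp add: L2_def)
qed

lemma L2_diff:
  assumes "X \<in> L2 M" "Y \<in> L2 M"
  shows "(\<lambda>\<omega>. X \<omega> - Y \<omega>) \<in> L2 M"
  using L2_add[OF assms(1) L2_scaleR[OF assms(2), of "-1"]] by simp

lemma L2_Pair:
  assumes "X \<in> L2 M" "Y \<in> L2 M"
  shows "(\<lambda>\<omega>. (X \<omega>, Y \<omega>)) \<in> L2 M"
  using assms by (auto simp: L2_def norm_Pair borel_prod[symmetric])

lemma integrable_norm_mult_L2:
  assumes "X \<in> L2 M" "Y \<in> L2 M"
  shows "integrable M (\<lambda>\<omega>. norm (X \<omega>) * norm (Y \<omega>))"
proof (rule Bochner_Integration.integrable_bound)
  show "integrable M (\<lambda>\<omega>. (norm (X \<omega>))\<^sup>2 + (norm (Y \<omega>))\<^sup>2)"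
    using assms[THEN L2D(2)] by simp
  show "(\<lambda>\<omega>. norm (X \<omega>) * norm (Y \<omega>)) \<in> borel_measurable M"
    using assms[THEN L2D(1)] by measurable
  have "norm (X \<omega>) * norm (Y \<omega>) \<le> (norm (X \<omega>))\<^sup>2 + (norm (Y \<omega>))\<^sup>2" for \<omega>
  proof -
    have "0 \<le> norm (X \<omega>) * norm (Y \<omega>)" by simp
    then show ?thesis
      using sum_squares_bound[of "norm (X \<omega>)" "norm (Y \<omega>)"] by linarith
  qed
  then show "AE \<omega> in M. norm (norm (X \<omega>) * norm (Y \<omega>)) \<le> norm ((norm (X \<omega>))\<^sup>2 + (norm (Y \<omega>))\<^sup>2)"
    by auto
qed

lemma integrable_inner_L2:
  assumes "X \<in> L2 M" "Y \<in> L2 M"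
  shows "integrable M (\<lambda>\<omega>. X \<omega> \<bullet> Y \<omega>)"
  by (rule Bochner_Integration.integrable_bound[OF integrable_norm_mult_L2[OF assms]])
     (use assms[THEN L2D(1)] Cauchy_Schwarz_ineq2 in auto)

lemma nn_integral_norm_sq:
  assumes "X \<in> L2 M"
  shows "(\<integral>\<^sup>+\<omega>. ennreal (norm (X \<omega>)) ^ 2 \<partial>M) = ennreal ((L2_norm M X)\<^sup>2)"
  unfolding L2_norm_sq using L2D(2)[OF assms]
  by (subst nn_integral_eq_integral[symmetric]) (auto simp: ennreal_power)

lemma integral_norm_mult_le_L2_norm:
  assumes "X \<in> L2 M" "Y \<in> L2 M"
  shows "(\<integral>\<omega>. norm (X \<omega>) * norm (Y \<omega>) \<partial>M) \<le> L2_norm M X * L2_norm M Y"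
proof -
  note [measurable] = assms[THEN L2D(1)]
  have "ennreal ((\<integral>\<omega>. norm (X \<omega>) * norm (Y \<omega>) \<partial>M)\<^sup>2)
      = (\<integral>\<^sup>+\<omega>. ennreal (norm (X \<omega>)) * ennreal (norm (Y \<omega>)) \<partial>M)\<^sup>2"
    using integrable_norm_mult_L2[OF assms]
    by (subst ennreal_power[symmetric]) (auto simp: nn_integral_eq_integral simp flip: ennreal_mult')
  also have "\<dots> \<le> ennreal ((L2_norm M X)\<^sup>2) * ennreal ((L2_norm M Y)\<^sup>2)"
    unfolding nn_integral_norm_sq[OF assms(1), symmetric] nn_integral_norm_sq[OF assms(2), symmetric]
    by (rule Cauchy_Schwarz_nn_integral) auto
  also have "\<dots> = ennreal ((L2_norm M X * L2_norm M Y)\<^sup>2)"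
    by (simp add: power_mult_distrib ennreal_mult')
  finally have "(\<integral>\<omega>. norm (X \<omega>) * norm (Y \<omega>) \<partial>M)\<^sup>2 \<le> (L2_norm M X * L2_norm M Y)\<^sup>2"
    by (subst (asm) ennreal_le_iff) auto
  then show ?thesis
    by (rule power2_le_imp_le) (simp add: L2_norm_nonneg)
qed

lemma integral_inner_le_L2_norm:
  assumes "X \<in> L2 M" "Y \<in> L2 M"
  shows "\<bar>\<integral>\<omega>. X \<omega> \<bullet> Y \<omega> \<partial>M\<bar> \<le> L2_norm M X * L2_norm M Y"
proof -
  have "\<bar>\<integral>\<omega>. X \<omega> \<bullet> Y \<omega> \<partial>M\<bar> \<le> (\<integral>\<omega>. \<bar>X \<omega> \<bullet> Y \<omega>\<bar> \<partial>M)"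
    by (rule integral_abs_bound)
  also have "\<dots> \<le> (\<integral>\<omega>. norm (X \<omega>) * norm (Y \<omega>) \<partial>M)"
    using integrable_inner_L2[OF assms] integrable_norm_mult_L2[OF assms]
    by (intro integral_mono) (auto intro: Cauchy_Schwarz_ineq2)
  also note integral_norm_mult_le_L2_norm[OF assms]
  finally show ?thesis .
qed

lemma L2_norm_add_sq:
  assumes "X \<in> L2 M" "Y \<in> L2 M"
  shows "(L2_norm M (\<lambda>\<omega>. X \<omega> + Y \<omega>))\<^sup>2
    = (L2_norm M X)\<^sup>2 + 2 * (\<integral>\<omega>. X \<omega> \<bullet> Y \<omega> \<partial>M) + (L2_norm M Y)\<^sup>2"
proof -
  have "(norm (X \<omega> + Y \<omega>))\<^sup>2 = (norm (X \<omega>))\<^sup>2 + 2 * (X \<omega> \<bullet> Y \<omega>) + (norm (Y \<omega>))\<^sup>2" for \<omega>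
    by (simp add: power2_norm_eq_inner inner_add_left inner_add_right inner_commute)
  then show ?thesis
    using assms[THEN L2D(2)] integrable_inner_L2[OF assms] by (simp add: L2_norm_sq)
qed

lemma L2_norm_triangle:
  assumes "X \<in> L2 M" "Y \<in> L2 M"
  shows "L2_norm M (\<lambda>\<omega>. X \<omega> + Y \<omega>) \<le> L2_norm M X + L2_norm M Y"
proof (rule power2_le_imp_le)
  show "(L2_norm M (\<lambda>\<omega>. X \<omega> + Y \<omega>))\<^sup>2 \<le> (L2_norm M X + L2_norm M Y)\<^sup>2"
    using integral_inner_le_L2_norm[OF assms]
    unfolding L2_norm_add_sq[OF assms] power2_sum by linarith
qed (simp add: L2_norm_nonneg)

lemma L2_norm_diff_triangle:
  assumes "X \<in> L2 M" "Y \<in> L2 M" "Z \<in> L2 M"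
  shows "L2_norm M (\<lambda>\<omega>. X \<omega> - Z \<omega>) \<le> L2_norm M (\<lambda>\<omega>. X \<omega> - Y \<omega>) + L2_norm M (\<lambda>\<omega>. Y \<omega> - Z \<omega>)"
  using L2_norm_triangle[OF L2_diff[OF assms(1,2)] L2_diff[OF assms(2,3)]] by simp

lemma L2_norm_diff_le:
  assumes "X \<in> L2 M" "Y \<in> L2 M"
  shows "L2_norm M (\<lambda>\<omega>. X \<omega> - Y \<omega>) \<le> L2_norm M X + L2_norm M Y"
  using L2_norm_triangle[OF assms(1) L2_scaleR[OF assms(2), of "-1"]]
    L2_norm_scaleR[of M "-1" Y] by simp

lemma L2_norm_mono:
  assumes "Y \<in> L2 M" "X \<in> borel_measurable M"
    and "\<And>\<omega>. \<omega> \<in> space M \<Longrightarrow> norm (X \<omega>) \<le> norm (Y \<omega>)"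
  shows "X \<in> L2 M" "L2_norm M X \<le> L2_norm M Y"
proof -
  have int: "integrable M (\<lambda>\<omega>. (norm (X \<omega>))\<^sup>2)"
    by (rule Bochner_Integration.integrable_bound[OF L2D(2)[OF assms(1)]])
       (use assms in \<open>auto intro!: power_mono\<close>)
  then show "X \<in> L2 M" using assms(2) by (simp add: L2_def)
  show "L2_norm M X \<le> L2_norm M Y"
    unfolding L2_norm_def using int L2D(2)[OF assms(1)] assms(3)
    by (intro real_sqrt_le_mono integral_mono) (auto intro!: power_mono)
qed

lemma borel_measurable_fst [measurable]: "fst \<in> borel_measurable (borel :: ('a::euclidean_space \<times> 'b::euclidean_space) measure)"
  and borel_measurable_snd [measurable]: "snd \<in> borel_measurable (borel :: ('a::euclidean_space \<times> 'b::euclidean_space) measure)"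
  by (intro borel_measurable_continuous_onI continuous_intros)+

lemma norm_fst_le': "norm (fst z) \<le> norm z" and norm_snd_le': "norm (snd z) \<le> norm z"
  using norm_fst_le[of "fst z" "snd z"] norm_snd_le[of "snd z" "fst z"] by simp_all

lemma L2_fst:
  assumes "Z \<in> L2 M"
  shows "(\<lambda>\<omega>. fst (Z \<omega>)) \<in> L2 M"
  by (rule L2_norm_mono(1)[OF assms]) (use L2D(1)[OF assms] in \<open>auto intro: norm_fst_le'\<close>)

lemma L2_snd:
  assumes "Z \<in> L2 M"
  shows "(\<lambda>\<omega>. snd (Z \<omega>)) \<in> L2 M"
  by (rule L2_norm_mono(1)[OF assms]) (use L2D(1)[OF assms] in \<open>auto intro: norm_snd_le'\<close>)

lemma L2_norm_Pair_le:
  assumes "X \<in> L2 M" "Y \<in> L2 M"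
  shows "L2_norm M (\<lambda>\<omega>. (X \<omega>, Y \<omega>)) \<le> L2_norm M X + L2_norm M Y"
proof -
  have "L2_norm M (\<lambda>\<omega>. (X \<omega>, Y \<omega>)) \<le> L2_norm M (\<lambda>\<omega>. norm (X \<omega>) + norm (Y \<omega>))"
    by (rule L2_norm_mono(2)[OF L2_add[OF L2_normed L2_normed] L2D(1)[OF L2_Pair]])
       (use assms in \<open>auto intro: norm_Pair_le\<close>)
  also have "\<dots> \<le> L2_norm M X + L2_norm M Y"
    using L2_norm_triangle[OF L2_normed L2_normed, OF assms] by (simp add: L2_norm_normed)
  finally show ?thesis .
qed

lemma L2_norm_cong:
  assumes "\<And>\<omega>. \<omega> \<in> space M \<Longrightarrow> X \<omega> = Y \<omega>"
  shows "L2_norm M X = L2_norm M Y"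
  unfolding L2_norm_def using assms by (auto intro!: arg_cong[where f = sqrt] Bochner_Integration.integral_cong)

lemma L2_norm_eq_0_imp_AE:
  assumes "X \<in> L2 M" "L2_norm M X = 0"
  shows "AE \<omega> in M. X \<omega> = 0"
  using assms integral_nonneg_eq_0_iff_AE[OF L2D(2)[OF assms(1)]] by (simp add: L2_norm_def)

lemma lipschitz_pair_measurable:
  fixes h :: "'a::euclidean_space \<Rightarrow> 'b::euclidean_space \<Rightarrow> 'c::euclidean_space"
  assumes lip: "\<And>x a x' a'. norm (h x a - h x' a') \<le> K * (norm (x - x') + norm (a - a'))" and K: "0 \<le> K"
    and [measurable]: "X \<in> borel_measurable M" "\<alpha> \<in> borel_measurable M"
  shows "(\<lambda>\<omega>. h (X \<omega>) (\<alpha> \<omega>)) \<in> borel_measurable M"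
proof -
  have "(2 * K)-lipschitz_on UNIV (\<lambda>z. h (fst z) (snd z))"
  proof (rule lipschitz_onI)
    fix z z' :: "'a \<times> 'b"
    have "dist (h (fst z) (snd z)) (h (fst z') (snd z')) \<le> K * (norm (fst (z - z')) + norm (snd (z - z')))"
      using lip by (simp add: dist_norm)
    also have "\<dots> \<le> K * (norm (z - z') + norm (z - z'))"
      using K by (intro mult_left_mono add_mono norm_fst_le' norm_snd_le') auto
    finally show "dist (h (fst z) (snd z)) (h (fst z') (snd z')) \<le> 2 * K * dist z z'"
      by (simp add: dist_norm)
  qed (use K in simp)
  then have [measurable]: "(\<lambda>z. h (fst z) (snd z)) \<in> borel_measurable borel"
    by (intro borel_measurable_continuous_onI lipschitz_on_continuous_on)
  have [measurable]: "(\<lambda>\<omega>. (X \<omega>, \<alpha> \<omega>)) \<in> borel_measurable M" by simp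
  have "(\<lambda>\<omega>. h (fst (X \<omega>, \<alpha> \<omega>)) (snd (X \<omega>, \<alpha> \<omega>))) \<in> borel_measurable M"
    by measurable
  then show ?thesis by simp
qed

context prob_space
begin

lemma L2_const: "(\<lambda>\<omega>. c) \<in> L2 M"
  by (simp add: L2_def)

lemma L2_norm_const: "L2_norm M (\<lambda>\<omega>. c) = norm c"
  by (simp add: L2_norm_def prob_space)

lemma integrable_L2:
  assumes "X \<in> L2 M"
  shows "integrable M (\<lambda>\<omega>. norm (X \<omega>))"
  by (rule square_integrable_imp_integrable) (use L2D[OF assms] in auto)

lemma integral_norm_le_L2_norm:
  assumes "X \<in> L2 M"
  shows "(\<integral>\<omega>. norm (X \<omega>) \<partial>M) \<le> L2_norm M X"
  using integral_norm_mult_le_L2_norm[OF assms L2_const[of "1::real"]]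
  by (simp add: L2_norm_const)

text \<open>The \<open>L\<^sup>2\<close> limit of the Picard iterates is the almost sure limit of a subsequence; it
  inherits the \<open>L\<^sup>2\<close> bounds by Fatou's lemma. This takes the place of the completeness of
  \<open>L\<^sup>2\<close> in Banach's fixed point theorem.\<close>

lemma L2_contraction_fixpoint:
  fixes T :: "('a \<Rightarrow> 'v::euclidean_space) \<Rightarrow> 'a \<Rightarrow> 'v"
  assumes T: "\<And>\<alpha>. \<alpha> \<in> L2 M \<Longrightarrow> T \<alpha> \<in> L2 M"
    and lip: "\<And>\<alpha> \<beta>. \<alpha> \<in> L2 M \<Longrightarrow> \<beta> \<in> L2 M \<Longrightarrow>
      L2_norm M (\<lambda>\<omega>. T \<alpha> \<omega> - T \<beta> \<omega>) \<le> k * L2_norm M (\<lambda>\<omega>. \<alpha> \<omega> - \<beta> \<omega>)"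
    and k: "0 \<le> k" "k < 1"
  shows "\<exists>\<alpha>\<in>L2 M. AE \<omega> in M. T \<alpha> \<omega> = \<alpha> \<omega>"
proof -
  define s where "s n = (T ^^ n) (\<lambda>_. 0)" for n
  have s: "s n \<in> L2 M" for n
    by (induction n) (auto simp: s_def L2_const T)
  have s_Suc: "s (Suc n) = T (s n)" for n by (simp add: s_def)
  define c where "c = L2_norm M (\<lambda>\<omega>. s 1 \<omega> - s 0 \<omega>)"
  have c0: "0 \<le> c" by (simp add: c_def L2_norm_nonneg)
  have step: "L2_norm M (\<lambda>\<omega>. s (Suc n) \<omega> - s n \<omega>) \<le> c * k ^ n" for n
  proof (induction n)
    case (Suc n)
    have "L2_norm M (\<lambda>\<omega>. s (Suc (Suc n)) \<omega> - s (Suc n) \<omega>)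
        \<le> k * L2_norm M (\<lambda>\<omega>. s (Suc n) \<omega> - s n \<omega>)"
      using lip[OF s s, of "Suc n" n] unfolding s_Suc .
    also have "\<dots> \<le> k * (c * k ^ n)" using Suc k by (intro mult_left_mono)
    finally show ?case by (simp add: mult_ac)
  qed (simp add: c_def)
  \<comment> \<open>The tail of the geometric series that bounds the remaining steps.\<close>
  define R where "R n = c * k ^ n / (1 - k)" for n
  have R_Suc: "c * k ^ n + R (Suc n) = R n" for n
    using k by (simp add: R_def field_simps)
  have "L2_norm M (\<lambda>\<omega>. s (n + m) \<omega> - s n \<omega>) \<le> R n - R (n + m)" for n m
  proof (induction m)
    case 0
    show ?case by (simp add: L2_norm_def)
  next
    case (Suc m)
    have "L2_norm M (\<lambda>\<omega>. s (n + Suc m) \<omega> - s n \<omega>)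
      \<le> L2_norm M (\<lambda>\<omega>. s (Suc (n + m)) \<omega> - s (n + m) \<omega>) + L2_norm M (\<lambda>\<omega>. s (n + m) \<omega> - s n \<omega>)"
      using L2_norm_diff_triangle[OF s s s] by simp
    also have "\<dots> \<le> c * k ^ (n + m) + (R n - R (n + m))"
      using step Suc by (intro add_mono)
    finally show ?case using R_Suc[of "n + m"] by simp
  qed
  note s_diff = this
  have R0: "0 \<le> R n" for n using k c0 by (simp add: R_def)
  have s_dist: "L2_norm M (\<lambda>\<omega>. s m \<omega> - s n \<omega>) \<le> R n" if "n \<le> m" for n m
    using that s_diff[of n "m - n"] R0[of m] by auto
  have R_lim: "R \<longlonglongrightarrow> 0"
    unfolding R_def using k by (auto intro!: tendsto_eq_intros LIMSEQ_power_zero)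
  have s_meas[measurable]: "s n \<in> borel_measurable M" for n by (rule L2D(1)[OF s])
  obtain r where r: "strict_mono r" "AE \<omega> in M. Cauchy (\<lambda>i. s (r i) \<omega>)"
  proof (rule cauchy_L1_AE_cauchy_subseq[of M s])
    show "integrable M (s n)" for n
      by (rule integrable_norm_cancel[OF integrable_L2[OF s]]) measurable
    fix e :: real assume "e > 0"
    then obtain N where N: "R N < e"
      using order_tendstoD(2)[OF R_lim] by (auto simp: eventually_sequentially)
    have le: "(LINT \<omega>|M. norm (s i \<omega> - s j \<omega>)) < e" if "N \<le> j" "j \<le> i" for i j
    proof -
      have "(LINT \<omega>|M. norm (s i \<omega> - s j \<omega>)) \<le> R j"
        using order_trans[OF integral_norm_le_L2_norm[OF L2_diff[OF s s]] s_dist[OF that(2)]] .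
      also have "R j \<le> R N"
        unfolding R_def using k c0 that
        by (intro divide_right_mono mult_left_mono power_decreasing) auto
      finally show ?thesis using N by simp
    qed
    have "(LINT \<omega>|M. norm (s i \<omega> - s j \<omega>)) < e" if "N \<le> j" "N \<le> i" for i j
      using le[of i j] le[of j i] that by (cases "j \<le> i") (auto simp: norm_minus_commute)
    then show "\<exists>N. \<forall>i\<ge>N. \<forall>j\<ge>N. LINT \<omega>|M. norm (s i \<omega> - s j \<omega>) < e" by blast
  qed
  define \<alpha> where "\<alpha> \<omega> = lim (\<lambda>i. s (r i) \<omega>)" for \<omega>
  have \<alpha>_meas[measurable]: "\<alpha> \<in> borel_measurable M"
    unfolding \<alpha>_def by measurable
  have conv: "AE \<omega> in M. (\<lambda>i. s (r i) \<omega>) \<longlonglongrightarrow> \<alpha> \<omega>"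
    using r(2) by eventually_elim (simp add: \<alpha>_def Cauchy_convergent_iff convergent_LIMSEQ_iff)
  have fatou: "(\<integral>\<^sup>+\<omega>. ennreal ((norm (\<alpha> \<omega> - s n \<omega>))\<^sup>2) \<partial>M) \<le> ennreal ((R n)\<^sup>2)" for n
  proof -
    have "(\<integral>\<^sup>+\<omega>. ennreal ((norm (\<alpha> \<omega> - s n \<omega>))\<^sup>2) \<partial>M)
        = (\<integral>\<^sup>+\<omega>. liminf (\<lambda>i. ennreal ((norm (s (r i) \<omega> - s n \<omega>))\<^sup>2)) \<partial>M)"
    proof (rule nn_integral_cong_AE)
      show "AE \<omega> in M. ennreal ((norm (\<alpha> \<omega> - s n \<omega>))\<^sup>2)
          = liminf (\<lambda>i. ennreal ((norm (s (r i) \<omega> - s n \<omega>))\<^sup>2))"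
        using conv
      proof eventually_elim
        case (elim \<omega>)
        have "(\<lambda>i. ennreal ((norm (s (r i) \<omega> - s n \<omega>))\<^sup>2)) \<longlonglongrightarrow> ennreal ((norm (\<alpha> \<omega> - s n \<omega>))\<^sup>2)"
          by (intro tendsto_intros elim)
        then show ?case by (rule lim_imp_Liminf[symmetric, rotated]) simp
      qed
    qed
    also have "\<dots> \<le> liminf (\<lambda>i. \<integral>\<^sup>+\<omega>. ennreal ((norm (s (r i) \<omega> - s n \<omega>))\<^sup>2) \<partial>M)"
      by (rule nn_integral_liminf) measurable
    also have "\<dots> \<le> ennreal ((R n)\<^sup>2)"
    proof (rule Liminf_le[OF _ eventually_sequentiallyI])
      fix i assume "n \<le> i"
      then have "n \<le> r i" using seq_suble[OF r(1), of i] by simp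
      have "(\<integral>\<^sup>+\<omega>. ennreal ((norm (s (r i) \<omega> - s n \<omega>))\<^sup>2) \<partial>M)
          = ennreal ((L2_norm M (\<lambda>\<omega>. s (r i) \<omega> - s n \<omega>))\<^sup>2)"
        unfolding L2_norm_sq by (rule nn_integral_eq_integral) (auto intro!: L2D(2) L2_diff s)
      also have "\<dots> \<le> ennreal ((R n)\<^sup>2)"
        using s_dist[OF \<open>n \<le> r i\<close>] by (intro ennreal_leI power_mono) (auto simp: L2_norm_nonneg)
      finally show "(\<integral>\<^sup>+\<omega>. ennreal ((norm (s (r i) \<omega> - s n \<omega>))\<^sup>2) \<partial>M) \<le> ennreal ((R n)\<^sup>2)" .
    qed (rule trivial_limit_sequentially)
    finally show ?thesis .
  qed
  have diff: "(\<lambda>\<omega>. \<alpha> \<omega> - s n \<omega>) \<in> L2 M" for n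
  proof -
    have "integrable M (\<lambda>\<omega>. (norm (\<alpha> \<omega> - s n \<omega>))\<^sup>2)"
      using fatou[of n] by (intro integrableI_bounded) (auto simp: less_top[symmetric] top_unique)
    then show ?thesis by (simp add: L2_def)
  qed
  have \<alpha>: "\<alpha> \<in> L2 M" using L2_add[OF diff[of 0] s[of 0]] by simp
  have near: "L2_norm M (\<lambda>\<omega>. \<alpha> \<omega> - s n \<omega>) \<le> R n" for n
  proof -
    have "ennreal ((L2_norm M (\<lambda>\<omega>. \<alpha> \<omega> - s n \<omega>))\<^sup>2) \<le> ennreal ((R n)\<^sup>2)"
      unfolding L2_norm_sq using fatou[of n] L2D(2)[OF diff, of n]
      by (subst (asm) nn_integral_eq_integral) auto
    then have "(L2_norm M (\<lambda>\<omega>. \<alpha> \<omega> - s n \<omega>))\<^sup>2 \<le> (R n)\<^sup>2"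
      by (subst (asm) ennreal_le_iff) auto
    then show ?thesis by (rule power2_le_imp_le[OF _ R0])
  qed
  have "L2_norm M (\<lambda>\<omega>. T \<alpha> \<omega> - \<alpha> \<omega>) \<le> k * R n + R (Suc n)" for n
  proof -
    have "L2_norm M (\<lambda>\<omega>. T \<alpha> \<omega> - \<alpha> \<omega>)
        \<le> L2_norm M (\<lambda>\<omega>. T \<alpha> \<omega> - s (Suc n) \<omega>) + L2_norm M (\<lambda>\<omega>. s (Suc n) \<omega> - \<alpha> \<omega>)"
      by (rule L2_norm_diff_triangle) (auto intro: T \<alpha> s)
    also have "\<dots> \<le> k * R n + R (Suc n)"
    proof (rule add_mono)
      have "L2_norm M (\<lambda>\<omega>. T \<alpha> \<omega> - s (Suc n) \<omega>) \<le> k * L2_norm M (\<lambda>\<omega>. \<alpha> \<omega> - s n \<omega>)"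
        unfolding s_Suc by (rule lip[OF \<alpha> s])
      also have "\<dots> \<le> k * R n" using near k by (intro mult_left_mono)
      finally show "L2_norm M (\<lambda>\<omega>. T \<alpha> \<omega> - s (Suc n) \<omega>) \<le> k * R n" .
      show "L2_norm M (\<lambda>\<omega>. s (Suc n) \<omega> - \<alpha> \<omega>) \<le> R (Suc n)"
        using near[of "Suc n"] by (subst L2_norm_minus_commute)
    qed
    finally show ?thesis .
  qed
  moreover have "(\<lambda>n. k * R n + R (Suc n)) \<longlonglongrightarrow> k * 0 + 0"
    by (intro tendsto_add tendsto_mult tendsto_const R_lim LIMSEQ_Suc[OF R_lim])
  ultimately have "L2_norm M (\<lambda>\<omega>. T \<alpha> \<omega> - \<alpha> \<omega>) \<le> 0"
    by (intro LIMSEQ_le_const[of "\<lambda>n. k * R n + R (Suc n)"]) auto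
  then have "L2_norm M (\<lambda>\<omega>. T \<alpha> \<omega> - \<alpha> \<omega>) = 0"
    using L2_norm_nonneg[of M "\<lambda>\<omega>. T \<alpha> \<omega> - \<alpha> \<omega>"] by linarith
  then have "AE \<omega> in M. T \<alpha> \<omega> - \<alpha> \<omega> = 0"
    by (intro L2_norm_eq_0_imp_AE L2_diff T \<alpha>)
  then show ?thesis using \<alpha> by auto
qed

text \<open>Zarantonello's theorem: a Lipschitz and strongly monotone operator on \<open>L\<^sup>2\<close> has a zero,
  since \<open>\<alpha> \<mapsto> \<alpha> - t F \<alpha>\<close> is a contraction for small \<open>t > 0\<close>.\<close>

lemma L2_strongly_monotone_zero:
  fixes F :: "('a \<Rightarrow> 'v::euclidean_space) \<Rightarrow> 'a \<Rightarrow> 'v"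
  assumes F: "\<And>\<alpha>. \<alpha> \<in> L2 M \<Longrightarrow> F \<alpha> \<in> L2 M"
    and lip: "\<And>\<alpha> \<beta>. \<alpha> \<in> L2 M \<Longrightarrow> \<beta> \<in> L2 M \<Longrightarrow>
      L2_norm M (\<lambda>\<omega>. F \<alpha> \<omega> - F \<beta> \<omega>) \<le> \<Lambda> * L2_norm M (\<lambda>\<omega>. \<alpha> \<omega> - \<beta> \<omega>)"
    and mono: "\<And>\<alpha> \<beta>. \<alpha> \<in> L2 M \<Longrightarrow> \<beta> \<in> L2 M \<Longrightarrow>
      \<gamma> * (L2_norm M (\<lambda>\<omega>. \<alpha> \<omega> - \<beta> \<omega>))\<^sup>2 \<le> (\<integral>\<omega>. (F \<alpha> \<omega> - F \<beta> \<omega>) \<bullet> (\<alpha> \<omega> - \<beta> \<omega>) \<partial>M)"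
    and \<gamma>: "\<gamma> > 0"
  shows "\<exists>\<alpha>\<in>L2 M. AE \<omega> in M. F \<alpha> \<omega> = 0"
proof -
  define \<Lambda>' where "\<Lambda>' = max \<Lambda> \<gamma>"
  have \<Lambda>': "\<Lambda>' > 0" "\<gamma> \<le> \<Lambda>'" "\<Lambda> \<le> \<Lambda>'" using \<gamma> by (auto simp: \<Lambda>'_def)
  \<comment> \<open>This step size minimizes the contraction factor \<open>1 - 2 t \<gamma> + t\<^sup>2 \<Lambda>'\<^sup>2\<close>; it is
    nonnegative because \<open>\<gamma> \<le> \<Lambda>'\<close>.\<close>
  define t where "t = \<gamma> / \<Lambda>'\<^sup>2"
  have t: "t > 0" using \<gamma> \<Lambda>' by (simp add: t_def)
  define q where "q = 1 - (\<gamma> / \<Lambda>')\<^sup>2"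
  have q: "0 \<le> q" "q < 1"
    using \<gamma> \<Lambda>' by (auto simp: q_def power_le_one)
  have q_eq: "1 - 2 * t * \<gamma> + t\<^sup>2 * \<Lambda>'\<^sup>2 = q"
  proof -
    have "t * \<gamma> = (\<gamma> / \<Lambda>')\<^sup>2" "t\<^sup>2 * \<Lambda>'\<^sup>2 = (\<gamma> / \<Lambda>')\<^sup>2"
      using \<Lambda>' by (simp_all add: t_def power2_eq_square)
    then show ?thesis by (simp add: q_def)
  qed
  have "\<exists>\<alpha>\<in>L2 M. AE \<omega> in M. (\<lambda>\<alpha> \<omega>. \<alpha> \<omega> - t *\<^sub>R F \<alpha> \<omega>) \<alpha> \<omega> = \<alpha> \<omega>"
  proof (rule L2_contraction_fixpoint[where k = "sqrt q"])
    show "(\<lambda>\<omega>. \<alpha> \<omega> - t *\<^sub>R F \<alpha> \<omega>) \<in> L2 M" if "\<alpha> \<in> L2 M" for \<alpha>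
      using that by (intro L2_diff L2_scaleR F)
    show "0 \<le> sqrt q" "sqrt q < 1" using q by auto
    fix \<alpha> \<beta> :: "'a \<Rightarrow> 'v" assume \<alpha>: "\<alpha> \<in> L2 M" and \<beta>: "\<beta> \<in> L2 M"
    define D where "D = (\<lambda>\<omega>. \<alpha> \<omega> - \<beta> \<omega>)"
    define E where "E = (\<lambda>\<omega>. F \<alpha> \<omega> - F \<beta> \<omega>)"
    have D: "D \<in> L2 M" and E: "E \<in> L2 M"
      unfolding D_def E_def by (intro L2_diff \<alpha> \<beta> F)+
    have "L2_norm M E \<le> \<Lambda> * L2_norm M D" using lip[OF \<alpha> \<beta>] by (simp add: D_def E_def)
    also have "\<dots> \<le> \<Lambda>' * L2_norm M D" by (intro mult_right_mono \<Lambda>' L2_norm_nonneg)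
    finally have "(L2_norm M E)\<^sup>2 \<le> (\<Lambda>' * L2_norm M D)\<^sup>2"
      by (intro power_mono L2_norm_nonneg)
    then have E_le: "t\<^sup>2 * (L2_norm M E)\<^sup>2 \<le> t\<^sup>2 * (\<Lambda>' * L2_norm M D)\<^sup>2"
      by (intro mult_left_mono) auto
    have "\<gamma> * (L2_norm M D)\<^sup>2 \<le> (\<integral>\<omega>. D \<omega> \<bullet> E \<omega> \<partial>M)"
      using mono[OF \<alpha> \<beta>] by (simp add: D_def E_def inner_commute)
    then have DE: "2 * t * (\<gamma> * (L2_norm M D)\<^sup>2) \<le> 2 * t * (\<integral>\<omega>. D \<omega> \<bullet> E \<omega> \<partial>M)"
      using t by (intro mult_left_mono) auto
    have "(L2_norm M (\<lambda>\<omega>. D \<omega> + (- t) *\<^sub>R E \<omega>))\<^sup>2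
        = (L2_norm M D)\<^sup>2 - 2 * t * (\<integral>\<omega>. D \<omega> \<bullet> E \<omega> \<partial>M) + t\<^sup>2 * (L2_norm M E)\<^sup>2"
      by (subst L2_norm_add_sq[OF D L2_scaleR[OF E]], subst L2_norm_scaleR)
         (simp add: power_mult_distrib)
    also have "\<dots> \<le> (L2_norm M D)\<^sup>2 - 2 * t * (\<gamma> * (L2_norm M D)\<^sup>2) + t\<^sup>2 * (\<Lambda>' * L2_norm M D)\<^sup>2"
      using E_le DE by linarith
    also have "\<dots> = (1 - 2 * t * \<gamma> + t\<^sup>2 * \<Lambda>'\<^sup>2) * (L2_norm M D)\<^sup>2"
      by algebra
    also have "\<dots> = (sqrt q * L2_norm M D)\<^sup>2"
      unfolding q_eq using q by (simp add: power_mult_distrib)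
    finally have "L2_norm M (\<lambda>\<omega>. D \<omega> + (- t) *\<^sub>R E \<omega>) \<le> sqrt q * L2_norm M D"
      by (rule power2_le_imp_le) (use q in \<open>simp add: L2_norm_nonneg\<close>)
    then show "L2_norm M (\<lambda>\<omega>. (\<alpha> \<omega> - t *\<^sub>R F \<alpha> \<omega>) - (\<beta> \<omega> - t *\<^sub>R F \<beta> \<omega>))
        \<le> sqrt q * L2_norm M (\<lambda>\<omega>. \<alpha> \<omega> - \<beta> \<omega>)"
      by (simp add: D_def E_def algebra_simps)
  qed
  then show ?thesis using t by auto
qed

end

section \<open>Laws, couplings and the Wasserstein distance\<close>

lemma P2_iff: "\<mu> \<in> P2 \<longleftrightarrow> prob_space \<mu> \<and> sets \<mu> = sets borel \<and> integrable \<mu> (\<lambda>x. (norm x)\<^sup>2)"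
  by (simp add: wspace_def)

lemma P2D:
  assumes "\<mu> \<in> P2"
  shows "prob_space \<mu>" "sets \<mu> = sets borel" "space \<mu> = UNIV"
  using assms by (auto simp: P2_iff dest: sets_eq_imp_space_eq)

lemma P2_id_L2:
  assumes "\<mu> \<in> P2"
  shows "(\<lambda>x. x) \<in> L2 \<mu>"
  using assms P2D(2)[OF assms] by (auto simp: P2_iff L2_def cong: measurable_cong_sets)

lemma (in prob_space) law_P2:
  assumes "Y \<in> L2 M"
  shows "law M Y \<in> P2"
  using assms L2D[OF assms] by (auto simp: P2_iff prob_space_distr integrable_distr_eq)

lemma (in prob_space) law_pair_coupling:
  assumes "Y \<in> borel_measurable M" "Y' \<in> borel_measurable M"
  shows "law M (\<lambda>\<omega>. (Y \<omega>, Y' \<omega>)) \<in> couplings (law M Y) (law M Y')"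
proof -
  have m: "(\<lambda>\<omega>. (Y \<omega>, Y' \<omega>)) \<in> borel_measurable M" using assms by simp
  show ?thesis
    unfolding couplings_def using m by (auto simp: prob_space_distr distr_distr comp_def)
qed

lemma enn2real_INF_le:
  assumes "\<pi> \<in> S" "g \<pi> \<le> ennreal r" "0 \<le> r"
  shows "enn2real (INF \<pi>\<in>S. g \<pi>) \<le> r"
  using assms by (intro enn2real_leI) (auto intro: INF_lower2)

lemma (in prob_space) wdist_1_law_le:
  assumes "Y \<in> L2 M" "Y' \<in> L2 M"
  shows "wdist 1 (law M Y) (law M Y') \<le> (\<integral>\<omega>. norm (Y \<omega> - Y' \<omega>) \<partial>M)"
proof -
  note [measurable] = assms[THEN L2D(1)]
  let ?\<pi> = "law M (\<lambda>\<omega>. (Y \<omega>, Y' \<omega>))"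
  have "(\<integral>\<^sup>+ z. ennreal (dist (fst z) (snd z) powr 1) \<partial>?\<pi>) = (\<integral>\<^sup>+\<omega>. ennreal (norm (Y \<omega> - Y' \<omega>)) \<partial>M)"
    by (subst nn_integral_distr) (auto simp: dist_norm)
  also have "\<dots> = ennreal (\<integral>\<omega>. norm (Y \<omega> - Y' \<omega>) \<partial>M)"
    by (intro nn_integral_eq_integral integrable_L2 L2_diff assms) auto
  finally show ?thesis
    unfolding wdist_def
    using enn2real_INF_le[OF law_pair_coupling[of Y Y'], where r = "\<integral>\<omega>. norm (Y \<omega> - Y' \<omega>) \<partial>M"]
    by simp
qed

lemma (in prob_space) wdist_2_law_le:
  assumes "Y \<in> L2 M" "Y' \<in> L2 M"
  shows "wdist 2 (law M Y) (law M Y') \<le> L2_norm M (\<lambda>\<omega>. Y \<omega> - Y' \<omega>)"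
proof -
  note [measurable] = assms[THEN L2D(1)]
  let ?\<pi> = "law M (\<lambda>\<omega>. (Y \<omega>, Y' \<omega>))" and ?r = "(L2_norm M (\<lambda>\<omega>. Y \<omega> - Y' \<omega>))\<^sup>2"
  have "(\<integral>\<^sup>+ z. ennreal (dist (fst z) (snd z) powr 2) \<partial>?\<pi>) = (\<integral>\<^sup>+\<omega>. ennreal ((norm (Y \<omega> - Y' \<omega>))\<^sup>2) \<partial>M)"
    by (subst nn_integral_distr) (auto simp: dist_norm)
  also have "\<dots> = ennreal ?r"
    unfolding L2_norm_sq by (intro nn_integral_eq_integral L2D(2) L2_diff assms) auto
  finally have le: "enn2real (INF \<pi>\<in>couplings (law M Y) (law M Y').
      \<integral>\<^sup>+ z. ennreal (dist (fst z) (snd z) powr 2) \<partial>\<pi>) \<le> ?r"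
    by (intro enn2real_INF_le[OF law_pair_coupling[of Y Y']]) auto
  have "wdist 2 (law M Y) (law M Y') \<le> ?r powr (1/2)"
    unfolding wdist_def by (intro powr_mono2 le) auto
  then show ?thesis by (simp add: powr_half_sqrt L2_norm_nonneg)
qed

lemma wdist_1_self:
  assumes "\<mu> \<in> P2"
  shows "wdist 1 \<mu> \<mu> = 0"
proof -
  interpret prob_space \<mu> using assms by (rule P2D)
  have "law \<mu> (\<lambda>x. x) = \<mu>" using P2D(2)[OF assms] by (intro distr_id2) simp
  then have "wdist 1 \<mu> \<mu> \<le> 0"
    using wdist_1_law_le[OF P2_id_L2[OF assms] P2_id_L2[OF assms]] by simp
  moreover have "0 \<le> wdist 1 \<mu> \<mu>" by (simp add: wdist_def)
  ultimately show ?thesis by simp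
qed

lemma couplings_nonempty:
  assumes "\<mu> \<in> P2" "\<nu> \<in> P2"
  shows "couplings \<mu> \<nu> \<noteq> {}"
proof -
  interpret \<mu>: prob_space \<mu> using assms(1) by (rule P2D)
  interpret \<nu>: prob_space \<nu> using assms(2) by (rule P2D)
  interpret pair_prob_space \<mu> \<nu> ..
  have sets: "sets (\<mu> \<Otimes>\<^sub>M \<nu>) = sets borel"
    by (subst borel_prod[symmetric]) (intro sets_pair_measure_cong P2D(2) assms)
  have m: "fst \<in> borel_measurable (\<mu> \<Otimes>\<^sub>M \<nu>)" "snd \<in> borel_measurable (\<mu> \<Otimes>\<^sub>M \<nu>)"
    by (simp_all add: measurable_cong_sets[OF sets refl])
  have "distr (\<mu> \<Otimes>\<^sub>M \<nu>) borel fst = \<mu>"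
  proof (rule measure_eqI)
    fix A assume "A \<in> sets (distr (\<mu> \<Otimes>\<^sub>M \<nu>) borel fst)"
    then have A: "A \<in> sets borel" by simp
    have "emeasure (distr (\<mu> \<Otimes>\<^sub>M \<nu>) borel fst) A = emeasure (\<mu> \<Otimes>\<^sub>M \<nu>) (A \<times> space \<nu>)"
      using A P2D(3) assms by (subst emeasure_distr[OF m(1) A])
        (auto simp: space_pair_measure intro!: arg_cong[where f = "emeasure _"])
    also have "\<dots> = emeasure \<mu> A"
      using A P2D(2)[OF assms(1)] by (simp add: \<nu>.emeasure_pair_measure_Times \<nu>.emeasure_space_1)
    finally show "emeasure (distr (\<mu> \<Otimes>\<^sub>M \<nu>) borel fst) A = emeasure \<mu> A" .
  qed (simp add: P2D(2)[OF assms(1)])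
  moreover have "distr (\<mu> \<Otimes>\<^sub>M \<nu>) borel snd = \<nu>"
  proof (rule measure_eqI)
    fix A assume "A \<in> sets (distr (\<mu> \<Otimes>\<^sub>M \<nu>) borel snd)"
    then have A: "A \<in> sets borel" by simp
    have "emeasure (distr (\<mu> \<Otimes>\<^sub>M \<nu>) borel snd) A = emeasure (\<mu> \<Otimes>\<^sub>M \<nu>) (space \<mu> \<times> A)"
      using A P2D(3) assms by (subst emeasure_distr[OF m(2) A])
        (auto simp: space_pair_measure intro!: arg_cong[where f = "emeasure _"])
    also have "\<dots> = emeasure \<nu> A"
      using A P2D(2)[OF assms(2)] by (simp add: \<nu>.emeasure_pair_measure_Times \<mu>.emeasure_space_1)
    finally show "emeasure (distr (\<mu> \<Otimes>\<^sub>M \<nu>) borel snd) A = emeasure \<nu> A" .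
  qed (simp add: P2D(2)[OF assms(2)])
  ultimately have "\<mu> \<Otimes>\<^sub>M \<nu> \<in> couplings \<mu> \<nu>"
    using sets prob_space_axioms by (simp add: couplings_def)
  then show ?thesis by blast
qed

lemma coupling_L2:
  assumes "\<mu> \<in> P2" "\<nu> \<in> P2" "\<pi> \<in> couplings \<mu> \<nu>"
  shows "prob_space \<pi>" "fst \<in> L2 \<pi>" "snd \<in> L2 \<pi>" "law \<pi> fst = \<mu>" "law \<pi> snd = \<nu>"
proof -
  show pi: "prob_space \<pi>" "law \<pi> fst = \<mu>" "law \<pi> snd = \<nu>"
    using assms(3) by (auto simp: couplings_def)
  have sets: "sets \<pi> = sets borel" using assms(3) by (simp add: couplings_def)
  have m: "fst \<in> borel_measurable \<pi>" "snd \<in> borel_measurable \<pi>"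
    by (simp_all add: measurable_cong_sets[OF sets refl])
  have "integrable (law \<pi> fst) (\<lambda>x. (norm x)\<^sup>2)" "integrable (law \<pi> snd) (\<lambda>x. (norm x)\<^sup>2)"
    unfolding pi using assms by (auto simp: P2_iff)
  then show "fst \<in> L2 \<pi>" "snd \<in> L2 \<pi>"
    using m by (auto simp: L2_def integrable_distr_eq)
qed

lemma wdist_2_ge:
  assumes "\<mu> \<in> P2" "\<nu> \<in> P2" "0 \<le> c"
    and le: "\<And>\<pi>. \<pi> \<in> couplings \<mu> \<nu> \<Longrightarrow> c \<le> L2_norm \<pi> (\<lambda>z. fst z - snd z)"
  shows "c \<le> wdist 2 \<mu> \<nu>"
proof -
  define J where "J = (INF \<pi>\<in>couplings \<mu> \<nu>. \<integral>\<^sup>+ z. ennreal (dist (fst z) (snd z) powr 2) \<partial>\<pi>)"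
  have cost: "(\<integral>\<^sup>+ z. ennreal (dist (fst z) (snd z) powr 2) \<partial>\<pi>) = ennreal ((L2_norm \<pi> (\<lambda>z. fst z - snd z))\<^sup>2)"
    if "\<pi> \<in> couplings \<mu> \<nu>" for \<pi>
    unfolding L2_norm_sq using coupling_L2[OF assms(1,2) that]
    by (subst nn_integral_eq_integral[symmetric]) (auto intro!: L2D(2) L2_diff simp: dist_norm)
  have "ennreal (c\<^sup>2) \<le> J"
    unfolding J_def
  proof (intro INF_greatest)
    fix \<pi> assume \<pi>: "\<pi> \<in> couplings \<mu> \<nu>"
    show "ennreal (c\<^sup>2) \<le> (\<integral>\<^sup>+ z. ennreal (dist (fst z) (snd z) powr 2) \<partial>\<pi>)"
      unfolding cost[OF \<pi>] by (intro ennreal_leI power_mono le[OF \<pi>] assms)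
  qed
  moreover have "J < \<top>"
  proof -
    obtain \<pi> where \<pi>: "\<pi> \<in> couplings \<mu> \<nu>" using couplings_nonempty[OF assms(1,2)] by blast
    have "J \<le> ennreal ((L2_norm \<pi> (\<lambda>z. fst z - snd z))\<^sup>2)"
      unfolding J_def cost[OF \<pi>, symmetric] by (rule INF_lower[OF \<pi>])
    then show ?thesis by (metis ennreal_less_top le_less_trans)
  qed
  ultimately have "c\<^sup>2 \<le> enn2real J"
    by (metis enn2real_mono enn2real_ennreal zero_le_power2)
  then have "(c\<^sup>2) powr (1/2) \<le> enn2real J powr (1/2)" by (intro powr_mono2) auto
  then show ?thesis using assms(3) by (simp add: wdist_def J_def powr_half_sqrt)
qed


section \<open>Mixtures and the mean value theorem for flat derivatives\<close>

lemma sets_mixture [simp]: "sets (mixture t \<mu> \<nu>) = sets borel"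
  unfolding mixture_def by (metis sets.sets_measure_of_eq space_borel)

lemma space_mixture [simp]: "space (mixture t \<mu> \<nu>) = UNIV"
  using sets_eq_imp_space_eq[OF sets_mixture] by simp

lemma measurable_mixture [simp]: "borel_measurable (mixture t \<mu> \<nu>) = borel_measurable borel"
  by (intro measurable_cong_sets) auto

lemma mixture_commute:
  assumes "sets \<mu> = sets borel" "sets \<nu> = sets borel"
  shows "mixture (1 - t) \<nu> \<mu> = mixture t \<mu> \<nu>"
  by (rule measure_eqI) (auto simp: emeasure_mixture assms add.commute)

lemma mixture_0 [simp]: "sets \<mu> = sets borel \<Longrightarrow> sets \<nu> = sets borel \<Longrightarrow> mixture 0 \<mu> \<nu> = \<mu>"
  and mixture_1 [simp]: "sets \<mu> = sets borel \<Longrightarrow> sets \<nu> = sets borel \<Longrightarrow> mixture 1 \<mu> \<nu> = \<nu>"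
  by (rule measure_eqI; simp add: emeasure_mixture)+

text \<open>A mixture is the law of a random point that is drawn from one of the two measures, the
  measure being chosen by a coin toss.\<close>

lemma mixture_eq_bind:
  assumes "\<mu> \<in> P2" "\<nu> \<in> P2" "0 \<le> t" "t \<le> 1"
  shows "mixture t \<mu> \<nu> = measure_pmf (bernoulli_pmf t) \<bind> (\<lambda>b. if b then \<nu> else \<mu>)"
    and "(\<lambda>b. if b then \<nu> else \<mu>) \<in> measure_pmf (bernoulli_pmf t) \<rightarrow>\<^sub>M subprob_algebra borel"
proof -
  show K: "(\<lambda>b. if b then \<nu> else \<mu>) \<in> measure_pmf (bernoulli_pmf t) \<rightarrow>\<^sub>M subprob_algebra borel"
    using P2D(1,2)[OF assms(1)] P2D(1,2)[OF assms(2)]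
    by (auto simp: space_subprob_algebra prob_space_imp_subprob_space)
  show "mixture t \<mu> \<nu> = measure_pmf (bernoulli_pmf t) \<bind> (\<lambda>b. if b then \<nu> else \<mu>)"
  proof (rule measure_eqI)
    show s: "sets (mixture t \<mu> \<nu>) = sets (measure_pmf (bernoulli_pmf t) \<bind> (\<lambda>b. if b then \<nu> else \<mu>))"
      using P2D(2)[OF assms(1)] P2D(2)[OF assms(2)] by (subst sets_bind[of _ _ borel]) auto
    fix A assume A: "A \<in> sets (mixture t \<mu> \<nu>)"
    then show "emeasure (mixture t \<mu> \<nu>) A
        = emeasure (measure_pmf (bernoulli_pmf t) \<bind> (\<lambda>b. if b then \<nu> else \<mu>)) A"
      using assms P2D(2)[OF assms(1)] P2D(2)[OF assms(2)] by (subst emeasure_bind[OF _ K]) (auto simp: emeasure_mixture mult.commute add.commute)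
  qed
qed

lemma nn_integral_mixture:
  assumes "\<mu> \<in> P2" "\<nu> \<in> P2" "0 \<le> t" "t \<le> 1" "f \<in> borel_measurable borel"
  shows "(\<integral>\<^sup>+x. f x \<partial>mixture t \<mu> \<nu>)
    = ennreal (1 - t) * (\<integral>\<^sup>+x. f x \<partial>\<mu>) + ennreal t * (\<integral>\<^sup>+x. f x \<partial>\<nu>)"
  unfolding mixture_eq_bind(1)[OF assms(1-4)]
  by (subst nn_integral_bind[OF assms(5) mixture_eq_bind(2)[OF assms(1-4)]])
     (use assms in \<open>auto simp: mult.commute add.commute\<close>)

lemma integrable_mixture:
  fixes f :: "'a::euclidean_space \<Rightarrow> 'b::euclidean_space"
  assumes "\<mu> \<in> P2" "\<nu> \<in> P2" "0 \<le> t" "t \<le> 1" "integrable \<mu> f" "integrable \<nu> f"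
  shows "integrable (mixture t \<mu> \<nu>) f"
proof -
  have f: "f \<in> borel_measurable borel"
    using assms(5) P2D(2)[OF assms(1)] by (auto dest!: borel_measurable_integrable cong: measurable_cong_sets)
  show ?thesis
    using assms f nn_integral_mixture[OF assms(1-4), of "\<lambda>x. ennreal (norm (f x))"]
    by (auto simp: integrable_iff_bounded ennreal_mult_less_top)
qed

lemma mixture_P2:
  assumes "\<mu> \<in> P2" "\<nu> \<in> P2" "0 \<le> t" "t \<le> 1"
  shows "mixture t \<mu> \<nu> \<in> P2"
proof -
  have "emeasure (mixture t \<mu> \<nu>) UNIV = 1"
    using assms P2D[OF assms(1)] P2D[OF assms(2)]
    by (simp add: emeasure_mixture prob_space.emeasure_space_1[of \<mu>, simplified P2D(3)[OF assms(1)]]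
        prob_space.emeasure_space_1[of \<nu>, simplified P2D(3)[OF assms(2)]] flip: ennreal_plus)
  then have "prob_space (mixture t \<mu> \<nu>)" by (intro prob_spaceI) simp
  then show ?thesis
    using integrable_mixture[OF assms, of "\<lambda>x. (norm x)\<^sup>2"] assms by (simp add: P2_iff)
qed

lemma integral_mixture_real:
  fixes f :: "'a::euclidean_space \<Rightarrow> real"
  assumes "\<mu> \<in> P2" "\<nu> \<in> P2" "0 \<le> t" "t \<le> 1" "integrable \<mu> f" "integrable \<nu> f"
  shows "(\<integral>x. f x \<partial>mixture t \<mu> \<nu>) = (1 - t) * (\<integral>x. f x \<partial>\<mu>) + t * (\<integral>x. f x \<partial>\<nu>)"
proof -
  have f[measurable]: "f \<in> borel_measurable borel"
    using assms(5) P2D(2)[OF assms(1)] by (auto dest!: borel_measurable_integrable cong: measurable_cong_sets)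
  have fin: "(\<integral>\<^sup>+x. ennreal (g x) \<partial>M) < \<top>" if "integrable M g" for M and g :: "'a \<Rightarrow> real"
  proof -
    have "(\<integral>\<^sup>+x. ennreal (g x) \<partial>M) \<le> (\<integral>\<^sup>+x. ennreal (norm (g x)) \<partial>M)"
      by (intro nn_integral_mono ennreal_leI) auto
    then show ?thesis using that by (auto simp: integrable_iff_bounded intro: le_less_trans)
  qed
  have conv: "enn2real (\<integral>\<^sup>+x. ennreal (g x) \<partial>mixture t \<mu> \<nu>)
      = (1 - t) * enn2real (\<integral>\<^sup>+x. ennreal (g x) \<partial>\<mu>) + t * enn2real (\<integral>\<^sup>+x. ennreal (g x) \<partial>\<nu>)"
    if "integrable \<mu> g" "integrable \<nu> g" "g \<in> borel_measurable borel" for g :: "'a \<Rightarrow> real"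
    using that fin[of \<mu> g] fin[of \<nu> g] assms
    by (subst nn_integral_mixture[OF assms(1-4)])
       (auto simp: enn2real_plus enn2real_mult ennreal_mult_less_top)
  have "integrable \<mu> (\<lambda>x. - f x)" "integrable \<nu> (\<lambda>x. - f x)" using assms by auto
  note cf = conv[OF assms(5,6) f] conv[OF this borel_measurable_uminus[OF f]]
  show ?thesis
    unfolding real_lebesgue_integral_def[OF integrable_mixture[OF assms]]
      real_lebesgue_integral_def[OF assms(5)] real_lebesgue_integral_def[OF assms(6)] cf
    by (simp add: algebra_simps)
qed

lemma integral_mixture:
  fixes f :: "'a::euclidean_space \<Rightarrow> 'b::euclidean_space"
  assumes "\<mu> \<in> P2" "\<nu> \<in> P2" "0 \<le> t" "t \<le> 1" "integrable \<mu> f" "integrable \<nu> f"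
  shows "(\<integral>x. f x \<partial>mixture t \<mu> \<nu>) = (1 - t) *\<^sub>R (\<integral>x. f x \<partial>\<mu>) + t *\<^sub>R (\<integral>x. f x \<partial>\<nu>)"
proof (rule euclidean_eqI)
  fix b :: 'b assume "b \<in> Basis"
  show "(\<integral>x. f x \<partial>mixture t \<mu> \<nu>) \<bullet> b = ((1 - t) *\<^sub>R (\<integral>x. f x \<partial>\<mu>) + t *\<^sub>R (\<integral>x. f x \<partial>\<nu>)) \<bullet> b"
    using integral_mixture_real[OF assms(1-4), of "\<lambda>x. f x \<bullet> b"] assms integrable_mixture[OF assms]
    by (simp add: inner_add_left)
qed

lemma mixture_mixture:
  assumes "\<mu> \<in> P2" "\<nu> \<in> P2" "0 \<le> t" "t \<le> 1" "0 \<le> s" "s \<le> 1"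
  shows "mixture s (mixture t \<mu> \<nu>) \<nu> = mixture (t + s * (1 - t)) \<mu> \<nu>"
proof (rule measure_eqI)
  fix A assume "A \<in> sets (mixture s (mixture t \<mu> \<nu>) \<nu>)"
  then have A: "A \<in> sets borel" by simp
  interpret \<mu>: prob_space \<mu> using assms(1) by (rule P2D)
  interpret \<nu>: prob_space \<nu> using assms(2) by (rule P2D)
  have r: "0 \<le> t + s * (1 - t)" "t + s * (1 - t) \<le> 1"
    using assms mult_right_le_one_le[of "1 - t" s] by (auto simp: mult.commute)
  have "(1 - s) * ((1 - t) * measure \<mu> A + t * measure \<nu> A) + s * measure \<nu> A
      = (1 - (t + s * (1 - t))) * measure \<mu> A + (t + s * (1 - t)) * measure \<nu> A"
    by (simp add: algebra_simps)
  then show "emeasure (mixture s (mixture t \<mu> \<nu>) \<nu>) A = emeasure (mixture (t + s * (1 - t)) \<mu> \<nu>) A"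
    using assms A P2D(2)[OF assms(1)] P2D(2)[OF assms(2)] r
    by (simp add: emeasure_mixture \<mu>.emeasure_eq_measure \<nu>.emeasure_eq_measure
        flip: ennreal_mult ennreal_plus)
qed simp

lemma wdist_1_mixture_le:
  fixes \<pi>1 \<pi>2 :: "('a::euclidean_space \<times> 'a) measure"
  assumes "\<pi>1 \<in> P2" "\<pi>2 \<in> P2" "0 \<le> t" "t \<le> 1"
  shows "wdist 1 (mixture t (law \<pi>1 fst) (law \<pi>2 fst)) (mixture t (law \<pi>1 snd) (law \<pi>2 snd))
    \<le> (1 - t) * (\<integral>z. norm (fst z - snd z) \<partial>\<pi>1) + t * (\<integral>z. norm (fst z - snd z) \<partial>\<pi>2)"
proof -
  let ?\<pi> = "mixture t \<pi>1 \<pi>2"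
  have \<pi>: "?\<pi> \<in> P2" by (rule mixture_P2[OF assms])
  interpret prob_space ?\<pi> using \<pi> by (rule P2D)
  have meas: "borel_measurable \<pi>1 = borel_measurable borel" "borel_measurable \<pi>2 = borel_measurable borel"
    using P2D(2)[OF assms(1)] P2D(2)[OF assms(2)] by (auto intro: measurable_cong_sets)
  have law: "law ?\<pi> h = mixture t (law \<pi>1 h) (law \<pi>2 h)" if [measurable]: "h \<in> borel_measurable borel"
    for h :: "'a \<times> 'a \<Rightarrow> 'a"
  proof (rule measure_eqI)
    fix A assume "A \<in> sets (law ?\<pi> h)"
    then have [measurable]: "A \<in> sets borel" by simp
    have "h -` A \<in> sets borel" using measurable_sets[OF that, of A] by simp
    then show "emeasure (law ?\<pi> h) A = emeasure (mixture t (law \<pi>1 h) (law \<pi>2 h)) A"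
      using P2D[OF assms(1)] P2D[OF assms(2)]
      by (simp add: emeasure_distr emeasure_mixture meas)
  qed simp
  have L2: "fst \<in> L2 ?\<pi>" "snd \<in> L2 ?\<pi>" using L2_fst L2_snd P2_id_L2[OF \<pi>] by blast+
  have int: "integrable \<mu> (\<lambda>z. norm (fst z - snd z))" if "\<mu> \<in> P2" for \<mu> :: "('a \<times> 'a) measure"
  proof -
    have "(\<lambda>z. fst z) \<in> L2 \<mu>" "(\<lambda>z. snd z) \<in> L2 \<mu>" using L2_fst L2_snd P2_id_L2[OF that] by blast+
    then show ?thesis by (intro prob_space.integrable_L2 P2D[OF that] L2_diff)
  qed
  have "wdist 1 (law ?\<pi> fst) (law ?\<pi> snd) \<le> (\<integral>z. norm (fst z - snd z) \<partial>?\<pi>)"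
    by (rule wdist_1_law_le[OF L2])
  also have "\<dots> = (1 - t) * (\<integral>z. norm (fst z - snd z) \<partial>\<pi>1) + t * (\<integral>z. norm (fst z - snd z) \<partial>\<pi>2)"
    by (rule integral_mixture_real) (auto intro: assms int)
  finally show ?thesis by (simp add: law)
qed

text \<open>The definition of the flat derivative concerns the start of a segment only. A point
  \<open>mixture t \<mu> \<nu>\<close> in the interior of the segment is itself the start of segments to \<open>\<nu>\<close> and to
  \<open>\<mu>\<close>, which yields the two one-sided derivatives at \<open>t\<close>.\<close>

lemma flat_derivative_at_right:
  assumes F: "has_flat_derivative F f (mixture t \<mu> \<nu>)"
    and "\<mu> \<in> P2" "\<nu> \<in> P2" "0 \<le> t" "t < 1"
  shows "((\<lambda>s. F (mixture s \<mu> \<nu>)) has_vector_derivative (\<integral>y. f y \<partial>\<nu>) - (\<integral>y. f y \<partial>\<mu>)) (at_right t)"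
proof -
  let ?m = "mixture t \<mu> \<nu>" and ?g = "\<lambda>s. F (mixture s \<mu> \<nu>)"
  let ?D = "(\<integral>y. f y \<partial>\<nu>) - (\<integral>y. f y \<partial>\<mu>)"
  have f: "integrable \<mu> f" "integrable \<nu> f"
    using F assms by (auto simp: has_flat_derivative_def)
  have m: "(\<integral>y. f y \<partial>\<nu>) - (\<integral>y. f y \<partial>?m) = (1 - t) *\<^sub>R ?D"
    using assms f by (simp add: integral_mixture algebra_simps)
  have "((\<lambda>s. (F (mixture s ?m \<nu>) - F ?m) /\<^sub>R s) \<longlongrightarrow> (1 - t) *\<^sub>R ?D) (at_right 0)"
    using F assms unfolding has_flat_derivative_def m[symmetric] by blast
  moreover have "filterlim (\<lambda>s. s / (1 - t)) (at_right 0) (at_right (0::real))"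
    unfolding filterlim_at using assms
    by (auto intro!: tendsto_eq_intros eventually_at_right_less simp: eventually_at_filter)
  ultimately have "((\<lambda>s. (F (mixture (s / (1 - t)) ?m \<nu>) - F ?m) /\<^sub>R (s / (1 - t))) \<longlongrightarrow> (1 - t) *\<^sub>R ?D) (at_right 0)"
    by (rule filterlim_compose)
  then have "((\<lambda>s. (1 / (1 - t)) *\<^sub>R ((F (mixture (s / (1 - t)) ?m \<nu>) - F ?m) /\<^sub>R (s / (1 - t))) - ?D)
      \<longlongrightarrow> (1 / (1 - t)) *\<^sub>R ((1 - t) *\<^sub>R ?D) - ?D) (at_right 0)"
    by (intro tendsto_diff tendsto_scaleR[OF tendsto_const] tendsto_const)
  moreover have "\<forall>\<^sub>F s in at_right 0.
      (1 / (1 - t)) *\<^sub>R ((F (mixture (s / (1 - t)) ?m \<nu>) - F ?m) /\<^sub>R (s / (1 - t))) - ?D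
      = ((?g (s + t) - ?g t) - (s + t - t) *\<^sub>R ?D) /\<^sub>R norm (s + t - t)"
    unfolding eventually_at_right_field
  proof (intro exI[of _ "1 - t"] conjI allI impI)
    fix s assume s: "0 < s" "s < 1 - t"
    then have "mixture (s / (1 - t)) ?m \<nu> = mixture (s + t) \<mu> \<nu>"
      using assms by (subst mixture_mixture) (auto simp: add.commute)
    then show "(1 / (1 - t)) *\<^sub>R ((F (mixture (s / (1 - t)) ?m \<nu>) - F ?m) /\<^sub>R (s / (1 - t))) - ?D
        = ((?g (s + t) - ?g t) - (s + t - t) *\<^sub>R ?D) /\<^sub>R norm (s + t - t)"
      using s by (simp add: scaleR_diff_right inverse_eq_divide)
  qed (use assms in simp)
  ultimately have "((\<lambda>s. ((?g (s + t) - ?g t) - (s + t - t) *\<^sub>R ?D) /\<^sub>R norm (s + t - t)) \<longlongrightarrow> 0) (at_right 0)"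
    using assms(5) by (subst (asm) tendsto_cong) auto
  then have "((\<lambda>s. ((?g s - ?g t) - (s - t) *\<^sub>R ?D) /\<^sub>R norm (s - t)) \<longlongrightarrow> 0) (at_right t)"
    by (subst at_right_to_0) (simp add: filterlim_filtermap)
  then show ?thesis
    unfolding has_vector_derivative_def has_derivative_at_within by (auto intro!: bounded_linear_intros)
qed

lemma flat_derivative_at_left:
  assumes F: "has_flat_derivative F f (mixture t \<mu> \<nu>)"
    and "\<mu> \<in> P2" "\<nu> \<in> P2" "0 < t" "t \<le> 1"
  shows "((\<lambda>s. F (mixture s \<mu> \<nu>)) has_vector_derivative (\<integral>y. f y \<partial>\<nu>) - (\<integral>y. f y \<partial>\<mu>)) (at_left t)"
proof -
  have sym: "mixture (1 - s) \<nu> \<mu> = mixture s \<mu> \<nu>" for s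
    by (rule mixture_commute) (use assms P2D in auto)
  have "((\<lambda>s. F (mixture s \<nu> \<mu>)) has_vector_derivative (\<integral>y. f y \<partial>\<mu>) - (\<integral>y. f y \<partial>\<nu>))
      (at (1 - t) within (\<lambda>s. 1 - s) ` {..<t})"
    using flat_derivative_at_right[of F f "1 - t" \<nu> \<mu>] assms
    by (subst has_vector_derivative_within_subset[of _ _ _ "{1 - t<..}"]) (auto simp: sym)
  from vector_diff_chain_within[OF _ this]
  have chain: "((\<lambda>s. 1 - s) has_vector_derivative c) (at_left t) \<Longrightarrow>
      ((\<lambda>s. F (mixture s \<mu> \<nu>)) has_vector_derivative c *\<^sub>R ((\<integral>y. f y \<partial>\<mu>) - (\<integral>y. f y \<partial>\<nu>))) (at_left t)" for c
    by (simp add: comp_def sym)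
  have "((\<lambda>s. 1 - s) has_vector_derivative - 1) (at_left t)"
    by (auto intro!: derivative_eq_intros simp flip: has_real_derivative_iff_has_vector_derivative)
  from chain[OF this] show ?thesis by simp
qed

text \<open>A mean value theorem for the difference of two functions, along two segments.\<close>

lemma flat_derivative_mvt:
  fixes F1 F2 :: "'a::euclidean_space measure \<Rightarrow> 'v::euclidean_space"
  assumes F1: "\<And>\<mu>. \<mu> \<in> P2 \<Longrightarrow> has_flat_derivative F1 (f1 \<mu>) \<mu>"
    and F2: "\<And>\<mu>. \<mu> \<in> P2 \<Longrightarrow> has_flat_derivative F2 (f2 \<mu>) \<mu>"
    and P2: "\<mu>1 \<in> P2" "\<nu>1 \<in> P2" "\<mu>2 \<in> P2" "\<nu>2 \<in> P2"
    and bound: "\<And>t. 0 < t \<Longrightarrow> t < 1 \<Longrightarrow>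
      norm (((\<integral>y. f1 (mixture t \<mu>1 \<nu>1) y \<partial>\<nu>1) - (\<integral>y. f1 (mixture t \<mu>1 \<nu>1) y \<partial>\<mu>1))
        - ((\<integral>y. f2 (mixture t \<mu>2 \<nu>2) y \<partial>\<nu>2) - (\<integral>y. f2 (mixture t \<mu>2 \<nu>2) y \<partial>\<mu>2))) \<le> c"
  shows "norm ((F1 \<nu>1 - F1 \<mu>1) - (F2 \<nu>2 - F2 \<mu>2)) \<le> c"
proof -
  define h where "h t = F1 (mixture t \<mu>1 \<nu>1) - F2 (mixture t \<mu>2 \<nu>2)" for t
  define h' where "h' t = ((\<integral>y. f1 (mixture t \<mu>1 \<nu>1) y \<partial>\<nu>1) - (\<integral>y. f1 (mixture t \<mu>1 \<nu>1) y \<partial>\<mu>1))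
        - ((\<integral>y. f2 (mixture t \<mu>2 \<nu>2) y \<partial>\<nu>2) - (\<integral>y. f2 (mixture t \<mu>2 \<nu>2) y \<partial>\<mu>2))" for t
  have right: "(h has_vector_derivative h' t) (at_right t)" if "0 \<le> t" "t < 1" for t
    unfolding h_def h'_def using that P2
    by (intro has_vector_derivative_diff flat_derivative_at_right F1 F2 mixture_P2) auto
  have left: "(h has_vector_derivative h' t) (at_left t)" if "0 < t" "t \<le> 1" for t
    unfolding h_def h'_def using that P2
    by (intro has_vector_derivative_diff flat_derivative_at_left F1 F2 mixture_P2) auto
  have deriv: "(h has_derivative (\<lambda>s. s *\<^sub>R h' t)) (at t)" if "0 < t" "t < 1" for t
    using right[of t] left[of t] that
    unfolding has_vector_derivative_def has_derivative_at_within filterlim_at_split by auto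
  have "continuous_on {0..1} h"
    unfolding continuous_on_eq_continuous_within
  proof
    fix t :: real assume "t \<in> {0..1}"
    then consider "t = 0" | "t = 1" | "0 < t" "t < 1" by fastforce
    then show "continuous (at t within {0..1}) h"
    proof cases
      case 1
      then show ?thesis
        using right[of 0] by (auto simp: at_within_Icc_at_right dest: has_vector_derivative_continuous)
    next
      case 2
      then show ?thesis
        using left[of 1] by (auto simp: at_within_Icc_at_left dest: has_vector_derivative_continuous)
    next
      case 3
      then show ?thesis
        using deriv[of t] by (auto intro: continuous_at_imp_continuous_at_within has_derivative_continuous)
    qed
  qed
  then obtain t where t: "0 < t" "t < 1" "norm (h 1 - h 0) \<le> norm ((1 - 0) *\<^sub>R h' t)"
    using mvt_general[of 0 1 h "\<lambda>t s. s *\<^sub>R h' t"] deriv by auto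
  have "norm (h 1 - h 0) \<le> c" using t bound[of t] by (simp add: h'_def)
  then show ?thesis using P2 by (simp add: h_def P2D(2) algebra_simps)
qed


section \<open>Realization of laws\<close>

text \<open>A binary sequence is recovered from the corresponding point of the Cantor set, scaled to
  \<open>[0, 1/2]\<close>.\<close>

lemma ternary_digit:
  fixes b :: "nat \<Rightarrow> bool"
  defines "y \<equiv> (\<Sum>n. of_bool (b n) / 3 ^ Suc n :: real)"
  shows "1 / 3 \<le> frac (3 ^ n * y) \<longleftrightarrow> b n" and "0 \<le> y" "y \<le> 1 / 2"
proof -
  \<comment> \<open>The fractional part of \<open>3\<^sup>n y\<close>: a digit \<open>0\<close> or \<open>1\<close> in front of a tail in \<open>[0, 1/2]\<close>.\<close>
  define T where "T n = (\<Sum>k. of_bool (b (n + k)) / 3 ^ Suc k :: real)" for n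
  have geo: "(\<lambda>k. 1 / 3 ^ Suc k :: real) sums (1 / 2)"
    using sums_mult[OF geometric_sums[of "1/3 :: real"], of "1/3"] by (simp add: power_divide)
  have summ: "summable (\<lambda>k. of_bool (b (n + k)) / 3 ^ Suc k :: real)" for n
    by (rule summable_comparison_test'[OF sums_summable[OF geo], of 0]) (auto simp: of_bool_def)
  have T0: "0 \<le> T n" for n unfolding T_def by (intro suminf_nonneg summ) auto
  have T1: "T n \<le> 1 / 2" for n
    unfolding T_def sums_unique[OF geo] by (intro suminf_le summ sums_summable[OF geo]) (auto simp: of_bool_def)
  have step: "3 * T n = of_bool (b n) + T (Suc n)" for n
  proof -
    have "T n = of_bool (b n) / 3 + (\<Sum>k. of_bool (b (n + Suc k)) / 3 ^ Suc (Suc k))"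
      unfolding T_def using suminf_split_head[OF summ, of n] by simp
    also have "(\<Sum>k. of_bool (b (n + Suc k)) / 3 ^ Suc (Suc k) :: real) = T (Suc n) / 3"
      unfolding T_def using suminf_divide[OF summ[of "Suc n"], of 3] by (simp add: mult_ac)
    finally show ?thesis by simp
  qed
  have y: "y = T 0" by (simp add: y_def T_def)
  have "\<exists>m::int. 3 ^ n * y = of_int m + T n" for n
  proof (induction n)
    case (Suc n)
    then obtain m :: int where "3 ^ n * y = of_int m + T n" by blast
    then have "3 ^ Suc n * y = of_int (3 * m + of_bool (b n)) + T (Suc n)" using step[of n] by simp
    then show ?case by blast
  qed (auto simp: y intro: exI[of _ 0])
  then obtain m :: int where "3 ^ n * y = of_int m + T n" by blast
  then have "frac (3 ^ n * y) = T n"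
    using T0[of n] T1[of n] by (auto simp: frac_unique_iff)
  moreover have "1 / 3 \<le> T n \<longleftrightarrow> b n"
    using step[of n] T0[of "Suc n"] T1[of "Suc n"] by (cases "b n") auto
  ultimately show "1 / 3 \<le> frac (3 ^ n * y) \<longleftrightarrow> b n" by simp
  show "0 \<le> y" "y \<le> 1 / 2" using T0 T1 by (auto simp: y)
qed

text \<open>A point is encoded by the truth values of \<open>q < x \<bullet> i\<close>, for rational \<open>q\<close> and basis vectors \<open>i\<close>;
  each coordinate is the supremum of the rationals below it.\<close>

lemma borel_embedding_real:
  obtains \<phi> :: "'a::euclidean_space \<Rightarrow> real" and \<psi> :: "real \<Rightarrow> 'a"
  where "\<phi> \<in> borel_measurable borel" "\<psi> \<in> borel_measurable borel"
    "\<And>x. \<psi> (\<phi> x) = x" "\<And>x. 0 \<le> \<phi> x" "\<And>x. \<phi> x \<le> 1 / 2"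
proof
  define I where "I = (Basis :: 'a set) \<times> (\<rat> :: real set)"
  define e where "e = from_nat_into I"
  have I: "countable I" "I \<noteq> {}"
    unfolding I_def using countable_SIGMA[OF countable_finite[OF finite_Basis] countable_rat] by auto
  have e: "range e = I" unfolding e_def using I by simp
  define b where "b n x \<longleftrightarrow> snd (e n) < x \<bullet> fst (e n)" for n and x :: 'a
  define \<phi> where "\<phi> x = (\<Sum>n. of_bool (b n x) / 3 ^ Suc n :: real)" for x
  define d where "d n y \<longleftrightarrow> 1 / 3 \<le> frac (3 ^ n * y)" for n and y :: real
  define \<psi> where "\<psi> y = (\<Sum>i\<in>Basis.
      real_of_ereal (SUP n\<in>{n. fst (e n) = i}. if d n y then ereal (snd (e n)) else - \<infinity>) *\<^sub>R i)" for y
  have d: "d n (\<phi> x) = b n x" for n x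
    unfolding d_def \<phi>_def by (rule ternary_digit)
  show "\<phi> \<in> borel_measurable borel"
    unfolding \<phi>_def b_def by measurable
  have [measurable]: "Measurable.pred borel (d n)" for n
    unfolding d_def frac_def by measurable
  show "\<psi> \<in> borel_measurable borel"
    unfolding \<psi>_def by measurable
  show "0 \<le> \<phi> x" "\<phi> x \<le> 1 / 2" for x
    unfolding \<phi>_def by (rule ternary_digit)+
  show "\<psi> (\<phi> x) = x" for x
  proof -
    have "(SUP n\<in>{n. fst (e n) = i}. if b n x then ereal (snd (e n)) else - \<infinity>) = ereal (x \<bullet> i)"
      if i: "i \<in> Basis" for i
    proof (rule antisym)
      show "(SUP n\<in>{n. fst (e n) = i}. if b n x then ereal (snd (e n)) else - \<infinity>) \<le> ereal (x \<bullet> i)"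
        by (rule SUP_least) (auto simp: b_def)
      show "ereal (x \<bullet> i) \<le> (SUP n\<in>{n. fst (e n) = i}. if b n x then ereal (snd (e n)) else - \<infinity>)"
      proof (rule dense_le)
        fix r assume "r < ereal (x \<bullet> i)"
        then obtain r' where r': "r \<le> ereal r'" "r' < x \<bullet> i"
          by (metis ereal_dense2 less_ereal.simps(1) less_imp_le)
        then obtain q where q: "q \<in> \<rat>" "r' < q" "q < x \<bullet> i"
          using Rats_dense_in_real by blast
        then obtain n where n: "e n = (i, q)" using e i unfolding I_def by (metis SigmaI rangeE)
        have "r \<le> (if b n x then ereal (snd (e n)) else - \<infinity>)"
          using r' q n by (auto simp: b_def intro: order_trans)
        also have "\<dots> \<le> (SUP n\<in>{n. fst (e n) = i}. if b n x then ereal (snd (e n)) else - \<infinity>)"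
          by (rule SUP_upper) (simp add: n)
        finally show "r \<le> (SUP n\<in>{n. fst (e n) = i}. if b n x then ereal (snd (e n)) else - \<infinity>)" .
      qed
    qed
    then show ?thesis unfolding \<psi>_def d by (simp add: euclidean_representation)
  qed
qed

text \<open>If the laws in \<open>P2\<close> of one Euclidean space are all realized on \<open>\<Omega>\<close>, then so are the laws on
  every other one.\<close>

lemma realize_law:
  fixes \<pi> :: "'b::euclidean_space measure"
  assumes \<Omega>: "\<And>\<mu> :: 'a::euclidean_space measure. \<mu> \<in> P2 \<Longrightarrow> \<exists>X\<in>borel_measurable \<Omega>. law \<Omega> X = \<mu>"
    and \<pi>: "\<pi> \<in> P2"
  shows "\<exists>Z\<in>L2 \<Omega>. law \<Omega> Z = \<pi>"
proof -
  obtain \<phi> :: "'b \<Rightarrow> real" and \<psi> where \<phi>: "\<phi> \<in> borel_measurable borel" "\<And>x. 0 \<le> \<phi> x" "\<And>x. \<phi> x \<le> 1 / 2"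
    and \<psi>: "\<psi> \<in> borel_measurable borel" "\<And>x. \<psi> (\<phi> x) = x"
    by (rule borel_embedding_real) blast
  note [measurable] = \<phi>(1) \<psi>(1)
  interpret prob_space \<pi> using \<pi> by (rule P2D)
  obtain i :: 'a where i: "i \<in> Basis" by (meson nonempty_Basis ex_in_conv)
  define \<mu> where "\<mu> = law \<pi> (\<lambda>x. \<phi> x *\<^sub>R i)"
  have \<pi>_borel: "borel_measurable \<pi> = borel_measurable borel"
    by (rule measurable_cong_sets) (simp_all add: P2D(2)[OF \<pi>])
  have enc: "(\<lambda>x. \<phi> x *\<^sub>R i) \<in> borel_measurable \<pi>" unfolding \<pi>_borel by measurable
  have "(\<lambda>x. \<phi> x *\<^sub>R i) \<in> L2 \<pi>"
  proof (rule L2_norm_mono(1)[OF L2_const[of "1::real"] enc])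
    show "norm (\<phi> x *\<^sub>R i) \<le> norm (1::real)" for x
      using \<phi>(2,3)[of x] i by simp
  qed
  then have "\<mu> \<in> P2" unfolding \<mu>_def by (rule law_P2)
  then obtain X where X: "X \<in> borel_measurable \<Omega>" "law \<Omega> X = \<mu>" using \<Omega> by blast
  define Z where "Z \<omega> = \<psi> (X \<omega> \<bullet> i)" for \<omega>
  have dec: "(\<lambda>x. \<psi> (x \<bullet> i)) \<in> borel_measurable borel" by measurable
  have Z: "Z \<in> borel_measurable \<Omega>" unfolding Z_def using X(1) by measurable
  have "law \<Omega> Z = distr \<mu> borel (\<lambda>x. \<psi> (x \<bullet> i))"
    unfolding X(2)[symmetric] using X(1) dec by (subst distr_distr) (auto simp: comp_def Z_def[abs_def])
  also have "\<dots> = distr \<pi> borel (\<lambda>x. x)"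
    unfolding \<mu>_def using enc dec i by (subst distr_distr) (auto simp: comp_def \<psi>)
  also have "\<dots> = \<pi>" using P2D(2)[OF \<pi>] by (intro distr_id2) simp
  finally have law: "law \<Omega> Z = \<pi>" .
  have "integrable (law \<Omega> Z) (\<lambda>x. (norm x)\<^sup>2)" unfolding law using \<pi> by (simp add: P2_iff)
  then have "Z \<in> L2 \<Omega>" using Z by (auto simp: L2_def integrable_distr_eq)
  then show ?thesis using law by blast
qed

section \<open>The maximizer in the Hamiltonian\<close>

lemma gradient_eqI:
  assumes "GDERIV f x :> D"
  shows "gradient f x = D"
  unfolding gradient_def
proof (rule the_equality)
  fix D' assume "GDERIV f x :> D'"
  then have "(\<lambda>h. h \<bullet> D') = (\<lambda>h. h \<bullet> D)"
    using assms unfolding gderiv_def by (rule has_derivative_unique)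
  then show "D' = D" by (metis vector_eq_ldot)
qed (rule assms)

text \<open>The supremum is attained at the unique zero \<open>A p\<close> of \<open>B + p\<close>. Since \<open>A\<close> is Lipschitz with
  constant \<open>1 / c\<close>, the affine lower bounds given by the maximizers at \<open>p\<close> and \<open>q\<close> agree up to
  \<open>|q - p|\<^sup>2 / c\<close>, which makes the supremum differentiable with gradient \<open>- A p\<close>.\<close>

lemma strongly_convex_legendre:
  fixes l :: "'a::euclidean_space \<Rightarrow> real"
  assumes deriv: "\<And>a. GDERIV l a :> B a"
    and mono: "\<And>a a'. c * (norm (a - a'))\<^sup>2 \<le> (B a - B a') \<bullet> (a - a')" and c: "c > 0"
    and coercive: "\<And>a. k * (norm a)\<^sup>2 - C \<le> l a" and k: "k > 0"
  shows "- gradient (\<lambda>p. SUP a. - (a \<bullet> p) - l a) p = a \<longleftrightarrow> B a = - p"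
proof -
  have max: "\<exists>a. B a = - p \<and> (\<forall>b. - (b \<bullet> p) - l b \<le> - (a \<bullet> p) - l a)" for p
  proof -
    define g where "g a = l a + a \<bullet> p" for a
    have g: "(g has_derivative (\<lambda>h. h \<bullet> (B a + p))) (at a)" for a
      unfolding g_def using deriv[of a] unfolding gderiv_def
      by (auto intro!: derivative_eq_intros simp: inner_add_right)
    then have cont: "continuous_on S g" for S
      by (meson has_derivative_continuous continuous_at_imp_continuous_on)
    \<comment> \<open>Outside the ball of radius \<open>R\<close> the function \<open>g\<close> is at least \<open>g 0\<close>.\<close>
    define R where "R = (norm p + \<bar>C\<bar> + \<bar>l 0\<bar>) / k + 1"
    have R1: "R \<ge> 1" using k by (simp add: R_def)
    have far: "g 0 \<le> g a" if "R \<le> norm a" for a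
    proof -
      have "k * R \<le> k * norm a" using that k by simp
      moreover have "k * R = norm p + \<bar>C\<bar> + \<bar>l 0\<bar> + k" using k by (simp add: R_def field_simps)
      ultimately have "\<bar>C\<bar> + \<bar>l 0\<bar> \<le> k * norm a - norm p" using k by linarith
      then have "1 * (\<bar>C\<bar> + \<bar>l 0\<bar>) \<le> norm a * (k * norm a - norm p)"
        using that R1 by (intro mult_mono) auto
      then have "\<bar>C\<bar> + \<bar>l 0\<bar> \<le> k * (norm a)\<^sup>2 - norm a * norm p"
        by (simp add: algebra_simps power2_eq_square)
      moreover have "- (norm a * norm p) \<le> a \<bullet> p"
        using Cauchy_Schwarz_ineq2[of a p] by linarith
      ultimately show ?thesis using coercive[of a] by (simp add: g_def)
    qed
    obtain a where a: "a \<in> cball 0 R" "\<And>b. b \<in> cball 0 R \<Longrightarrow> g a \<le> g b"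
      using continuous_attains_inf[OF compact_cball _ cont, of 0 R] R1 by auto
    have min: "g a \<le> g b" for b
    proof (cases "b \<in> cball 0 R")
      case False
      then have "g 0 \<le> g b" by (intro far) simp
      moreover have "g a \<le> g 0" using R1 by (intro a) simp
      ultimately show ?thesis by simp
    qed (rule a)
    have "(\<lambda>h. h \<bullet> (B a + p)) = (\<lambda>h. 0)"
      by (rule differential_zero_maxmin[OF UNIV_I open_UNIV g]) (use min in auto)
    then have "B a + p = 0" by (metis inner_eq_zero_iff)
    then have "B a = - p" by (simp add: eq_neg_iff_add_eq_0)
    moreover have "- (b \<bullet> p) - l b \<le> - (a \<bullet> p) - l a" for b
      using min[of b] by (simp add: g_def)
    ultimately show ?thesis by blast
  qed
  then obtain A where A: "\<And>p. B (A p) = - p" "\<And>p b. - (b \<bullet> p) - l b \<le> - (A p \<bullet> p) - l (A p)"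
    by metis
  define H where "H p = (SUP a. - (a \<bullet> p) - l a)" for p
  have H: "H p = - (A p \<bullet> p) - l (A p)" for p
    unfolding H_def by (rule cSup_eq_maximum) (use A(2) in auto)
  have A_lip: "norm (A p - A q) \<le> norm (p - q) / c" for p q
  proof (cases "A p = A q")
    case False
    have "c * (norm (A p - A q))\<^sup>2 \<le> (q - p) \<bullet> (A p - A q)"
      using mono[of "A p" "A q"] by (simp add: A)
    also have "\<dots> \<le> norm (q - p) * norm (A p - A q)" by (rule norm_cauchy_schwarz)
    finally have "c * norm (A p - A q) \<le> norm (p - q)"
      using False by (simp add: power2_eq_square norm_minus_commute)
    then show ?thesis using c by (simp add: field_simps)
  qed (use c in simp)
  have H_deriv: "GDERIV H p :> - A p" for p
    unfolding gderiv_def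
  proof (rule has_derivativeI_sandwich[of 1 _ _ _ _ "\<lambda>q. norm (q - p) / c"])
    show "bounded_linear (\<lambda>h. h \<bullet> - A p)" by (rule bounded_linear_inner_left)
    show "((\<lambda>q. norm (q - p) / c) \<longlongrightarrow> 0) (at p)"
      using c by (auto intro!: tendsto_eq_intros)
    fix q assume "q \<noteq> p"
    have "H p - A p \<bullet> (q - p) \<le> H q" "H q - A q \<bullet> (p - q) \<le> H p"
      using A(2)[of "A p" q] A(2)[of "A q" p] by (auto simp: H inner_diff_right)
    then have "norm (H q - H p - (q - p) \<bullet> - A p) \<le> (A p - A q) \<bullet> (q - p)"
      by (auto simp: inner_diff_left inner_diff_right inner_commute)
    also have "\<dots> \<le> norm (A p - A q) * norm (q - p)" by (rule norm_cauchy_schwarz)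
    also have "\<dots> \<le> norm (p - q) / c * norm (q - p)" by (intro mult_right_mono A_lip) simp
    finally show "norm (H q - H p - (q - p) \<bullet> - A p) / norm (q - p) \<le> norm (q - p) / c"
      using \<open>q \<noteq> p\<close> c by (simp add: divide_le_eq norm_minus_commute)
  qed simp
  have grad: "gradient H p = - A p" by (rule gradient_eqI[OF H_deriv])
  have "A p = a \<longleftrightarrow> B a = - p"
  proof
    assume "B a = - p"
    then have "c * (norm (A p - a))\<^sup>2 \<le> 0" using mono[of "A p" a] by (simp add: A)
    then have "(norm (A p - a))\<^sup>2 \<le> 0" using c by (simp add: mult_le_0_iff)
    then show "A p = a" by simp
  qed (use A in auto)
  then show ?thesis using grad by (simp add: H_def[abs_def])
qed

section \<open>Displacement monotone Lagrangians\<close>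

text \<open>The properties of the Lagrangian that enter the argument. Here \<open>f\<close> is a flat derivative of
  \<open>D\<^sub>aL\<close>, and \<open>K\<close> a common Lipschitz constant. The last assumption is displacement
  monotonicity for two controls of the same state, expressed by the joint law \<open>\<pi>\<close> of the state
  and the two controls; in this form it does not refer to a particular probability space.\<close>

locale displacement_monotone_lagrangian =
  fixes L :: "'d::finite lagrangian"
    and f :: "'d vec \<times> 'd vec \<Rightarrow> ('d vec \<times> 'd vec) measure \<Rightarrow> 'd vec \<times> 'd vec \<Rightarrow> 'd vec"
    and K c \<gamma> :: real
  assumes K: "K > 0" and c: "c > 0" and \<gamma>: "\<gamma> > 0"
    and D_aL_lipschitz: "\<mu> \<in> P2 \<Longrightarrow>
      norm (D_aL L x a \<mu> - D_aL L x' a' \<mu>) \<le> K * (norm (x - x') + norm (a - a'))"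
    and flat: "\<mu> \<in> P2 \<Longrightarrow> has_flat_derivative (D_aL L x a) (f (x, a) \<mu>) \<mu>"
    and flat_lipschitz: "\<mu> \<in> P2 \<Longrightarrow> \<mu>' \<in> P2 \<Longrightarrow>
      norm (f z \<mu> y - f z' \<mu>' y') \<le> K * (norm (z - z') + wdist 1 \<mu> \<mu>' + norm (y - y'))"
    and D_aL_strongly_mono: "\<mu> \<in> P2 \<Longrightarrow>
      c * (norm (a - a'))\<^sup>2 \<le> (D_aL L x a \<mu> - D_aL L x a' \<mu>) \<bullet> (a - a')"
    and D_pH_iff: "\<mu> \<in> P2 \<Longrightarrow> - D_pH L x p \<mu> = a \<longleftrightarrow> D_aL L x a \<mu> = - p"
    and law_mono: "\<pi> \<in> P2 \<Longrightarrow>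
      \<gamma> * (\<integral>(x, a, a'). (norm (a - a'))\<^sup>2 \<partial>\<pi>)
      \<le> (\<integral>(x, a, a'). (D_aL L x a (law \<pi> (\<lambda>(x, a, a'). (x, a)))
          - D_aL L x a' (law \<pi> (\<lambda>(x, a, a'). (x, a')))) \<bullet> (a - a') \<partial>\<pi>)"
begin

text \<open>Along the segment from \<open>law M Y'\<close> to \<open>law M Y\<close> the derivative of \<open>D\<^sub>aL\<close> is the expectation of
  \<open>f(Y) - f(Y')\<close>, where \<open>f\<close> is Lipschitz.\<close>

lemma D_aL_law_lipschitz:
  assumes M: "prob_space M" and Y: "Y \<in> L2 M" "Y' \<in> L2 M"
  shows "norm (D_aL L x a (law M Y) - D_aL L x a (law M Y')) \<le> K * (\<integral>\<omega>. norm (Y \<omega> - Y' \<omega>) \<partial>M)"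
proof -
  interpret prob_space M by (rule M)
  note [measurable] = Y[THEN L2D(1)]
  have P2: "law M Y \<in> P2" "law M Y' \<in> P2" using Y by (auto intro: law_P2)
  \<comment> \<open>The second segment of the mean value theorem is taken to be constant.\<close>
  have "norm ((D_aL L x a (law M Y) - D_aL L x a (law M Y'))
      - (D_aL L x a (law M Y') - D_aL L x a (law M Y'))) \<le> K * (\<integral>\<omega>. norm (Y \<omega> - Y' \<omega>) \<partial>M)"
  proof (rule flat_derivative_mvt[where ?f1.0 = "f (x, a)" and ?f2.0 = "f (x, a)", OF flat flat P2(2,1,2,2)])
    fix t :: real assume t: "0 < t" "t < 1"
    define m where "m = mixture t (law M Y') (law M Y)"
    have m: "m \<in> P2" unfolding m_def using t P2 by (intro mixture_P2) auto
    define g where "g = f (x, a) m"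
    have g: "continuous_on UNIV g" "\<And>\<nu>. \<nu> \<in> P2 \<Longrightarrow> integrable \<nu> g"
      using flat[OF m] by (auto simp: has_flat_derivative_def g_def)
    have [measurable]: "g \<in> borel_measurable borel" by (rule borel_measurable_continuous_onI[OF g(1)])
    have int: "integrable M (\<lambda>\<omega>. g (Y \<omega>))" "integrable M (\<lambda>\<omega>. g (Y' \<omega>))"
      using g(2)[OF P2(1)] g(2)[OF P2(2)] by (simp_all add: integrable_distr_eq)
    have "(\<integral>y. g y \<partial>law M Y) - (\<integral>y. g y \<partial>law M Y') = (\<integral>\<omega>. g (Y \<omega>) - g (Y' \<omega>) \<partial>M)"
      using int by (simp add: integral_distr)
    also have "norm \<dots> \<le> (\<integral>\<omega>. norm (g (Y \<omega>) - g (Y' \<omega>)) \<partial>M)"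
      by (rule integral_norm_bound)
    also have "\<dots> \<le> (\<integral>\<omega>. K * norm (Y \<omega> - Y' \<omega>) \<partial>M)"
    proof (rule integral_mono)
      show "integrable M (\<lambda>\<omega>. norm (g (Y \<omega>) - g (Y' \<omega>)))" using int by auto
      show "integrable M (\<lambda>\<omega>. K * norm (Y \<omega> - Y' \<omega>))"
        by (intro integrable_mult_right integrable_L2 L2_diff Y)
      show "norm (g (Y \<omega>) - g (Y' \<omega>)) \<le> K * norm (Y \<omega> - Y' \<omega>)" for \<omega>
        using flat_lipschitz[OF m m, of "(x, a)" "Y \<omega>" "(x, a)" "Y' \<omega>"]
        by (simp add: g_def wdist_1_self[OF m])
    qed
    finally show "norm (((\<integral>y. f (x, a) (mixture t (law M Y') (law M Y)) y \<partial>law M Y)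
          - (\<integral>y. f (x, a) (mixture t (law M Y') (law M Y)) y \<partial>law M Y'))
        - ((\<integral>y. f (x, a) (mixture t (law M Y') (law M Y')) y \<partial>law M Y')
          - (\<integral>y. f (x, a) (mixture t (law M Y') (law M Y')) y \<partial>law M Y')))
        \<le> K * (\<integral>\<omega>. norm (Y \<omega> - Y' \<omega>) \<partial>M)"
      by (simp add: g_def m_def)
  qed
  then show ?thesis by simp
qed

text \<open>The mean field operator \<open>\<alpha> \<mapsto> D\<^sub>aL(X, \<alpha>, law (X, \<alpha>))\<close> on random controls, on an arbitrary
  probability space.\<close>

definition nemytskii :: "'w measure \<Rightarrow> ('w \<Rightarrow> 'd vec) \<Rightarrow> ('w \<Rightarrow> 'd vec) \<Rightarrow> 'w \<Rightarrow> 'd vec" where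
  "nemytskii M X \<alpha> \<omega> = D_aL L (X \<omega>) (\<alpha> \<omega>) (law M (\<lambda>\<omega>. (X \<omega>, \<alpha> \<omega>)))"

lemma D_aL_measurable:
  assumes "\<mu> \<in> P2" "X \<in> borel_measurable M" "\<alpha> \<in> borel_measurable M"
  shows "(\<lambda>\<omega>. D_aL L (X \<omega>) (\<alpha> \<omega>) \<mu>) \<in> borel_measurable M"
  using K by (intro lipschitz_pair_measurable[OF D_aL_lipschitz[OF assms(1)] _ assms(2,3)]) simp

text \<open>Strong monotonicity in the control for a fixed measure makes the maximizer Lipschitz in
  \<open>(x, p)\<close>.\<close>

lemma D_pH_measurable:
  assumes "\<mu> \<in> P2"
  shows "(\<lambda>(x, p). (x, - D_pH L x p \<mu>)) \<in> borel_measurable borel"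
proof -
  define A where "A z = - D_pH L (fst z) (snd z) \<mu>" for z
  have A: "D_aL L (fst z) (A z) \<mu> = - snd z" for z
    using D_pH_iff[OF assms, of "fst z" "snd z" "A z"] by (simp add: A_def)
  have "((1 + K) / c)-lipschitz_on UNIV A"
  proof (rule lipschitz_onI)
    fix z z' :: "'d vec \<times> 'd vec"
    have "norm (A z - A z') \<le> (1 + K) / c * norm (z - z')"
    proof (cases "A z = A z'")
      case False
      have "c * (norm (A z - A z'))\<^sup>2
          \<le> (D_aL L (fst z) (A z) \<mu> - D_aL L (fst z) (A z') \<mu>) \<bullet> (A z - A z')"
        by (rule D_aL_strongly_mono[OF assms])
      also have "\<dots> = ((snd z' - snd z) + (D_aL L (fst z') (A z') \<mu> - D_aL L (fst z) (A z') \<mu>)) \<bullet> (A z - A z')"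
        unfolding A by simp
      also have "\<dots> \<le> norm ((snd z' - snd z) + (D_aL L (fst z') (A z') \<mu> - D_aL L (fst z) (A z') \<mu>)) * norm (A z - A z')"
        by (rule norm_cauchy_schwarz)
      also have "\<dots> \<le> (norm (z - z') + K * norm (z - z')) * norm (A z - A z')"
      proof (intro mult_right_mono norm_triangle_le add_mono)
        show "norm (snd z' - snd z) \<le> norm (z - z')"
          using norm_snd_le'[of "z - z'"] by (simp add: norm_minus_commute)
        have "norm (D_aL L (fst z') (A z') \<mu> - D_aL L (fst z) (A z') \<mu>) \<le> K * norm (fst (z - z'))"
          using D_aL_lipschitz[OF assms, of "fst z'" "A z'" "fst z" "A z'"] by (simp add: norm_minus_commute)
        also have "\<dots> \<le> K * norm (z - z')" using K by (intro mult_left_mono norm_fst_le') simp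
        finally show "norm (D_aL L (fst z') (A z') \<mu> - D_aL L (fst z) (A z') \<mu>) \<le> K * norm (z - z')" .
      qed simp
      finally have "(c * norm (A z - A z')) * norm (A z - A z') \<le> ((1 + K) * norm (z - z')) * norm (A z - A z')"
        by (simp add: power2_eq_square algebra_simps)
      then have "c * norm (A z - A z') \<le> (1 + K) * norm (z - z')"
        by (rule mult_right_le_imp_le) (use False in simp)
      then show ?thesis using c by (simp add: field_simps)
    qed (use K c in simp)
    then show "dist (A z) (A z') \<le> (1 + K) / c * dist z z'" by (simp add: dist_norm)
  qed (use K c in simp)
  then have [measurable]: "A \<in> borel_measurable borel"
    by (intro borel_measurable_continuous_onI lipschitz_on_continuous_on)
  have "(\<lambda>z. (fst z, A z)) \<in> borel_measurable borel" by measurable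
  then show ?thesis by (simp add: A_def case_prod_beta')
qed

context
  fixes M :: "'w measure"
  assumes M: "prob_space M"
begin

interpretation prob_space M by (rule M)

lemma law_pair_P2:
  assumes "X \<in> L2 M" "\<alpha> \<in> L2 M"
  shows "law M (\<lambda>\<omega>. (X \<omega>, \<alpha> \<omega>)) \<in> P2"
  by (rule law_P2[OF L2_Pair[OF assms]])

lemma nemytskii_diff_le:
  assumes "X \<in> L2 M" "\<alpha> \<in> L2 M" "X' \<in> L2 M" "\<alpha>' \<in> L2 M"
  shows "norm (nemytskii M X \<alpha> \<omega> - nemytskii M X' \<alpha>' \<omega>)
    \<le> K * ((norm (X \<omega> - X' \<omega>) + norm (\<alpha> \<omega> - \<alpha>' \<omega>))
      + (L2_norm M (\<lambda>\<omega>. X \<omega> - X' \<omega>) + L2_norm M (\<lambda>\<omega>. \<alpha> \<omega> - \<alpha>' \<omega>)))"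
proof -
  let ?Y = "\<lambda>\<omega>. (X \<omega>, \<alpha> \<omega>)" and ?Y' = "\<lambda>\<omega>. (X' \<omega>, \<alpha>' \<omega>)"
  have "norm (D_aL L (X \<omega>) (\<alpha> \<omega>) (law M ?Y) - D_aL L (X' \<omega>) (\<alpha>' \<omega>) (law M ?Y))
      \<le> K * (norm (X \<omega> - X' \<omega>) + norm (\<alpha> \<omega> - \<alpha>' \<omega>))"
    by (rule D_aL_lipschitz[OF law_pair_P2[OF assms(1,2)]])
  moreover have "norm (D_aL L (X' \<omega>) (\<alpha>' \<omega>) (law M ?Y) - D_aL L (X' \<omega>) (\<alpha>' \<omega>) (law M ?Y'))
      \<le> K * (L2_norm M (\<lambda>\<omega>. X \<omega> - X' \<omega>) + L2_norm M (\<lambda>\<omega>. \<alpha> \<omega> - \<alpha>' \<omega>))"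
  proof -
    have "norm (D_aL L (X' \<omega>) (\<alpha>' \<omega>) (law M ?Y) - D_aL L (X' \<omega>) (\<alpha>' \<omega>) (law M ?Y'))
        \<le> K * (\<integral>\<omega>. norm (?Y \<omega> - ?Y' \<omega>) \<partial>M)"
      by (intro D_aL_law_lipschitz M L2_Pair assms)
    also have "\<dots> \<le> K * L2_norm M (\<lambda>\<omega>. ?Y \<omega> - ?Y' \<omega>)"
      using K by (intro mult_left_mono integral_norm_le_L2_norm L2_diff L2_Pair assms) simp
    also have "\<dots> \<le> K * (L2_norm M (\<lambda>\<omega>. X \<omega> - X' \<omega>) + L2_norm M (\<lambda>\<omega>. \<alpha> \<omega> - \<alpha>' \<omega>))"
      using K L2_norm_Pair_le[OF L2_diff L2_diff, OF assms(1,3,2,4)]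
      by (intro mult_left_mono) auto
    finally show ?thesis .
  qed
  ultimately show ?thesis
    using norm_triangle_ineq[of "D_aL L (X \<omega>) (\<alpha> \<omega>) (law M ?Y) - D_aL L (X' \<omega>) (\<alpha>' \<omega>) (law M ?Y)"
        "D_aL L (X' \<omega>) (\<alpha>' \<omega>) (law M ?Y) - D_aL L (X' \<omega>) (\<alpha>' \<omega>) (law M ?Y')"]
    by (simp add: nemytskii_def distrib_left)
qed

lemma nemytskii_measurable:
  assumes "X \<in> L2 M" "\<alpha> \<in> L2 M"
  shows "nemytskii M X \<alpha> \<in> borel_measurable M"
  unfolding nemytskii_def[abs_def]
  by (intro D_aL_measurable law_pair_P2 assms L2D(1))

lemma nemytskii_lipschitz:
  assumes "X \<in> L2 M" "\<alpha> \<in> L2 M" "X' \<in> L2 M" "\<alpha>' \<in> L2 M"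
  shows "(\<lambda>\<omega>. nemytskii M X \<alpha> \<omega> - nemytskii M X' \<alpha>' \<omega>) \<in> L2 M" (is ?L2)
    and "L2_norm M (\<lambda>\<omega>. nemytskii M X \<alpha> \<omega> - nemytskii M X' \<alpha>' \<omega>)
      \<le> 2 * K * (L2_norm M (\<lambda>\<omega>. X \<omega> - X' \<omega>) + L2_norm M (\<lambda>\<omega>. \<alpha> \<omega> - \<alpha>' \<omega>))" (is ?lip)
proof -
  define r where "r = L2_norm M (\<lambda>\<omega>. X \<omega> - X' \<omega>) + L2_norm M (\<lambda>\<omega>. \<alpha> \<omega> - \<alpha>' \<omega>)"
  define D where "D = (\<lambda>\<omega>. norm (X \<omega> - X' \<omega>) + norm (\<alpha> \<omega> - \<alpha>' \<omega>))"
  have r: "0 \<le> r" by (simp add: r_def L2_norm_nonneg)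
  have D: "D \<in> L2 M" unfolding D_def by (intro L2_add L2_normed L2_diff assms)
  have Dr: "(\<lambda>\<omega>. D \<omega> + r) \<in> L2 M" by (intro L2_add D L2_const)
  have Y: "(\<lambda>\<omega>. K *\<^sub>R (D \<omega> + r)) \<in> L2 M" by (intro L2_scaleR Dr)
  have meas: "(\<lambda>\<omega>. nemytskii M X \<alpha> \<omega> - nemytskii M X' \<alpha>' \<omega>) \<in> borel_measurable M"
    by (intro borel_measurable_diff nemytskii_measurable assms)
  have le: "norm (nemytskii M X \<alpha> \<omega> - nemytskii M X' \<alpha>' \<omega>) \<le> norm (K *\<^sub>R (D \<omega> + r))" for \<omega>
    using nemytskii_diff_le[OF assms, of \<omega>] K r by (simp add: D_def r_def[symmetric])
  show ?L2 by (rule L2_norm_mono(1)[OF Y meas le])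
  have "L2_norm M (\<lambda>\<omega>. nemytskii M X \<alpha> \<omega> - nemytskii M X' \<alpha>' \<omega>) \<le> L2_norm M (\<lambda>\<omega>. K *\<^sub>R (D \<omega> + r))"
    by (rule L2_norm_mono(2)[OF Y meas le])
  also have "\<dots> = K * L2_norm M (\<lambda>\<omega>. D \<omega> + r)" using K by (subst L2_norm_scaleR) simp
  also have "\<dots> \<le> K * (L2_norm M D + r)"
    using L2_norm_triangle[OF D L2_const[of r]] r K by (intro mult_left_mono) (auto simp: L2_norm_const)
  also have "L2_norm M D \<le> r"
    unfolding D_def r_def using L2_norm_triangle[OF L2_normed L2_normed, OF L2_diff L2_diff, OF assms(1,3,2,4)]
    by (simp add: L2_norm_normed)
  finally show ?lip using K by (simp add: r_def algebra_simps)
qed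

lemma nemytskii_L2:
  assumes "X \<in> L2 M" "\<alpha> \<in> L2 M"
  shows "nemytskii M X \<alpha> \<in> L2 M"
proof -
  have "nemytskii M (\<lambda>_. 0) (\<lambda>_. 0) \<in> L2 M"
    unfolding nemytskii_def[abs_def] by (rule L2_const)
  from L2_add[OF nemytskii_lipschitz(1)[OF assms L2_const[of 0] L2_const[of 0]] this] show ?thesis by simp
qed

lemma nemytskii_strongly_mono:
  assumes X: "X \<in> L2 M" and \<alpha>: "\<alpha> \<in> L2 M" "\<alpha>' \<in> L2 M"
  shows "\<gamma> * (L2_norm M (\<lambda>\<omega>. \<alpha> \<omega> - \<alpha>' \<omega>))\<^sup>2
    \<le> (\<integral>\<omega>. (nemytskii M X \<alpha> \<omega> - nemytskii M X \<alpha>' \<omega>) \<bullet> (\<alpha> \<omega> - \<alpha>' \<omega>) \<partial>M)"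
proof -
  let ?Z = "\<lambda>\<omega>. (X \<omega>, \<alpha> \<omega>, \<alpha>' \<omega>)"
  define \<pi> where "\<pi> = law M ?Z"
  have Z: "?Z \<in> L2 M" by (intro L2_Pair assms)
  note [measurable] = L2D(1)[OF Z]
  have \<pi>: "\<pi> \<in> P2" unfolding \<pi>_def by (rule law_P2[OF Z])
  have [measurable]: "(\<lambda>(x::'d vec, a::'d vec, a'::'d vec). (x, a)) \<in> borel_measurable borel"
      "(\<lambda>(x::'d vec, a::'d vec, a'::'d vec). (x, a')) \<in> borel_measurable borel"
    unfolding case_prod_beta' by measurable
  have laws: "law \<pi> (\<lambda>(x, a, a'). (x, a)) = law M (\<lambda>\<omega>. (X \<omega>, \<alpha> \<omega>))"
      "law \<pi> (\<lambda>(x, a, a'). (x, a')) = law M (\<lambda>\<omega>. (X \<omega>, \<alpha>' \<omega>))"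
    unfolding \<pi>_def by (subst distr_distr; simp add: comp_def)+
  have P2: "law M (\<lambda>\<omega>. (X \<omega>, \<alpha> \<omega>)) \<in> P2" "law M (\<lambda>\<omega>. (X \<omega>, \<alpha>' \<omega>)) \<in> P2"
    by (intro law_pair_P2 assms)+
  have "\<gamma> * (\<integral>(x, a, a'). (norm (a - a'))\<^sup>2 \<partial>\<pi>)
      \<le> (\<integral>(x, a, a'). (D_aL L x a (law M (\<lambda>\<omega>. (X \<omega>, \<alpha> \<omega>)))
          - D_aL L x a' (law M (\<lambda>\<omega>. (X \<omega>, \<alpha>' \<omega>)))) \<bullet> (a - a') \<partial>\<pi>)"
    using law_mono[OF \<pi>] unfolding laws .
  also have "(\<integral>(x, a, a'). (norm (a - a'))\<^sup>2 \<partial>\<pi>) = (L2_norm M (\<lambda>\<omega>. \<alpha> \<omega> - \<alpha>' \<omega>))\<^sup>2"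
    unfolding \<pi>_def L2_norm_sq case_prod_beta' by (subst integral_distr) auto
  also have "(\<integral>(x, a, a'). (D_aL L x a (law M (\<lambda>\<omega>. (X \<omega>, \<alpha> \<omega>)))
          - D_aL L x a' (law M (\<lambda>\<omega>. (X \<omega>, \<alpha>' \<omega>)))) \<bullet> (a - a') \<partial>\<pi>)
      = (\<integral>\<omega>. (nemytskii M X \<alpha> \<omega> - nemytskii M X \<alpha>' \<omega>) \<bullet> (\<alpha> \<omega> - \<alpha>' \<omega>) \<partial>M)"
    unfolding \<pi>_def nemytskii_def case_prod_beta'
    by (subst integral_distr)
       (auto intro!: borel_measurable_inner borel_measurable_diff D_aL_measurable P2)
  finally show ?thesis .
qed

text \<open>The stability estimate behind all parts of the theorem: the control is a Lipschitz function of
  the state and of the value of the mean field operator.\<close>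

lemma control_estimate:
  assumes X: "X \<in> L2 M" "X' \<in> L2 M" and \<alpha>: "\<alpha> \<in> L2 M" "\<alpha>' \<in> L2 M"
  shows "\<gamma> * L2_norm M (\<lambda>\<omega>. \<alpha> \<omega> - \<alpha>' \<omega>)
    \<le> L2_norm M (\<lambda>\<omega>. nemytskii M X \<alpha> \<omega> - nemytskii M X' \<alpha>' \<omega>) + 2 * K * L2_norm M (\<lambda>\<omega>. X \<omega> - X' \<omega>)"
proof -
  let ?d = "L2_norm M (\<lambda>\<omega>. \<alpha> \<omega> - \<alpha>' \<omega>)"
  have "\<gamma> * ?d\<^sup>2 \<le> (\<integral>\<omega>. (nemytskii M X \<alpha> \<omega> - nemytskii M X \<alpha>' \<omega>) \<bullet> (\<alpha> \<omega> - \<alpha>' \<omega>) \<partial>M)"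
    by (rule nemytskii_strongly_mono[OF X(1) \<alpha>])
  also have "\<dots> \<le> L2_norm M (\<lambda>\<omega>. nemytskii M X \<alpha> \<omega> - nemytskii M X \<alpha>' \<omega>) * ?d"
    using integral_inner_le_L2_norm[OF nemytskii_lipschitz(1)[OF X(1) \<alpha>(1) X(1) \<alpha>(2)] L2_diff[OF \<alpha>]]
    by linarith
  finally have "\<gamma> * ?d \<le> L2_norm M (\<lambda>\<omega>. nemytskii M X \<alpha> \<omega> - nemytskii M X \<alpha>' \<omega>)"
    using L2_norm_nonneg[of M "\<lambda>\<omega>. nemytskii M X \<alpha> \<omega> - nemytskii M X \<alpha>' \<omega>"] L2_norm_nonneg[of M "\<lambda>\<omega>. \<alpha> \<omega> - \<alpha>' \<omega>"]
    by (cases "?d = 0") (auto simp: power2_eq_square)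
  also have "\<dots> \<le> L2_norm M (\<lambda>\<omega>. nemytskii M X \<alpha> \<omega> - nemytskii M X' \<alpha>' \<omega>)
      + L2_norm M (\<lambda>\<omega>. nemytskii M X' \<alpha>' \<omega> - nemytskii M X \<alpha>' \<omega>)"
    by (intro L2_norm_diff_triangle nemytskii_L2 assms)
  also have "L2_norm M (\<lambda>\<omega>. nemytskii M X' \<alpha>' \<omega> - nemytskii M X \<alpha>' \<omega>) \<le> 2 * K * L2_norm M (\<lambda>\<omega>. X \<omega> - X' \<omega>)"
    using nemytskii_lipschitz(2)[OF X(2) \<alpha>(2) X(1) \<alpha>(2)] L2_norm_const[of "0::'d vec"]
    by (simp add: L2_norm_minus_commute[of M X' X])
  finally show ?thesis by simp
qed

end

section \<open>The fixed-point map\<close>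

text \<open>On the probability space \<open>\<nu>\<close> itself, with the coordinates \<open>fst\<close> and \<open>snd\<close> as state and
  momentum, Zarantonello's theorem yields a control that satisfies the first order condition.\<close>

lemma is_Phi_ex:
  assumes \<nu>: "\<nu> \<in> P2"
  shows "\<exists>\<mu>. is_Phi L \<nu> \<mu>"
proof -
  have \<nu>_prob: "prob_space \<nu>" by (rule P2D[OF \<nu>])
  interpret prob_space \<nu> by (rule \<nu>_prob)
  have id: "(\<lambda>z. z) \<in> L2 \<nu>" by (rule P2_id_L2[OF \<nu>])
  have X: "fst \<in> L2 \<nu>" and P: "snd \<in> L2 \<nu>" using L2_fst[OF id] L2_snd[OF id] by simp_all
  have "\<exists>\<alpha>\<in>L2 \<nu>. AE z in \<nu>. nemytskii \<nu> fst \<alpha> z + snd z = 0"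
  proof (rule L2_strongly_monotone_zero[where \<Lambda> = "2 * K" and \<gamma> = \<gamma>])
    fix \<alpha> \<beta> :: "'d vec \<times> 'd vec \<Rightarrow> 'd vec" assume \<alpha>\<beta>: "\<alpha> \<in> L2 \<nu>" "\<beta> \<in> L2 \<nu>"
    show "(\<lambda>z. nemytskii \<nu> fst \<alpha> z + snd z) \<in> L2 \<nu>"
      by (intro L2_add nemytskii_L2 \<nu>_prob X P \<alpha>\<beta>)
    show "L2_norm \<nu> (\<lambda>z. nemytskii \<nu> fst \<alpha> z + snd z - (nemytskii \<nu> fst \<beta> z + snd z))
        \<le> 2 * K * L2_norm \<nu> (\<lambda>z. \<alpha> z - \<beta> z)"
      using nemytskii_lipschitz(2)[OF \<nu>_prob X \<alpha>\<beta>(1) X \<alpha>\<beta>(2)] L2_norm_const[of "0::'d vec"] by simp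
    show "\<gamma> * (L2_norm \<nu> (\<lambda>z. \<alpha> z - \<beta> z))\<^sup>2
        \<le> (\<integral>z. (nemytskii \<nu> fst \<alpha> z + snd z - (nemytskii \<nu> fst \<beta> z + snd z)) \<bullet> (\<alpha> z - \<beta> z) \<partial>\<nu>)"
      using nemytskii_strongly_mono[OF \<nu>_prob X \<alpha>\<beta>] by simp
  qed (rule \<gamma>)
  then obtain \<alpha> where \<alpha>: "\<alpha> \<in> L2 \<nu>" "AE z in \<nu>. nemytskii \<nu> fst \<alpha> z + snd z = 0" by blast
  define \<mu> where "\<mu> = law \<nu> (\<lambda>z. (fst z, \<alpha> z))"
  have \<mu>: "\<mu> \<in> P2" unfolding \<mu>_def by (rule law_pair_P2[OF \<nu>_prob X \<alpha>(1)])
  have "AE z in \<nu>. (fst z, \<alpha> z) = (\<lambda>(x, p). (x, - D_pH L x p \<mu>)) z"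
    using \<alpha>(2)
  proof eventually_elim
    case (elim z)
    then have "D_aL L (fst z) (\<alpha> z) \<mu> = - snd z"
      by (simp add: nemytskii_def \<mu>_def[symmetric] eq_neg_iff_add_eq_0)
    then have "- D_pH L (fst z) (snd z) \<mu> = \<alpha> z" using D_pH_iff[OF \<mu>] by blast
    then show ?case by (simp add: case_prod_beta')
  qed
  moreover have "(\<lambda>(x, p). (x, - D_pH L x p \<mu>)) \<in> borel_measurable \<nu>"
    using D_pH_measurable[OF \<mu>] by (simp add: measurable_cong_sets[OF P2D(2)[OF \<nu>] refl])
  ultimately have "law \<nu> (\<lambda>z. (fst z, \<alpha> z)) = distr \<nu> borel (\<lambda>(x, p). (x, - D_pH L x p \<mu>))"
    by (intro distr_cong_AE L2D(1)[OF L2_Pair[OF X \<alpha>(1)]]) auto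
  then have "\<mu> = distr \<nu> borel (\<lambda>(x, p). (x, - D_pH L x p \<mu>))"
    by (rule trans[OF \<mu>_def])
  then show ?thesis using \<mu> unfolding is_Phi_def by blast
qed

text \<open>A solution of the fixed point equation for the law of \<open>(X, P)\<close> is the law of \<open>(X, \<alpha>)\<close>, where the
  control \<open>\<alpha>\<close> satisfies the first order condition.\<close>

lemma is_Phi_lift:
  assumes M: "prob_space M" and X: "X \<in> L2 M" and P: "P \<in> L2 M"
    and Phi: "is_Phi L (law M (\<lambda>\<omega>. (X \<omega>, P \<omega>))) \<mu>"
  obtains \<alpha> where "\<alpha> \<in> L2 M" "law M (\<lambda>\<omega>. (X \<omega>, \<alpha> \<omega>)) = \<mu>" "nemytskii M X \<alpha> = (\<lambda>\<omega>. - P \<omega>)"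
    "\<And>\<omega>. \<alpha> \<omega> = - D_pH L (X \<omega>) (P \<omega>) \<mu>"
proof
  let ?A = "\<lambda>(x, p). (x, - D_pH L x p \<mu>)"
  define \<alpha> where "\<alpha> \<omega> = - D_pH L (X \<omega>) (P \<omega>) \<mu>" for \<omega>
  have \<mu>: "\<mu> \<in> P2" and eq: "distr (law M (\<lambda>\<omega>. (X \<omega>, P \<omega>))) borel ?A = \<mu>"
    using Phi by (auto simp: is_Phi_def)
  have XP: "(\<lambda>\<omega>. (X \<omega>, P \<omega>)) \<in> borel_measurable M" by (rule L2D(1)[OF L2_Pair[OF X P]])
  have comp: "?A \<circ> (\<lambda>\<omega>. (X \<omega>, P \<omega>)) = (\<lambda>\<omega>. (X \<omega>, \<alpha> \<omega>))" by (auto simp: \<alpha>_def)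
  have X\<alpha>: "(\<lambda>\<omega>. (X \<omega>, \<alpha> \<omega>)) \<in> borel_measurable M"
    using measurable_comp[OF XP D_pH_measurable[OF \<mu>]] unfolding comp .
  show law: "law M (\<lambda>\<omega>. (X \<omega>, \<alpha> \<omega>)) = \<mu>"
    using eq distr_distr[OF D_pH_measurable[OF \<mu>] XP] unfolding comp by simp
  have "integrable (law M (\<lambda>\<omega>. (X \<omega>, \<alpha> \<omega>))) (\<lambda>z. (norm z)\<^sup>2)"
    unfolding law using \<mu> by (simp add: P2_iff)
  then have "(\<lambda>\<omega>. (X \<omega>, \<alpha> \<omega>)) \<in> L2 M" using X\<alpha> by (simp add: L2_def integrable_distr_eq)
  from L2_snd[OF this] show "\<alpha> \<in> L2 M" by simp
  show "nemytskii M X \<alpha> = (\<lambda>\<omega>. - P \<omega>)"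
    unfolding nemytskii_def[abs_def] law
  proof
    show "D_aL L (X \<omega>) (\<alpha> \<omega>) \<mu> = - P \<omega>" for \<omega>
      using D_pH_iff[OF \<mu>, of "X \<omega>" "P \<omega>" "\<alpha> \<omega>"] by (simp add: \<alpha>_def)
  qed
  show "\<alpha> \<omega> = - D_pH L (X \<omega>) (P \<omega>) \<mu>" for \<omega> by (simp add: \<alpha>_def)
qed

lemma is_Phi_dist_le:
  assumes M: "prob_space M" and L2: "X \<in> L2 M" "P \<in> L2 M" "X' \<in> L2 M" "P' \<in> L2 M"
    and Phi: "is_Phi L (law M (\<lambda>\<omega>. (X \<omega>, P \<omega>))) \<mu>" "is_Phi L (law M (\<lambda>\<omega>. (X' \<omega>, P' \<omega>))) \<mu>'"
  obtains \<alpha> \<alpha>' where "\<alpha> \<in> L2 M" "\<alpha>' \<in> L2 M" "\<mu> = law M (\<lambda>\<omega>. (X \<omega>, \<alpha> \<omega>))" "\<mu>' = law M (\<lambda>\<omega>. (X' \<omega>, \<alpha>' \<omega>))"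
    "\<gamma> * L2_norm M (\<lambda>\<omega>. \<alpha> \<omega> - \<alpha>' \<omega>)
      \<le> L2_norm M (\<lambda>\<omega>. P \<omega> - P' \<omega>) + 2 * K * L2_norm M (\<lambda>\<omega>. X \<omega> - X' \<omega>)"
proof -
  obtain \<alpha> where \<alpha>: "\<alpha> \<in> L2 M" "law M (\<lambda>\<omega>. (X \<omega>, \<alpha> \<omega>)) = \<mu>" "nemytskii M X \<alpha> = (\<lambda>\<omega>. - P \<omega>)"
    by (rule is_Phi_lift[OF M L2(1,2) Phi(1)])
  obtain \<alpha>' where \<alpha>': "\<alpha>' \<in> L2 M" "law M (\<lambda>\<omega>. (X' \<omega>, \<alpha>' \<omega>)) = \<mu>'" "nemytskii M X' \<alpha>' = (\<lambda>\<omega>. - P' \<omega>)"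
    by (rule is_Phi_lift[OF M L2(3,4) Phi(2)])
  have "L2_norm M (\<lambda>\<omega>. - P \<omega> - - P' \<omega>) = L2_norm M (\<lambda>\<omega>. P \<omega> - P' \<omega>)"
    by (simp add: L2_norm_def norm_minus_commute)
  then show ?thesis
    using that[OF \<alpha>(1) \<alpha>'(1) \<alpha>(2)[symmetric] \<alpha>'(2)[symmetric]]
      control_estimate[OF M L2(1,3) \<alpha>(1) \<alpha>'(1)] unfolding \<alpha>(3) \<alpha>'(3) by simp
qed

lemma is_Phi_unique:
  assumes \<nu>: "\<nu> \<in> P2" and Phi: "is_Phi L \<nu> \<mu>" "is_Phi L \<nu> \<mu>'"
  shows "\<mu> = \<mu>'"
proof -
  interpret prob_space \<nu> by (rule P2D[OF \<nu>])
  have id: "(\<lambda>z. z) \<in> L2 \<nu>" by (rule P2_id_L2[OF \<nu>])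
  have XP: "fst \<in> L2 \<nu>" "snd \<in> L2 \<nu>" using L2_fst[OF id] L2_snd[OF id] by simp_all
  have law: "law \<nu> (\<lambda>z. (fst z, snd z)) = \<nu>" using P2D(2)[OF \<nu>] by (simp add: distr_id2)
  obtain \<alpha> \<alpha>' where \<alpha>: "\<alpha> \<in> L2 \<nu>" "\<alpha>' \<in> L2 \<nu>" "\<mu> = law \<nu> (\<lambda>z. (fst z, \<alpha> z))" "\<mu>' = law \<nu> (\<lambda>z. (fst z, \<alpha>' z))"
    and le: "\<gamma> * L2_norm \<nu> (\<lambda>z. \<alpha> z - \<alpha>' z)
      \<le> L2_norm \<nu> (\<lambda>z. snd z - snd z) + 2 * K * L2_norm \<nu> (\<lambda>z. fst z - fst z)"
    by (rule is_Phi_dist_le[OF prob_space_axioms XP XP, unfolded law, OF Phi])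
  have "L2_norm \<nu> (\<lambda>z. \<alpha> z - \<alpha>' z) = 0"
    using le \<gamma> L2_norm_nonneg[of \<nu> "\<lambda>z. \<alpha> z - \<alpha>' z"] L2_norm_const[of "0::'d vec"]
    by (simp add: mult_le_0_iff)
  then have "AE z in \<nu>. \<alpha> z - \<alpha>' z = 0" by (intro L2_norm_eq_0_imp_AE L2_diff \<alpha>)
  then show ?thesis
    unfolding \<alpha>(3,4) by (intro distr_cong_AE) (auto intro!: L2D(1) L2_Pair XP \<alpha>)
qed

lemma is_Phi_Phi:
  assumes "\<nu> \<in> P2"
  shows "is_Phi L \<nu> (Phi L \<nu>)"
  unfolding Phi_def by (rule theI') (use is_Phi_ex[OF assms] is_Phi_unique[OF assms] in blast)

lemma Phi_lipschitz:
  assumes "\<nu> \<in> P2" "\<nu>' \<in> P2"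
  shows "wdist 2 (Phi L \<nu>) (Phi L \<nu>') \<le> ((1 + 2 * K) / \<gamma> + 1) * wdist 2 \<nu> \<nu>'"
proof -
  define C where "C = (1 + 2 * K) / \<gamma> + 1"
  have C: "C > 0" using K \<gamma> by (simp add: C_def add_nonneg_pos)
  have "wdist 2 (Phi L \<nu>) (Phi L \<nu>') / C \<le> wdist 2 \<nu> \<nu>'"
  proof (rule wdist_2_ge[OF assms])
    show "0 \<le> wdist 2 (Phi L \<nu>) (Phi L \<nu>') / C" using C by (simp add: wdist_def)
    fix \<pi> assume "\<pi> \<in> couplings \<nu> \<nu>'"
    note \<pi> = coupling_L2[OF assms this]
    interpret prob_space \<pi> by (rule \<pi>)
    have L2: "(\<lambda>z. fst (fst z)) \<in> L2 \<pi>" "(\<lambda>z. snd (fst z)) \<in> L2 \<pi>"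
      "(\<lambda>z. fst (snd z)) \<in> L2 \<pi>" "(\<lambda>z. snd (snd z)) \<in> L2 \<pi>"
      using \<pi> by (auto intro!: L2_fst L2_snd)
    have "is_Phi L (law \<pi> (\<lambda>z. (fst (fst z), snd (fst z)))) (Phi L \<nu>)"
      "is_Phi L (law \<pi> (\<lambda>z. (fst (snd z), snd (snd z)))) (Phi L \<nu>')"
      using is_Phi_Phi assms by (simp_all add: \<pi>(4,5))
    from is_Phi_dist_le[OF prob_space_axioms L2 this]
    obtain \<alpha> \<alpha>' where \<alpha>: "\<alpha> \<in> L2 \<pi>" "\<alpha>' \<in> L2 \<pi>"
      and laws: "Phi L \<nu> = law \<pi> (\<lambda>z. (fst (fst z), \<alpha> z))" "Phi L \<nu>' = law \<pi> (\<lambda>z. (fst (snd z), \<alpha>' z))"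
      and le: "\<gamma> * L2_norm \<pi> (\<lambda>z. \<alpha> z - \<alpha>' z)
        \<le> L2_norm \<pi> (\<lambda>z. snd (fst z) - snd (snd z)) + 2 * K * L2_norm \<pi> (\<lambda>z. fst (fst z) - fst (snd z))"
      .
    define \<delta> where "\<delta> = L2_norm \<pi> (\<lambda>z. fst z - snd z)"
    have d: "(\<lambda>z. fst z - snd z) \<in> L2 \<pi>" by (intro L2_diff \<pi>)
    have X: "L2_norm \<pi> (\<lambda>z. fst (fst z) - fst (snd z)) \<le> \<delta>"
      unfolding \<delta>_def using norm_fst_le'[of "fst z - snd z" for z]
      by (intro L2_norm_mono(2)[OF d] L2D(1) L2_diff L2) auto
    have P: "L2_norm \<pi> (\<lambda>z. snd (fst z) - snd (snd z)) \<le> \<delta>"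
      unfolding \<delta>_def using norm_snd_le'[of "fst z - snd z" for z]
      by (intro L2_norm_mono(2)[OF d] L2D(1) L2_diff L2) auto
    have "2 * K * L2_norm \<pi> (\<lambda>z. fst (fst z) - fst (snd z)) \<le> 2 * K * \<delta>"
      using X K by (intro mult_left_mono) auto
    with le P have "\<gamma> * L2_norm \<pi> (\<lambda>z. \<alpha> z - \<alpha>' z) \<le> (1 + 2 * K) * \<delta>"
      by (simp add: distrib_right)
    then have A: "L2_norm \<pi> (\<lambda>z. \<alpha> z - \<alpha>' z) \<le> (1 + 2 * K) / \<gamma> * \<delta>"
      using \<gamma> by (simp add: field_simps)
    have "wdist 2 (Phi L \<nu>) (Phi L \<nu>') \<le> L2_norm \<pi> (\<lambda>z. (fst (fst z), \<alpha> z) - (fst (snd z), \<alpha>' z))"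
      unfolding laws by (intro wdist_2_law_le L2_Pair L2 \<alpha>)
    also have "\<dots> \<le> L2_norm \<pi> (\<lambda>z. fst (fst z) - fst (snd z)) + L2_norm \<pi> (\<lambda>z. \<alpha> z - \<alpha>' z)"
      using L2_norm_Pair_le[OF L2_diff L2_diff, OF L2(1,3) \<alpha>] by simp
    also have "\<dots> \<le> C * \<delta>" using X A by (simp add: C_def distrib_right)
    finally show "wdist 2 (Phi L \<nu>) (Phi L \<nu>') / C \<le> L2_norm \<pi> (\<lambda>z. fst z - snd z)"
      using C by (simp add: \<delta>_def divide_le_eq mult.commute)
  qed
  then show ?thesis using C by (simp add: C_def divide_le_eq mult.commute)
qed

end

section \<open>Empirical measures\<close>

lemma integral_uniform_count:
  fixes g :: "'a \<Rightarrow> 'b::{banach, second_countable_topology}"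
  assumes "finite I"
  shows "(\<integral>i. g i \<partial>uniform_count_measure I) = (1 / card I) *\<^sub>R (\<Sum>i\<in>I. g i)"
  using assms by (simp add: uniform_count_measure_def lebesgue_integral_point_measure_finite scaleR_sum_right)

lemma integrable_uniform_count:
  fixes g :: "'a \<Rightarrow> 'b::{banach, second_countable_topology}"
  assumes "finite I"
  shows "integrable (uniform_count_measure I) g"
  unfolding uniform_count_measure_def by (rule integrable_point_measure_finite[OF assms])

lemma measurable_uniform_count: "g \<in> borel_measurable (uniform_count_measure I)"
  by (simp add: measurable_def sets_uniform_count_measure space_uniform_count_measure)

lemma L2_uniform_count:
  assumes "finite I"
  shows "g \<in> L2 (uniform_count_measure I)"
  using assms by (simp add: L2_def measurable_uniform_count integrable_uniform_count)

lemma L2_norm_uniform_count_sq: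
  assumes "finite I"
  shows "(L2_norm (uniform_count_measure I) g)\<^sup>2 = (\<Sum>i\<in>I. (norm (g i))\<^sup>2) / card I"
  using assms by (simp add: L2_norm_sq integral_uniform_count)

lemma sum_squares_uniform_count:
  assumes "N > 0"
  shows "real N * (L2_norm (uniform_count_measure {..<N}) x + L2_norm (uniform_count_measure {..<N}) p)\<^sup>2
    \<le> 2 * (\<Sum>i<N. (norm (x i))\<^sup>2 + (norm (p i))\<^sup>2)"
proof -
  let ?U = "uniform_count_measure {..<N}"
  have N: "real N > 0" using assms by simp
  have "(L2_norm ?U x + L2_norm ?U p)\<^sup>2 \<le> 2 * ((L2_norm ?U x)\<^sup>2 + (L2_norm ?U p)\<^sup>2)"
    using sum_squares_bound[of "L2_norm ?U x" "L2_norm ?U p"] by (simp add: power2_sum)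
  also have "\<dots> = 2 * (\<Sum>i<N. (norm (x i))\<^sup>2 + (norm (p i))\<^sup>2) / N"
    by (simp add: L2_norm_uniform_count_sq sum.distrib add_divide_distrib)
  finally show ?thesis using N by (simp add: field_simps)
qed

lemma AE_uniform_count:
  assumes "finite I" "AE i in uniform_count_measure I. Q i" "i \<in> I"
  shows "Q i"
proof -
  have "card I > 0" using assms by (auto simp: card_gt_0_iff)
  then have "0 < ennreal (1 / real (card I))" by simp
  moreover have "\<forall>x\<in>I. 0 < ennreal (1 / real (card I)) \<longrightarrow> Q x"
    using assms(2) unfolding uniform_count_measure_def AE_point_measure .
  ultimately show ?thesis using assms(3) by blast
qed

lemma empirical_P2:
  assumes "finite I" "I \<noteq> {}"
  shows "empirical I y \<in> P2"
  unfolding empirical_def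
  by (intro prob_space.law_P2 prob_space_uniform_count_measure L2_uniform_count assms)

lemma integral_empirical:
  fixes g :: "'a::euclidean_space \<Rightarrow> 'b::euclidean_space"
  assumes "finite I" "g \<in> borel_measurable borel"
  shows "(\<integral>x. g x \<partial>empirical I y) = (1 / card I) *\<^sub>R (\<Sum>i\<in>I. g (y i))"
  unfolding empirical_def using assms
  by (simp add: integral_distr measurable_uniform_count integral_uniform_count)

lemma law_empirical:
  assumes "h \<in> borel_measurable borel"
  shows "law (empirical I y) h = empirical I (\<lambda>i. h (y i))"
  unfolding empirical_def using assms by (simp add: distr_distr measurable_uniform_count comp_def)

lemma empirical_cong:
  assumes "\<And>i. i \<in> I \<Longrightarrow> y i = y' i"
  shows "empirical I y = empirical I y'"
  unfolding empirical_def using assms by (intro distr_cong) (auto simp: space_uniform_count_measure)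

lemma empirical_const:
  assumes "finite I" "I \<noteq> {}"
  shows "empirical I (\<lambda>i. w) = return borel w"
  unfolding empirical_def
  by (simp add: prob_space.distr_const prob_space_uniform_count_measure assms)

text \<open>Removing one point from the empirical measure moves it by \<open>1 / N\<close> times a difference of
  averages.\<close>

lemma average_remove_diff:
  fixes g :: "nat \<Rightarrow> 'b::real_vector"
  assumes N: "N \<ge> 2" and i: "i < N"
  shows "(1 / real (card ({..<N} - {i}))) *\<^sub>R (\<Sum>j\<in>{..<N} - {i}. g j) - (1 / real (card {..<N})) *\<^sub>R (\<Sum>j<N. g j)
    = (1 / (real N * (real N - 1))) *\<^sub>R (\<Sum>j\<in>{..<N} - {i}. g j - g i)"
proof -
  define s where "s = (\<Sum>j\<in>{..<N} - {i}. g j)"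
  have card: "card ({..<N} - {i}) = N - 1" using i by simp
  have sum: "(\<Sum>j<N. g j) = s + g i" unfolding s_def using i by (simp add: sum.remove add.commute)
  have N1: "real (N - Suc 0) = real N - 1" "real N - 1 > 0" using N by auto
  have c: "1 / (real N - 1) - 1 / real N = 1 / (real N * (real N - 1))"
    using N1 by (simp add: field_simps)
  have "(1 / (real N - 1)) *\<^sub>R s - (1 / real N) *\<^sub>R (s + g i)
      = (1 / (real N - 1) - 1 / real N) *\<^sub>R s - (1 / real N) *\<^sub>R g i"
    by (simp add: algebra_simps)
  also have "\<dots> = (1 / (real N * (real N - 1))) *\<^sub>R (s - (real N - 1) *\<^sub>R g i)"
    unfolding c using N1 by (simp add: scaleR_diff_right)
  also have "s - (real N - 1) *\<^sub>R g i = (\<Sum>j\<in>{..<N} - {i}. g j - g i)"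
    by (simp add: s_def sum_subtractf card N1 sum_constant_scaleR del: sum_constant)
  finally show ?thesis by (simp add: card sum N1 flip: s_def)
qed

lemma emp_minus_P2:
  assumes "N \<ge> 2" "i < N"
  shows "emp_minus N i x a \<in> P2"
proof -
  have "(if i = 0 then 1 else 0) \<in> {..<N} - {i}" using assms by auto
  then show ?thesis unfolding emp_minus_def by (intro empirical_P2) auto
qed

lemma emp_eq_law: "emp N x a = law (uniform_count_measure {..<N}) (\<lambda>j. (x j, a j))"
  by (simp add: emp_def empirical_def)

text \<open>Both empirical measures in a mixture are coupled by pairing the points of equal index.\<close>

lemma wdist_1_mixture_emp_le:
  fixes x a x' a' :: "nat \<Rightarrow> 'd::finite vec"
  assumes N: "N \<ge> 2" and i: "i < N" and t: "0 \<le> t" "t \<le> 1"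
  shows "wdist 1 (mixture t (emp N x a) (emp_minus N i x a)) (mixture t (emp N x' a') (emp_minus N i x' a'))
    \<le> (\<Sum>j<N. norm ((x j, a j) - (x' j, a' j))) / (real N - 1)"
proof -
  let ?d = "\<lambda>j. norm ((x j, a j) - (x' j, a' j))"
  define S where "S = (\<Sum>j<N. ?d j) / (real N - 1)"
  let ?z = "\<lambda>j. ((x j, a j), (x' j, a' j))"
  let ?I = "{..<N} - {i}"
  have I: "finite ?I" "?I \<noteq> {}"
  proof -
    have "(if i = 0 then 1 else 0) \<in> ?I" using N by auto
    then show "?I \<noteq> {}" by blast
  qed simp
  have J: "{..<N} \<noteq> {}" using i by auto
  have laws: "emp N x a = law (empirical {..<N} ?z) fst" "emp N x' a' = law (empirical {..<N} ?z) snd"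
    "emp_minus N i x a = law (empirical ?I ?z) fst" "emp_minus N i x' a' = law (empirical ?I ?z) snd"
    by (simp_all add: law_empirical emp_def emp_minus_def)
  have meas: "(\<lambda>z::('d vec \<times> 'd vec) \<times> ('d vec \<times> 'd vec). norm (fst z - snd z)) \<in> borel_measurable borel"
    by measurable
  have N1: "real N - 1 > 0" "real (N - Suc 0) = real N - 1" using N by auto
  have "(\<integral>z. norm (fst z - snd z) \<partial>empirical {..<N} ?z) = (\<Sum>j<N. ?d j) / real N"
    using integral_empirical[of "{..<N}" "\<lambda>z. norm (fst z - snd z)" ?z, OF _ meas] by simp
  also have "\<dots> \<le> S" unfolding S_def using N1 by (intro divide_left_mono sum_nonneg) auto
  finally have 1: "(\<integral>z. norm (fst z - snd z) \<partial>empirical {..<N} ?z) \<le> S" .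
  have "(\<integral>z. norm (fst z - snd z) \<partial>empirical ?I ?z) = (\<Sum>j\<in>?I. ?d j) / (real N - 1)"
    using integral_empirical[of ?I "\<lambda>z. norm (fst z - snd z)" ?z, OF _ meas] i N1 by simp
  also have "\<dots> \<le> S" unfolding S_def using N1 by (intro divide_right_mono sum_mono2) auto
  finally have 2: "(\<integral>z. norm (fst z - snd z) \<partial>empirical ?I ?z) \<le> S" .
  have "wdist 1 (mixture t (emp N x a) (emp_minus N i x a)) (mixture t (emp N x' a') (emp_minus N i x' a'))
      \<le> (1 - t) * (\<integral>z. norm (fst z - snd z) \<partial>empirical {..<N} ?z) + t * (\<integral>z. norm (fst z - snd z) \<partial>empirical ?I ?z)"
    unfolding laws by (intro wdist_1_mixture_le empirical_P2 I J t) simp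
  also have "\<dots> \<le> (1 - t) * S + t * S"
    using t 1 2 by (intro add_mono mult_left_mono) auto
  also have "\<dots> = S" by (simp add: algebra_simps)
  finally show ?thesis by (simp only: S_def)
qed

section \<open>The finite-player system\<close>

context displacement_monotone_lagrangian
begin

text \<open>The effect of leaving the state and control of player \<open>i\<close> out of the empirical measure.\<close>

definition self_interaction :: "nat \<Rightarrow> (nat \<Rightarrow> 'd vec) \<Rightarrow> (nat \<Rightarrow> 'd vec) \<Rightarrow> nat \<Rightarrow> 'd vec" where
  "self_interaction N x a i = D_aL L (x i) (a i) (emp_minus N i x a) - D_aL L (x i) (a i) (emp N x a)"

text \<open>The mean value theorem is applied on the two segments that join the empirical measures with and
  without player \<open>i\<close>. By the lemma \<open>average_remove_diff\<close> the derivative on each segment is an average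
  of differences of \<open>f\<close>, times \<open>1 / N\<close>. As \<open>f\<close> is Lipschitz in all its arguments, the
  difference of the two derivatives is of the order \<open>1 / N\<close> times the distance of the
  configurations.\<close>

lemma self_interaction_diff_le:
  assumes N: "N \<ge> 2" and i: "i < N"
  shows "norm (self_interaction N x a i - self_interaction N x' a' i)
    \<le> 3 * K / N * (norm ((x i, a i) - (x' i, a' i)) + (\<Sum>j<N. norm ((x j, a j) - (x' j, a' j))) / (real N - 1))"
proof -
  let ?I = "{..<N} - {i}"
  define z where "z = (\<lambda>j. (x j, a j))"
  define z' where "z' = (\<lambda>j. (x' j, a' j))"
  define S where "S = (\<Sum>j<N. norm (z j - z' j)) / (real N - 1)"
  define \<delta> where "\<delta> = norm (z i - z' i)"
  have N1: "real N - 1 > 0" "real (N - Suc 0) = real N - 1" using N by auto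
  have P2: "emp N x a \<in> P2" "emp N x' a' \<in> P2" "emp_minus N i x a \<in> P2" "emp_minus N i x' a' \<in> P2"
    using emp_minus_P2[OF N i] i by (auto simp: emp_def intro!: empirical_P2)
  have "norm ((D_aL L (x i) (a i) (emp_minus N i x a) - D_aL L (x i) (a i) (emp N x a))
      - (D_aL L (x' i) (a' i) (emp_minus N i x' a') - D_aL L (x' i) (a' i) (emp N x' a'))) \<le> 3 * K / N * (\<delta> + S)"
  proof (rule flat_derivative_mvt[where ?f1.0 = "f (z i)" and ?f2.0 = "f (z' i)"])
    fix t :: real assume t: "0 < t" "t < 1"
    define m where "m = mixture t (emp N x a) (emp_minus N i x a)"
    define m' where "m' = mixture t (emp N x' a') (emp_minus N i x' a')"
    have m: "m \<in> P2" "m' \<in> P2" unfolding m_def m'_def using t P2 by (auto intro!: mixture_P2)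
    define g where "g = f (z i) m"
    define g' where "g' = f (z' i) m'"
    have meas: "g \<in> borel_measurable borel" "g' \<in> borel_measurable borel"
      using flat[OF m(1), of "x i" "a i"] flat[OF m(2), of "x' i" "a' i"]
      by (auto simp: has_flat_derivative_def g_def g'_def z_def z'_def intro: borel_measurable_continuous_onI)
    have W: "wdist 1 m m' \<le> S"
      unfolding m_def m'_def S_def z_def z'_def by (rule wdist_1_mixture_emp_le[OF N i]) (use t in auto)
    have g: "norm (g (z j) - g' (z' j)) \<le> K * (\<delta> + S + norm (z j - z' j))" for j
    proof -
      have "norm (g (z j) - g' (z' j)) \<le> K * (\<delta> + wdist 1 m m' + norm (z j - z' j))"
        unfolding g_def g'_def \<delta>_def by (rule flat_lipschitz[OF m])
      also have "\<dots> \<le> K * (\<delta> + S + norm (z j - z' j))"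
        using K W by (intro mult_left_mono) auto
      finally show ?thesis .
    qed
    have diff: "(\<integral>y. g y \<partial>emp_minus N i x a) - (\<integral>y. g y \<partial>emp N x a)
        = (1 / (real N * (real N - 1))) *\<^sub>R (\<Sum>j\<in>?I. g (z j) - g (z i))"
      using average_remove_diff[OF N i, of "\<lambda>j. g (z j)"]
      by (simp add: emp_def emp_minus_def integral_empirical meas z_def)
    have diff': "(\<integral>y. g' y \<partial>emp_minus N i x' a') - (\<integral>y. g' y \<partial>emp N x' a')
        = (1 / (real N * (real N - 1))) *\<^sub>R (\<Sum>j\<in>?I. g' (z' j) - g' (z' i))"
      using average_remove_diff[OF N i, of "\<lambda>j. g' (z' j)"]
      by (simp add: emp_def emp_minus_def integral_empirical meas z'_def)
    have "norm (\<Sum>j\<in>?I. (g (z j) - g (z i)) - (g' (z' j) - g' (z' i)))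
        \<le> (\<Sum>j\<in>?I. norm ((g (z j) - g (z i)) - (g' (z' j) - g' (z' i))))"
      by (rule norm_sum)
    also have "\<dots> \<le> (\<Sum>j\<in>?I. K * (3 * \<delta> + 2 * S + norm (z j - z' j)))"
    proof (rule sum_mono)
      fix j
      have "(g (z j) - g (z i)) - (g' (z' j) - g' (z' i)) = (g (z j) - g' (z' j)) - (g (z i) - g' (z' i))"
        by simp
      also have "norm \<dots> \<le> norm (g (z j) - g' (z' j)) + norm (g (z i) - g' (z' i))"
        by (rule norm_triangle_ineq4)
      also have "\<dots> \<le> K * (\<delta> + S + norm (z j - z' j)) + K * (\<delta> + S + \<delta>)"
        using g[of j] g[of i] by (auto simp: \<delta>_def)
      finally show "norm ((g (z j) - g (z i)) - (g' (z' j) - g' (z' i))) \<le> K * (3 * \<delta> + 2 * S + norm (z j - z' j))"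
        by (simp add: algebra_simps)
    qed
    also have "\<dots> = K * ((real N - 1) * (3 * \<delta> + 2 * S) + (\<Sum>j\<in>?I. norm (z j - z' j)))"
      using i N1 by (simp add: sum_distrib_left[symmetric] sum.distrib)
    also have "(\<Sum>j\<in>?I. norm (z j - z' j)) \<le> (\<Sum>j<N. norm (z j - z' j))"
      by (intro sum_mono2) auto
    also have "(\<Sum>j<N. norm (z j - z' j)) = (real N - 1) * S" using N1 by (simp add: S_def)
    finally have le: "norm (\<Sum>j\<in>?I. (g (z j) - g (z i)) - (g' (z' j) - g' (z' i)))
        \<le> K * ((real N - 1) * (3 * (\<delta> + S)))"
      using K by (simp add: algebra_simps)
    have "norm (((\<integral>y. g y \<partial>emp_minus N i x a) - (\<integral>y. g y \<partial>emp N x a))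
        - ((\<integral>y. g' y \<partial>emp_minus N i x' a') - (\<integral>y. g' y \<partial>emp N x' a')))
      = (1 / (real N * (real N - 1))) * norm (\<Sum>j\<in>?I. (g (z j) - g (z i)) - (g' (z' j) - g' (z' i)))"
      unfolding diff diff' using N1
      by (simp add: sum_subtractf[symmetric] scaleR_diff_right[symmetric] del: sum_subtractf scaleR_diff_right)
    also have "\<dots> \<le> (1 / (real N * (real N - 1))) * (K * ((real N - 1) * (3 * (\<delta> + S))))"
      using N1 by (intro mult_left_mono le) auto
    also have "\<dots> = 3 * K / N * (\<delta> + S)" using N1 by (simp add: field_simps)
    finally show "norm (((\<integral>y. f (z i) (mixture t (emp N x a) (emp_minus N i x a)) y \<partial>emp_minus N i x a)
          - (\<integral>y. f (z i) (mixture t (emp N x a) (emp_minus N i x a)) y \<partial>emp N x a))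
        - ((\<integral>y. f (z' i) (mixture t (emp N x' a') (emp_minus N i x' a')) y \<partial>emp_minus N i x' a')
          - (\<integral>y. f (z' i) (mixture t (emp N x' a') (emp_minus N i x' a')) y \<partial>emp N x' a')))
        \<le> 3 * K / N * (\<delta> + S)"
      by (simp only: g_def g'_def m_def m'_def)
  qed (use flat P2 in \<open>auto simp: z_def z'_def\<close>)
  then show ?thesis by (simp add: self_interaction_def \<delta>_def S_def z_def z'_def)
qed

lemma self_interaction_lipschitz:
  assumes N: "N \<ge> 2"
  defines "U \<equiv> uniform_count_measure {..<N}"
  shows "L2_norm U (\<lambda>i. self_interaction N x a i - self_interaction N x' a' i)
    \<le> 9 * K / N * (L2_norm U (\<lambda>i. x i - x' i) + L2_norm U (\<lambda>i. a i - a' i))"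
proof -
  interpret prob_space U unfolding U_def using N by (intro prob_space_uniform_count_measure) (auto simp: lessThan_empty_iff)
  have L2: "g \<in> L2 U" for g :: "nat \<Rightarrow> 'v::euclidean_space"
    unfolding U_def by (rule L2_uniform_count) simp
  define D where "D = (\<lambda>i. (x i - x' i, a i - a' i))"
  have N1: "real N - 1 > 0" using N by auto
  have "(\<Sum>j<N. norm (D j)) = real N * (\<integral>j. norm (D j) \<partial>U)"
    using N by (simp add: U_def integral_uniform_count)
  also have "\<dots> \<le> real N * L2_norm U D" by (intro mult_left_mono integral_norm_le_L2_norm L2) simp
  \<comment> \<open>\<open>N \<le> 2 (N - 1)\<close> for \<open>N \<ge> 2\<close>\<close>
  also have "\<dots> \<le> (2 * (real N - 1)) * L2_norm U D"
    using N by (intro mult_right_mono L2_norm_nonneg) auto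
  finally have S: "(\<Sum>j<N. norm (D j)) / (real N - 1) \<le> 2 * L2_norm U D"
    using N1 by (simp add: field_simps)
  define Y where "Y = (\<lambda>i. norm (D i) + 2 * L2_norm U D)"
  have "L2_norm U (\<lambda>i. self_interaction N x a i - self_interaction N x' a' i)
      \<le> L2_norm U (\<lambda>i. (3 * K / N) *\<^sub>R Y i)"
  proof (rule L2_norm_mono(2)[OF L2 L2D(1)[OF L2]])
    fix i assume "i \<in> space U"
    then have "i < N" by (simp add: U_def space_uniform_count_measure)
    have "norm (self_interaction N x a i - self_interaction N x' a' i)
        \<le> 3 * K / N * (norm (D i) + (\<Sum>j<N. norm (D j)) / (real N - 1))"
      using self_interaction_diff_le[OF N \<open>i < N\<close>, of x a x' a'] by (simp add: D_def)
    also have "\<dots> \<le> 3 * K / N * Y i"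
      unfolding Y_def using K S by (intro mult_left_mono add_left_mono) auto
    also have "\<dots> \<le> norm ((3 * K / N) *\<^sub>R Y i)"
      unfolding real_scaleR_def real_norm_def by (rule abs_ge_self)
    finally show "norm (self_interaction N x a i - self_interaction N x' a' i) \<le> norm ((3 * K / N) *\<^sub>R Y i)" .
  qed
  also have "\<dots> = 3 * K / N * L2_norm U Y" using K by (subst L2_norm_scaleR) simp
  also have "\<dots> \<le> 3 * K / N * (3 * L2_norm U D)"
    unfolding Y_def
    using L2_norm_triangle[OF L2 L2_const, of "\<lambda>i. norm (D i)" "2 * L2_norm U D"] K
    by (intro mult_left_mono) (auto simp: L2_norm_const L2_norm_normed L2_norm_nonneg)
  also have "\<dots> \<le> 3 * K / N * (3 * (L2_norm U (\<lambda>i. x i - x' i) + L2_norm U (\<lambda>i. a i - a' i)))"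
    unfolding D_def using K by (intro mult_left_mono L2_norm_Pair_le L2) auto
  finally show ?thesis by (simp add: algebra_simps)
qed

text \<open>Player indices form the probability space \<open>uniform_count_measure {..<N}\<close>. In these terms the
  system is the mean field equation with a momentum perturbed by the self-interaction.\<close>

lemma solves_system_iff:
  assumes "N \<ge> 2"
  shows "solves_system L N x p a \<longleftrightarrow> a \<in> {..<N} \<rightarrow>\<^sub>E UNIV \<and>
    (\<forall>i<N. nemytskii (uniform_count_measure {..<N}) x a i = - p i - self_interaction N x a i)"
proof -
  have "a i = - D_pH L (x i) (p i) (emp_minus N i x a) \<longleftrightarrow>
      nemytskii (uniform_count_measure {..<N}) x a i = - p i - self_interaction N x a i" if "i < N" for i
  proof -
    have "nemytskii (uniform_count_measure {..<N}) x a i = - p i - self_interaction N x a i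
        \<longleftrightarrow> D_aL L (x i) (a i) (emp_minus N i x a) = - p i"
      by (simp add: nemytskii_def self_interaction_def emp_eq_law eq_diff_eq)
    then show ?thesis
      using D_pH_iff[OF emp_minus_P2[OF assms that], of "x i" "p i" x a "a i"] by auto
  qed
  then show ?thesis unfolding solves_system_def by auto
qed

text \<open>The self-interaction is a perturbation of Lipschitz constant \<open>9 K / N\<close>. For the number of
  players considered here it takes up at most half of the monotonicity.\<close>

definition many_players :: "nat \<Rightarrow> bool" where
  "many_players N \<longleftrightarrow> N \<ge> 2 \<and> 9 * K / N \<le> \<gamma> / 2"

lemma eventually_many_players: "\<forall>\<^sub>F N in sequentially. many_players N"
proof -
  have "(\<lambda>N. 9 * K / real N) \<longlonglongrightarrow> 0" by (rule lim_const_over_n)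
  then have "\<forall>\<^sub>F N in sequentially. 9 * K / real N < \<gamma> / 2"
    using \<gamma> by (intro order_tendstoD(2)[of _ 0]) auto
  with eventually_ge_at_top[of 2] show ?thesis
    by eventually_elim (simp add: many_players_def)
qed

context
  fixes N :: nat and U :: "nat measure"
  assumes N: "many_players N"
  defines "U \<equiv> uniform_count_measure {..<N}"
begin

lemma N2: "N \<ge> 2" and N_large: "9 * K / N \<le> \<gamma> / 2"
  using N by (auto simp: many_players_def)

lemma U_prob: "prob_space U"
  unfolding U_def using N2 by (intro prob_space_uniform_count_measure) (auto simp: lessThan_empty_iff)

interpretation U: prob_space U by (rule U_prob)

lemma U_space: "space U = {..<N}"
  by (simp add: U_def space_uniform_count_measure)

lemma U_L2: "g \<in> L2 U"
  unfolding U_def by (rule L2_uniform_count) simp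

lemma self_interaction_small:
  "L2_norm U (\<lambda>i. self_interaction N x a i - self_interaction N x' a' i)
    \<le> \<gamma> / 2 * (L2_norm U (\<lambda>i. x i - x' i) + L2_norm U (\<lambda>i. a i - a' i))"
proof -
  have "9 * K / N * (L2_norm U (\<lambda>i. x i - x' i) + L2_norm U (\<lambda>i. a i - a' i))
      \<le> \<gamma> / 2 * (L2_norm U (\<lambda>i. x i - x' i) + L2_norm U (\<lambda>i. a i - a' i))"
    by (intro mult_right_mono N_large add_nonneg_nonneg L2_norm_nonneg)
  then show ?thesis
    using self_interaction_lipschitz[OF N2, of x a x' a', folded U_def] by linarith
qed

lemma solves_system_ex: "\<exists>a. solves_system L N x p a"
proof -
  let ?F = "\<lambda>a i. nemytskii U x a i + self_interaction N x a i + p i"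
  have "\<exists>a\<in>L2 U. AE i in U. ?F a i = 0"
  proof (rule U.L2_strongly_monotone_zero[where \<Lambda> = "2 * K + \<gamma> / 2" and \<gamma> = "\<gamma> / 2"])
    fix a b :: "nat \<Rightarrow> 'd vec"
    let ?n = "\<lambda>i. nemytskii U x a i - nemytskii U x b i"
    let ?s = "\<lambda>i. self_interaction N x a i - self_interaction N x b i"
    let ?d = "\<lambda>i. a i - b i"
    have split: "?F a i - ?F b i = ?n i + ?s i" for i by simp
    have zero: "L2_norm U (\<lambda>i. x i - x i) = 0" using U.L2_norm_const[of "0::'d vec"] by simp
    have n: "L2_norm U ?n \<le> 2 * K * L2_norm U ?d"
      using nemytskii_lipschitz(2)[OF U_prob U_L2 U_L2 U_L2 U_L2, of x a x b] zero by simp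
    have s: "L2_norm U ?s \<le> \<gamma> / 2 * L2_norm U ?d"
      using self_interaction_small[of x a x b] zero by simp
    show "L2_norm U (\<lambda>i. ?F a i - ?F b i) \<le> (2 * K + \<gamma> / 2) * L2_norm U ?d"
      unfolding split using L2_norm_triangle[OF U_L2 U_L2, of ?n ?s] n s by (simp add: distrib_right)
    have "\<bar>\<integral>i. ?s i \<bullet> ?d i \<partial>U\<bar> \<le> L2_norm U ?s * L2_norm U ?d"
      by (rule integral_inner_le_L2_norm[OF U_L2 U_L2])
    also have "\<dots> \<le> \<gamma> / 2 * L2_norm U ?d * L2_norm U ?d"
      by (intro mult_right_mono s L2_norm_nonneg)
    finally have "- (\<gamma> / 2 * (L2_norm U ?d)\<^sup>2) \<le> (\<integral>i. ?s i \<bullet> ?d i \<partial>U)"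
      by (simp add: power2_eq_square)
    moreover have "(\<integral>i. (?F a i - ?F b i) \<bullet> ?d i \<partial>U) = (\<integral>i. ?n i \<bullet> ?d i \<partial>U) + (\<integral>i. ?s i \<bullet> ?d i \<partial>U)"
      unfolding split inner_add_left
      by (intro Bochner_Integration.integral_add integrable_inner_L2 U_L2)
    ultimately show "\<gamma> / 2 * (L2_norm U ?d)\<^sup>2 \<le> (\<integral>i. (?F a i - ?F b i) \<bullet> ?d i \<partial>U)"
      using nemytskii_strongly_mono[OF U_prob U_L2 U_L2 U_L2, where X = x and \<alpha> = a and \<alpha>' = b] by simp
  qed (use \<gamma> in \<open>auto intro: U_L2\<close>)
  then obtain a where a: "AE i in U. ?F a i = 0" by blast
  \<comment> \<open>Controls of indices beyond \<open>N\<close> do not enter the equations; they are set to \<open>undefined\<close>.\<close>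
  define b where "b = restrict a {..<N}"
  have b: "b i = a i" if "i < N" for i using that by (simp add: b_def)
  have "emp N x b = emp N x a" "\<And>i. emp_minus N i x b = emp_minus N i x a"
    unfolding emp_def emp_minus_def by (intro empirical_cong; simp add: b_def)+
  then have "nemytskii U x b i = nemytskii U x a i" "self_interaction N x b i = self_interaction N x a i"
    if "i < N" for i
    using that b by (auto simp: nemytskii_def self_interaction_def U_def simp flip: emp_eq_law)
  moreover have "nemytskii U x a i = - p i - self_interaction N x a i" if "i < N" for i
  proof -
    have "?F a i = 0"
      by (rule AE_uniform_count[of "{..<N}"]) (use a[unfolded U_def] that in \<open>auto simp: U_def\<close>)
    then show ?thesis by (simp add: eq_neg_iff_add_eq_0 algebra_simps)
  qed
  ultimately have "solves_system L N x p b"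
    unfolding solves_system_iff[OF N2] U_def[symmetric] by (auto simp: b_def PiE_def)
  then show ?thesis by blast
qed

lemma solves_system_dist_le:
  assumes a: "solves_system L N x p a" and a': "solves_system L N x' p' a'"
  shows "L2_norm U (\<lambda>i. a i - a' i)
    \<le> (1 + (2 + 4 * K) / \<gamma>) * (L2_norm U (\<lambda>i. x i - x' i) + L2_norm U (\<lambda>i. p i - p' i))"
proof -
  let ?a = "L2_norm U (\<lambda>i. a i - a' i)" and ?x = "L2_norm U (\<lambda>i. x i - x' i)" and ?p = "L2_norm U (\<lambda>i. p i - p' i)"
  let ?s = "\<lambda>i. self_interaction N x a i - self_interaction N x' a' i"
  have "L2_norm U (\<lambda>i. nemytskii U x a i - nemytskii U x' a' i) = L2_norm U (\<lambda>i. (p' i - p i) - ?s i)"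
    using a a' unfolding solves_system_iff[OF N2] U_def[symmetric]
    by (intro L2_norm_cong) (auto simp: U_space)
  also have "\<dots> \<le> ?p + L2_norm U ?s"
    using L2_norm_diff_le[OF U_L2 U_L2, of "\<lambda>i. p' i - p i" ?s] by (simp add: L2_norm_minus_commute[of U p'])
  also have "\<dots> \<le> ?p + \<gamma> / 2 * (?x + ?a)" by (intro add_left_mono self_interaction_small)
  finally have "\<gamma> * ?a \<le> ?p + \<gamma> / 2 * (?x + ?a) + 2 * K * ?x"
    using control_estimate[OF U_prob U_L2 U_L2 U_L2 U_L2, of a a' x x'] by linarith
  then have "\<gamma> * ?a \<le> 2 * ?p + (\<gamma> + 4 * K) * ?x" by (simp add: algebra_simps)
  also have "\<dots> \<le> (\<gamma> + 2 + 4 * K) * ?p + (\<gamma> + 2 + 4 * K) * ?x"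
    using K \<gamma> by (intro add_mono mult_right_mono L2_norm_nonneg) auto
  also have "\<dots> = \<gamma> * ((1 + (2 + 4 * K) / \<gamma>) * (?x + ?p))" using \<gamma> by (simp add: field_simps)
  finally show ?thesis using \<gamma> by simp
qed

lemma solves_system_unique:
  assumes "solves_system L N x p a" "solves_system L N x p b"
  shows "a = b"
proof -
  have "L2_norm U (\<lambda>i. a i - b i) \<le> 0"
    using solves_system_dist_le[OF assms] U.L2_norm_const[of "0::'d vec"] by simp
  then have "L2_norm U (\<lambda>i. a i - b i) = 0" using L2_norm_nonneg[of U "\<lambda>i. a i - b i"] by linarith
  then have AE: "AE i in U. a i - b i = 0" by (rule L2_norm_eq_0_imp_AE[OF U_L2])
  have "a i = b i" if "i \<in> {..<N}" for i
    using AE_uniform_count[OF _ AE[unfolded U_def] that] by simp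
  moreover have "a \<in> {..<N} \<rightarrow>\<^sub>E UNIV" "b \<in> {..<N} \<rightarrow>\<^sub>E UNIV"
    using assms by (auto simp: solves_system_def)
  ultimately show ?thesis by (rule PiE_ext[rotated 2])
qed

lemma solves_system_aN: "solves_system L N x p (aN L N x p)"
  unfolding aN_def by (rule theI'[of "solves_system L N x p"]) (use solves_system_ex solves_system_unique in blast)

lemma emp_P2: "emp N x p \<in> P2"
  unfolding emp_def using N2 by (intro empirical_P2) (auto simp: lessThan_empty_iff)

text \<open>At the origin of the state space all players use the same control, and there is no
  self-interaction.\<close>

lemma solves_system_origin:
  obtains a0 where "solves_system L N (\<lambda>_. 0) (\<lambda>_. 0) (restrict (\<lambda>_. a0) {..<N})"
    "\<And>i. i < N \<Longrightarrow> self_interaction N (\<lambda>_. 0) (\<lambda>_. a0) i = 0"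
proof -
  have Phi: "is_Phi L (law U (\<lambda>i. ((\<lambda>_. 0) i, (\<lambda>_. 0) i))) (Phi L (emp N (\<lambda>_. 0) (\<lambda>_. 0)))"
    using is_Phi_Phi[OF emp_P2[of "\<lambda>_. 0" "\<lambda>_. 0"]] by (simp add: emp_eq_law U_def)
  obtain \<alpha> where \<alpha>: "nemytskii U (\<lambda>_. 0) \<alpha> = (\<lambda>_. - 0)"
    "\<And>i. \<alpha> i = - D_pH L 0 0 (Phi L (emp N (\<lambda>_. 0) (\<lambda>_. 0)))"
    by (rule is_Phi_lift[OF U_prob U_L2 U_L2 Phi]) blast
  define a0 where "a0 = - D_pH L 0 0 (Phi L (emp N (\<lambda>_. 0) (\<lambda>_. 0)))"
  have \<alpha>_a0: "\<alpha> = (\<lambda>_. a0)" using \<alpha>(2) by (auto simp: a0_def)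
  have ne: "{..<N} - {i} \<noteq> {}" if "i < N" for i
  proof -
    have "(if i = 0 then 1 else 0) \<in> {..<N} - {i}" using N2 by auto
    then show ?thesis by blast
  qed
  have self0: "self_interaction N (\<lambda>_. 0) (\<lambda>_. a0) i = 0" if "i < N" for i
    using ne[OF that] N2 unfolding self_interaction_def emp_def emp_minus_def
    by (subst (1 2) empirical_const) auto
  define b where "b = restrict (\<lambda>_. a0) {..<N}"
  have b: "b i = a0" if "i < N" for i using that by (simp add: b_def)
  have cong: "emp N x b = emp N x (\<lambda>_. a0)" "emp_minus N i x b = emp_minus N i x (\<lambda>_. a0)" for x i
    unfolding emp_def emp_minus_def by (intro empirical_cong; simp add: b)+
  have "nemytskii U (\<lambda>_. 0) b i = 0" if "i < N" for i
    using fun_cong[OF \<alpha>(1), of i] that unfolding \<alpha>_a0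
    by (simp add: nemytskii_def U_def b cong flip: emp_eq_law)
  moreover have "self_interaction N (\<lambda>_. 0) b i = 0" if "i < N" for i
    using self0[OF that] that by (simp add: self_interaction_def b cong)
  ultimately have "solves_system L N (\<lambda>_. 0) (\<lambda>_. 0) (restrict (\<lambda>_. a0) {..<N})"
    unfolding solves_system_iff[OF N2] U_def[symmetric] b_def[symmetric] by (auto simp: b_def)
  then show ?thesis using self0 that by blast
qed

text \<open>The fixed point and the finite-player control solve the mean field equation on the same
  states, with momenta that differ by the self-interaction. The latter vanishes at the origin, so
  that its Lipschitz bound turns into the bound \<open>C / N\<close> times the norm of the data.\<close>

lemma Phi_emp_dist_le:
  "wdist 2 (Phi L (emp N x p)) (emp N x (aN L N x p))
    \<le> 9 * K / (\<gamma> * N) * (2 + (2 + 4 * K) / \<gamma>) * (L2_norm U x + L2_norm U p)"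
proof -
  define a where "a = aN L N x p"
  have a: "solves_system L N x p a" unfolding a_def by (rule solves_system_aN)
  have Phi: "is_Phi L (law U (\<lambda>i. (x i, p i))) (Phi L (emp N x p))"
    using is_Phi_Phi[OF emp_P2] by (simp add: emp_eq_law U_def)
  obtain \<alpha> where \<alpha>: "law U (\<lambda>i. (x i, \<alpha> i)) = Phi L (emp N x p)" "nemytskii U x \<alpha> = (\<lambda>i. - p i)"
    by (rule is_Phi_lift[OF U_prob U_L2 U_L2 Phi]) blast
  obtain a0 where a0: "solves_system L N (\<lambda>_. 0) (\<lambda>_. 0) (restrict (\<lambda>_. a0) {..<N})"
    "\<And>i. i < N \<Longrightarrow> self_interaction N (\<lambda>_. 0) (\<lambda>_. a0) i = 0"
    by (rule solves_system_origin) blast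
  have "L2_norm U (\<lambda>i. a i - a0) = L2_norm U (\<lambda>i. a i - restrict (\<lambda>_. a0) {..<N} i)"
    by (rule L2_norm_cong) (simp add: U_space)
  also have "\<dots> \<le> (1 + (2 + 4 * K) / \<gamma>) * (L2_norm U x + L2_norm U p)"
    using solves_system_dist_le[OF a a0(1)] by simp
  finally have a_le: "L2_norm U (\<lambda>i. a i - a0) \<le> (1 + (2 + 4 * K) / \<gamma>) * (L2_norm U x + L2_norm U p)" .
  have "L2_norm U (\<lambda>i. nemytskii U x \<alpha> i - nemytskii U x a i)
      = L2_norm U (\<lambda>i. self_interaction N x a i - self_interaction N (\<lambda>_. 0) (\<lambda>_. a0) i)"
    using a unfolding solves_system_iff[OF N2] U_def[symmetric]
    by (intro L2_norm_cong) (auto simp: \<alpha>(2) a0(2) U_space)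
  also have "\<dots> \<le> 9 * K / N * (L2_norm U x + L2_norm U (\<lambda>i. a i - a0))"
    using self_interaction_lipschitz[OF N2, of x a "\<lambda>_. 0" "\<lambda>_. a0", folded U_def] by simp
  also have "\<dots> \<le> 9 * K / N * ((2 + (2 + 4 * K) / \<gamma>) * (L2_norm U x + L2_norm U p))"
    using a_le K L2_norm_nonneg[of U p] by (intro mult_left_mono) (auto simp: algebra_simps)
  finally have "\<gamma> * L2_norm U (\<lambda>i. \<alpha> i - a i) \<le> 9 * K / N * ((2 + (2 + 4 * K) / \<gamma>) * (L2_norm U x + L2_norm U p))"
    using control_estimate[OF U_prob U_L2 U_L2 U_L2 U_L2, of \<alpha> a x x] U.L2_norm_const[of "0::'d vec"] by simp
  then have \<alpha>_le: "L2_norm U (\<lambda>i. \<alpha> i - a i) \<le> 9 * K / (\<gamma> * N) * (2 + (2 + 4 * K) / \<gamma>) * (L2_norm U x + L2_norm U p)"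
    using \<gamma> by (simp add: mult.assoc pos_le_divide_eq[symmetric] mult.commute[of \<gamma>])
  have "wdist 2 (Phi L (emp N x p)) (emp N x a) \<le> L2_norm U (\<lambda>i. (x i, \<alpha> i) - (x i, a i))"
    unfolding \<alpha>(1)[symmetric] emp_eq_law[of N x a] U_def[symmetric] by (intro U.wdist_2_law_le U_L2)
  also have "\<dots> = L2_norm U (\<lambda>i. \<alpha> i - a i)" by (simp add: L2_norm_def norm_Pair)
  finally show ?thesis using \<alpha>_le by (simp add: a_def)
qed

end

end

section \<open>Consequences of the assumptions on the data\<close>

text \<open>Differentiability of the lift presupposes a random variable with the given law.\<close>

lemma fully_C2_bounded_realize:
  fixes F :: "'z::euclidean_space \<Rightarrow> 'y::euclidean_space measure \<Rightarrow> real" and \<mu> :: "'y measure"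
  assumes "fully_C2_bounded \<Omega> F" "\<mu> \<in> P2"
  shows "\<exists>X\<in>borel_measurable \<Omega>. law \<Omega> X = \<mu>"
proof -
  obtain \<xi> where "has_lions_derivative \<Omega> (F 0) \<xi> \<mu>"
    using assms unfolding fully_C2_bounded_def by blast
  then show ?thesis unfolding has_lions_derivative_def L2_def by blast
qed

lemma fully_C2_bounded_gradient:
  fixes F :: "'z::euclidean_space \<Rightarrow> 'y::euclidean_space measure \<Rightarrow> real"
  assumes "fully_C2_bounded \<Omega> F"
  obtains Dz K where "\<And>z \<mu>. \<mu> \<in> P2 \<Longrightarrow> GDERIV (\<lambda>z. F z \<mu>) z :> Dz z \<mu>"
    and "\<And>z \<mu>. \<mu> \<in> P2 \<Longrightarrow> (\<lambda>z. Dz z \<mu>) differentiable (at z)"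
    and "\<And>z z' \<mu>. \<mu> \<in> P2 \<Longrightarrow> norm (Dz z \<mu> - Dz z' \<mu>) \<le> K * norm (z - z')"
proof -
  have "\<exists>(Dz :: 'z \<Rightarrow> 'y measure \<Rightarrow> 'z) (Dzz :: 'z \<Rightarrow> 'y measure \<Rightarrow> 'z \<Rightarrow>\<^sub>L 'z) K. \<forall>z. \<forall>\<mu>\<in>P2.
      (GDERIV (\<lambda>z. F z \<mu>) z :> Dz z \<mu>) \<and>
      ((\<lambda>z. Dz z \<mu>) has_derivative blinfun_apply (Dzz z \<mu>)) (at z) \<and> norm (Dzz z \<mu>) \<le> K"
    using assms unfolding fully_C2_bounded_def
    apply (elim exE conjE)
    subgoal for Dz Dm Dzz Dzm Dym Dmm K
      by (rule exI[of _ Dz], rule exI[of _ Dzz], rule exI[of _ K]) blast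
    done
  then obtain Dz :: "'z \<Rightarrow> 'y measure \<Rightarrow> 'z" and Dzz :: "'z \<Rightarrow> 'y measure \<Rightarrow> 'z \<Rightarrow>\<^sub>L 'z" and K
    where D: "\<And>z \<mu>. \<mu> \<in> P2 \<Longrightarrow> GDERIV (\<lambda>z. F z \<mu>) z :> Dz z \<mu>"
      "\<And>z \<mu>. \<mu> \<in> P2 \<Longrightarrow> ((\<lambda>z. Dz z \<mu>) has_derivative blinfun_apply (Dzz z \<mu>)) (at z)"
      "\<And>z \<mu>. \<mu> \<in> P2 \<Longrightarrow> norm (Dzz z \<mu>) \<le> K"
    by blast
  have "norm (Dz z \<mu> - Dz z' \<mu>) \<le> K * norm (z - z')" if "\<mu> \<in> P2" for z z' \<mu>
    by (rule differentiable_bound[OF convex_UNIV D(2)[OF that]])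
       (use D(3)[OF that] in \<open>auto simp: norm_blinfun.rep_eq\<close>)
  moreover have "(\<lambda>z. Dz z \<mu>) differentiable (at z)" if "\<mu> \<in> P2" for z \<mu>
    using D(2)[OF that] unfolding differentiable_def by blast
  ultimately show ?thesis using that D(1) by blast
qed

lemma strongly_mono_of_derivative:
  fixes g :: "'a::euclidean_space \<Rightarrow> 'a"
  assumes g: "\<And>x. (g has_derivative g' x) (at x)" and pos: "\<And>x v. c * (norm v)\<^sup>2 \<le> v \<bullet> g' x v"
  shows "c * (norm (a - a'))\<^sup>2 \<le> (g a - g a') \<bullet> (a - a')"
proof -
  define v where "v = a - a'"
  define \<phi> where "\<phi> t = g (a' + t *\<^sub>R v) \<bullet> v" for t
  have \<phi>: "(\<phi> has_derivative (\<lambda>s. g' (a' + t *\<^sub>R v) (s *\<^sub>R v) \<bullet> v)) (at t)" for t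
    unfolding \<phi>_def
    by (intro has_derivative_inner_left has_derivative_compose[OF _ g])
       (auto intro!: derivative_eq_intros)
  then have "continuous_on {0..1} \<phi>"
    by (meson has_derivative_continuous continuous_at_imp_continuous_on)
  then obtain t where "\<phi> 1 - \<phi> 0 = g' (a' + t *\<^sub>R v) ((1 - 0) *\<^sub>R v) \<bullet> v"
    using mvt[of 0 1 \<phi>, OF _ _ \<phi>] by auto
  then have "c * (norm v)\<^sup>2 \<le> \<phi> 1 - \<phi> 0" using pos[of v] by (simp add: inner_commute)
  then show ?thesis by (simp add: \<phi>_def v_def inner_diff_left)
qed

lemma displacement_monotone_lagrangian_ex:
  fixes L :: "'d::finite lagrangian"
  assumes R: "assumption_R \<Omega> L G" and M: "assumption_M \<Omega> T L G"
  shows "\<exists>f K c \<gamma>. displacement_monotone_lagrangian L f K c \<gamma>"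
proof -
  have C2: "fully_C2_bounded \<Omega> (\<lambda>(x, a). L x a)" using R by (simp add: assumption_R_def)
  from C2 obtain Dz KL where Dz: "\<And>z \<mu>. \<mu> \<in> P2 \<Longrightarrow> GDERIV (\<lambda>z. (\<lambda>(x, a). L x a) z \<mu>) z :> Dz z \<mu>"
    "\<And>z \<mu>. \<mu> \<in> P2 \<Longrightarrow> (\<lambda>z. Dz z \<mu>) differentiable (at z)"
    "\<And>z z' \<mu>. \<mu> \<in> P2 \<Longrightarrow> norm (Dz z \<mu> - Dz z' \<mu>) \<le> KL * norm (z - z')"
    by (rule fully_C2_bounded_gradient) blast
  have grad: "GDERIV (\<lambda>a. L x a \<mu>) a :> snd (Dz (x, a) \<mu>)" if "\<mu> \<in> P2" for x a \<mu>
  proof -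
    have "((\<lambda>z. (\<lambda>(x, a). L x a) z \<mu>) has_derivative (\<lambda>h. h \<bullet> Dz (x, a) \<mu>)) (at (x, a))"
      using Dz(1)[OF that] by (simp add: gderiv_def)
    then have "((\<lambda>b. (\<lambda>(x, a). L x a) (x, b) \<mu>) has_derivative (\<lambda>h. (0, h) \<bullet> Dz (x, a) \<mu>)) (at a)"
      by (rule has_derivative_compose[rotated]) (auto intro!: derivative_eq_intros)
    then show ?thesis by (simp add: gderiv_def inner_prod_def)
  qed
  then have D_aL: "D_aL L x a \<mu> = snd (Dz (x, a) \<mu>)" if "\<mu> \<in> P2" for x a \<mu>
    unfolding D_aL_def using that by (intro gradient_eqI)
  obtain c where c: "c > 0" "\<And>x a \<mu> v. \<mu> \<in> P2 \<Longrightarrow>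
      c * (norm v)\<^sup>2 \<le> v \<bullet> frechet_derivative (\<lambda>a. D_aL L x a \<mu>) (at a) v"
    using R unfolding assumption_R_def by blast
  have mono: "c * (norm (a - a'))\<^sup>2 \<le> (D_aL L x a \<mu> - D_aL L x a' \<mu>) \<bullet> (a - a')" if "\<mu> \<in> P2" for x a a' \<mu>
  proof (rule strongly_mono_of_derivative[OF _ c(2)[OF that]])
    fix b
    have "(\<lambda>b. Dz (x, b) \<mu>) differentiable (at b)"
      by (rule differentiable_compose[OF Dz(2)[OF that]]) (auto intro!: derivative_intros)
    then have "(\<lambda>b. snd (Dz (x, b) \<mu>)) differentiable (at b)"
      unfolding differentiable_def by (auto intro!: has_derivative_snd)
    then show "((\<lambda>b. D_aL L x b \<mu>) has_derivative frechet_derivative (\<lambda>b. D_aL L x b \<mu>) (at b)) (at b)"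
      unfolding D_aL[OF that] by (simp add: frechet_derivative_works)
  qed
  obtain C where C: "C > 0" "\<And>x a \<mu>. \<mu> \<in> P2 \<Longrightarrow>
      (1 / C) * (norm a)\<^sup>2 - C * (1 + (norm x)\<^sup>2 + wdist 2 \<mu> (return borel 0)) \<le> L x a \<mu>"
    using R unfolding assumption_R_def by blast
  have D_pH: "- D_pH L x p \<mu> = a \<longleftrightarrow> D_aL L x a \<mu> = - p" if "\<mu> \<in> P2" for x p a \<mu>
    unfolding D_pH_def hamiltonian_def
    by (rule strongly_convex_legendre[where k = "1 / C" and c = c and
          C = "C * (1 + (norm x)\<^sup>2 + wdist 2 \<mu> (return borel 0))"])
       (use grad[OF that] D_aL[OF that] mono[OF that] c(1) C(1) C(2)[OF that] in auto)
  obtain f Kf where f: "\<And>z \<mu>. \<mu> \<in> P2 \<Longrightarrow> has_flat_derivative ((\<lambda>(x, a). D_aL L x a) z) (f z \<mu>) \<mu>"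
    "\<And>z z' y y' \<mu> \<mu>'. \<mu> \<in> P2 \<Longrightarrow> \<mu>' \<in> P2 \<Longrightarrow>
      norm (f z \<mu> y - f z' \<mu>' y') \<le> Kf * (dist z z' + wdist 1 \<mu> \<mu>' + dist y y')"
  proof -
    have "lipschitz_flat_derivative (\<lambda>(x, a). D_aL L x a)" using R by (simp add: assumption_R_def)
    then show ?thesis unfolding lipschitz_flat_derivative_def using that by blast
  qed
  define K where "K = max 1 (max KL Kf)"
  have K: "K > 0" "KL \<le> K" "Kf \<le> K" by (auto simp: K_def)
  have lip: "norm (D_aL L x a \<mu> - D_aL L x' a' \<mu>) \<le> K * (norm (x - x') + norm (a - a'))"
    if "\<mu> \<in> P2" for x a x' a' \<mu>
  proof -
    have "norm (D_aL L x a \<mu> - D_aL L x' a' \<mu>) \<le> norm (Dz (x, a) \<mu> - Dz (x', a') \<mu>)"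
      using norm_snd_le'[of "Dz (x, a) \<mu> - Dz (x', a') \<mu>"] by (simp add: D_aL[OF that])
    also have "\<dots> \<le> KL * norm ((x, a) - (x', a'))" by (rule Dz(3)[OF that])
    also have "\<dots> \<le> K * norm ((x, a) - (x', a'))" by (intro mult_right_mono K) simp
    also have "\<dots> \<le> K * (norm (x - x') + norm (a - a'))"
      using K norm_Pair_le[of "x - x'" "a - a'"] by (intro mult_left_mono) auto
    finally show ?thesis .
  qed
  obtain \<gamma> C_Lx where \<gamma>: "\<gamma> > 0" and disp: "\<And>X X' \<alpha> \<alpha>'. X \<in> L2 \<Omega> \<Longrightarrow> X' \<in> L2 \<Omega> \<Longrightarrow> \<alpha> \<in> L2 \<Omega> \<Longrightarrow> \<alpha>' \<in> L2 \<Omega> \<Longrightarrow>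
      \<gamma> * (\<integral>\<omega>. (norm (\<alpha> \<omega> - \<alpha>' \<omega>))\<^sup>2 \<partial>\<Omega>) - C_Lx * (\<integral>\<omega>. (norm (X \<omega> - X' \<omega>))\<^sup>2 \<partial>\<Omega>)
      \<le> (\<integral>\<omega>. (D_aL L (X \<omega>) (\<alpha> \<omega>) (law \<Omega> (\<lambda>\<omega>. (X \<omega>, \<alpha> \<omega>))) - D_aL L (X' \<omega>) (\<alpha>' \<omega>) (law \<Omega> (\<lambda>\<omega>. (X' \<omega>, \<alpha>' \<omega>)))) \<bullet> (\<alpha> \<omega> - \<alpha>' \<omega>)
        + (D_xL L (X \<omega>) (\<alpha> \<omega>) (law \<Omega> (\<lambda>\<omega>. (X \<omega>, \<alpha> \<omega>))) - D_xL L (X' \<omega>) (\<alpha>' \<omega>) (law \<Omega> (\<lambda>\<omega>. (X' \<omega>, \<alpha>' \<omega>)))) \<bullet> (X \<omega> - X' \<omega>) \<partial>\<Omega>)"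
    using M unfolding assumption_M_def Let_def by blast
  have law_mono: "\<gamma> * (\<integral>(x, a, a'). (norm (a - a'))\<^sup>2 \<partial>\<pi>)
      \<le> (\<integral>(x, a, a'). (D_aL L x a (law \<pi> (\<lambda>(x, a, a'). (x, a)))
          - D_aL L x a' (law \<pi> (\<lambda>(x, a, a'). (x, a')))) \<bullet> (a - a') \<partial>\<pi>)"
    if \<pi>: "\<pi> \<in> P2" for \<pi> :: "('d vec \<times> 'd vec \<times> 'd vec) measure"
  proof -
    obtain Z where Z: "Z \<in> L2 \<Omega>" "law \<Omega> Z = \<pi>"
      using realize_law[OF fully_C2_bounded_realize[OF C2] \<pi>] by blast
    define X where "X \<omega> = fst (Z \<omega>)" for \<omega>
    define \<alpha> where "\<alpha> \<omega> = fst (snd (Z \<omega>))" for \<omega>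
    define \<alpha>' where "\<alpha>' \<omega> = snd (snd (Z \<omega>))" for \<omega>
    have L2: "X \<in> L2 \<Omega>" "\<alpha> \<in> L2 \<Omega>" "\<alpha>' \<in> L2 \<Omega>"
      unfolding X_def \<alpha>_def \<alpha>'_def by (intro L2_fst L2_snd Z)+
    note [measurable] = L2D(1)[OF Z(1)]
    have m1: "(\<lambda>(x::'d vec, a::'d vec, a'::'d vec). (x, a)) \<in> borel_measurable borel"
      and m2: "(\<lambda>(x::'d vec, a::'d vec, a'::'d vec). (x, a')) \<in> borel_measurable borel"
      unfolding case_prod_beta' by measurable
    have laws: "law \<pi> (\<lambda>(x, a, a'). (x, a)) = law \<Omega> (\<lambda>\<omega>. (X \<omega>, \<alpha> \<omega>))"
      "law \<pi> (\<lambda>(x, a, a'). (x, a')) = law \<Omega> (\<lambda>\<omega>. (X \<omega>, \<alpha>' \<omega>))"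
      unfolding Z(2)[symmetric] distr_distr[OF m1 L2D(1)[OF Z(1)]] distr_distr[OF m2 L2D(1)[OF Z(1)]]
      by (simp_all add: comp_def case_prod_beta' X_def \<alpha>_def \<alpha>'_def)
    have "prob_space \<pi>" using \<pi> by (rule P2D)
    have id: "(\<lambda>z. z) \<in> L2 \<pi>" by (rule P2_id_L2[OF \<pi>])
    have P2: "law \<pi> (\<lambda>(x, a, a'). (x, a)) \<in> P2" "law \<pi> (\<lambda>(x, a, a'). (x, a')) \<in> P2"
      unfolding case_prod_beta'
      by (intro prob_space.law_P2[OF \<open>prob_space \<pi>\<close>] L2_Pair L2_fst[OF id] L2_fst[OF L2_snd[OF id]] L2_snd[OF L2_snd[OF id]])+
    have "\<gamma> * (\<integral>\<omega>. (norm (\<alpha> \<omega> - \<alpha>' \<omega>))\<^sup>2 \<partial>\<Omega>)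
        \<le> (\<integral>\<omega>. (D_aL L (X \<omega>) (\<alpha> \<omega>) (law \<pi> (\<lambda>(x, a, a'). (x, a)))
          - D_aL L (X \<omega>) (\<alpha>' \<omega>) (law \<pi> (\<lambda>(x, a, a'). (x, a')))) \<bullet> (\<alpha> \<omega> - \<alpha>' \<omega>) \<partial>\<Omega>)"
      using disp[OF L2(1,1,2,3)] unfolding laws by simp
    also have "(\<integral>\<omega>. (norm (\<alpha> \<omega> - \<alpha>' \<omega>))\<^sup>2 \<partial>\<Omega>) = (\<integral>(x, a, a'). (norm (a - a'))\<^sup>2 \<partial>\<pi>)"
      unfolding Z(2)[symmetric] case_prod_beta' by (subst integral_distr) (auto simp: \<alpha>_def \<alpha>'_def)
    also have "(\<integral>\<omega>. (D_aL L (X \<omega>) (\<alpha> \<omega>) (law \<pi> (\<lambda>(x, a, a'). (x, a)))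
          - D_aL L (X \<omega>) (\<alpha>' \<omega>) (law \<pi> (\<lambda>(x, a, a'). (x, a')))) \<bullet> (\<alpha> \<omega> - \<alpha>' \<omega>) \<partial>\<Omega>)
        = (\<integral>(x, a, a'). (D_aL L x a (law \<pi> (\<lambda>(x, a, a'). (x, a)))
          - D_aL L x a' (law \<pi> (\<lambda>(x, a, a'). (x, a')))) \<bullet> (a - a') \<partial>law \<Omega> Z)"
      unfolding case_prod_beta'
      by (subst integral_distr)
         (use P2[unfolded case_prod_beta'] K in \<open>auto simp: X_def \<alpha>_def \<alpha>'_def
            intro!: borel_measurable_inner borel_measurable_diff lipschitz_pair_measurable[OF lip]\<close>)
    finally show ?thesis by (simp only: Z(2))
  qed
  have "displacement_monotone_lagrangian L f K c \<gamma>"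
  proof
    fix \<mu> \<mu>' :: "('d vec \<times> 'd vec) measure" and z z' y y' :: "'d vec \<times> 'd vec" and x a
    show "has_flat_derivative (D_aL L x a) (f (x, a) \<mu>) \<mu>" if "\<mu> \<in> P2" using f(1)[OF that, of "(x, a)"] by simp
    show "norm (f z \<mu> y - f z' \<mu>' y') \<le> K * (norm (z - z') + wdist 1 \<mu> \<mu>' + norm (y - y'))"
      if "\<mu> \<in> P2" "\<mu>' \<in> P2"
    proof -
      have "norm (f z \<mu> y - f z' \<mu>' y') \<le> Kf * (dist z z' + wdist 1 \<mu> \<mu>' + dist y y')" by (rule f(2)[OF that])
      also have "\<dots> \<le> K * (dist z z' + wdist 1 \<mu> \<mu>' + dist y y')"
        by (intro mult_right_mono K) (simp add: wdist_def)
      finally show ?thesis by (simp add: dist_norm)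
    qed
  qed (fact K c \<gamma> lip mono D_pH law_mono)+
  then show ?thesis by blast
qed

section \<open>The fixed-point map and its finite-player approximation\<close>

theorem proposition1p5:
  fixes \<Omega> :: "'w measure" and T :: real
    and L :: "'d::finite lagrangian" and G :: "'d terminal_cost"
  assumes "atomless_prob_space \<Omega>"
    and "T > 0"
    and "assumption_R \<Omega> L G"
    and "assumption_M \<Omega> T L G"
  shows "((\<forall>\<nu>\<in>P2. \<exists>!\<mu>. is_Phi L \<nu> \<mu>) \<and>
          (\<exists>C. \<forall>\<nu>\<in>P2. \<forall>\<nu>'\<in>P2. wdist 2 (Phi L \<nu>) (Phi L \<nu>') \<le> C * wdist 2 \<nu> \<nu>')) \<and>
         ((\<forall>\<^sub>F N in sequentially. \<forall>x p. \<exists>!a. solves_system L N x p a) \<and>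
          (\<exists>C. \<forall>\<^sub>F N in sequentially. \<forall>x p x' p'.
             (\<Sum>i<N. (norm (aN L N x p i - aN L N x' p' i))\<^sup>2)
             \<le> C * (\<Sum>i<N. (norm (x i - x' i))\<^sup>2 + (norm (p i - p' i))\<^sup>2))) \<and>
         (\<exists>C. \<forall>\<^sub>F N in sequentially. \<forall>x p.
             (wdist 2 (Phi L (emp N x p)) (emp N x (aN L N x p)))\<^sup>2
             \<le> C / (real N)\<^sup>2 * (\<Sum>i<N. (norm (x i))\<^sup>2 + (norm (p i))\<^sup>2))"
proof -
  obtain f K c \<gamma> where "displacement_monotone_lagrangian L f K c \<gamma>"
    using displacement_monotone_lagrangian_ex[OF assms(3,4)] by blast
  then interpret displacement_monotone_lagrangian L f K c \<gamma> .
  define B where "B = 1 + (2 + 4 * K) / \<gamma>"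
  define B' where "B' = 9 * K / \<gamma> * (2 + (2 + 4 * K) / \<gamma>)"
  have aN: "(\<Sum>i<N. (norm (aN L N x p i - aN L N x' p' i))\<^sup>2)
      \<le> 2 * B\<^sup>2 * (\<Sum>i<N. (norm (x i - x' i))\<^sup>2 + (norm (p i - p' i))\<^sup>2)" if N: "many_players N" for N x p x' p'
  proof -
    let ?U = "uniform_count_measure {..<N}"
    let ?r = "L2_norm ?U (\<lambda>i. x i - x' i) + L2_norm ?U (\<lambda>i. p i - p' i)"
    have "(\<Sum>i<N. (norm (aN L N x p i - aN L N x' p' i))\<^sup>2)
        = real N * (L2_norm ?U (\<lambda>i. aN L N x p i - aN L N x' p' i))\<^sup>2"
      using N by (simp add: L2_norm_uniform_count_sq many_players_def)
    also have "\<dots> \<le> real N * (B * ?r)\<^sup>2"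
      unfolding B_def
      by (intro mult_left_mono power_mono solves_system_dist_le[OF N] solves_system_aN[OF N] L2_norm_nonneg) simp
    also have "\<dots> = B\<^sup>2 * (real N * ?r\<^sup>2)" by (simp add: power_mult_distrib)
    also have "\<dots> \<le> B\<^sup>2 * (2 * (\<Sum>i<N. (norm (x i - x' i))\<^sup>2 + (norm (p i - p' i))\<^sup>2))"
      using N by (intro mult_left_mono sum_squares_uniform_count) (auto simp: many_players_def)
    finally show ?thesis by simp
  qed
  have Phi_emp: "(wdist 2 (Phi L (emp N x p)) (emp N x (aN L N x p)))\<^sup>2
      \<le> 2 * B'\<^sup>2 / (real N)\<^sup>2 * (\<Sum>i<N. (norm (x i))\<^sup>2 + (norm (p i))\<^sup>2)" if N: "many_players N" for N x p
  proof -
    let ?U = "uniform_count_measure {..<N}"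
    let ?r = "L2_norm ?U x + L2_norm ?U p"
    have "(wdist 2 (Phi L (emp N x p)) (emp N x (aN L N x p)))\<^sup>2 \<le> (B' / N * ?r)\<^sup>2"
      using Phi_emp_dist_le[OF N, of x p] by (intro power_mono) (auto simp: B'_def wdist_def)
    also have "\<dots> = B'\<^sup>2 / (real N)\<^sup>2 * ?r\<^sup>2" by (simp add: power_mult_distrib power_divide)
    also have "\<dots> \<le> B'\<^sup>2 / (real N)\<^sup>2 * (2 * (\<Sum>i<N. (norm (x i))\<^sup>2 + (norm (p i))\<^sup>2))"
    proof (rule mult_left_mono)
      have "?r\<^sup>2 \<le> real N * ?r\<^sup>2"
        using N mult_right_mono[of 1 "real N" "?r\<^sup>2"] by (simp add: many_players_def)
      also have "\<dots> \<le> 2 * (\<Sum>i<N. (norm (x i))\<^sup>2 + (norm (p i))\<^sup>2)" using N by (intro sum_squares_uniform_count) (simp add: many_players_def)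
      finally show "?r\<^sup>2 \<le> 2 * (\<Sum>i<N. (norm (x i))\<^sup>2 + (norm (p i))\<^sup>2)" .
    qed simp
    finally show ?thesis by (simp add: mult_ac)
  qed
  have system: "\<exists>!a. solves_system L N x p a" if "many_players N" for N x p
    using solves_system_ex[OF that] solves_system_unique[OF that] by blast
  have Phi: "\<exists>!\<mu>. is_Phi L \<nu> \<mu>" if "\<nu> \<in> P2" for \<nu>
    using is_Phi_ex[OF that] is_Phi_unique[OF that] by blast
  note many = eventually_mono[OF eventually_many_players]
  show ?thesis
  proof (intro conjI)
    show "\<forall>\<nu>\<in>P2. \<exists>!\<mu>. is_Phi L \<nu> \<mu>" using Phi by blast
    show "\<exists>C. \<forall>\<nu>\<in>P2. \<forall>\<nu>'\<in>P2. wdist 2 (Phi L \<nu>) (Phi L \<nu>') \<le> C * wdist 2 \<nu> \<nu>'"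
      using Phi_lipschitz by blast
    show "\<forall>\<^sub>F N in sequentially. \<forall>x p. \<exists>!a. solves_system L N x p a"
      by (rule many) (use system in blast)
    show "\<exists>C. \<forall>\<^sub>F N in sequentially. \<forall>x p x' p'.
        (\<Sum>i<N. (norm (aN L N x p i - aN L N x' p' i))\<^sup>2)
        \<le> C * (\<Sum>i<N. (norm (x i - x' i))\<^sup>2 + (norm (p i - p' i))\<^sup>2)"
      by (rule exI[of _ "2 * B\<^sup>2"], rule many) (use aN in blast)
    show "\<exists>C. \<forall>\<^sub>F N in sequentially. \<forall>x p.
        (wdist 2 (Phi L (emp N x p)) (emp N x (aN L N x p)))\<^sup>2
        \<le> C / (real N)\<^sup>2 * (\<Sum>i<N. (norm (x i))\<^sup>2 + (norm (p i))\<^sup>2)"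
      by (rule exI[of _ "2 * B'\<^sup>2"], rule many) (use Phi_emp in blast)
  qed
qed

end
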